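(* Let $\mathbb{F}$ be a finite field, let $\lambda,\kappa,\mu,S,\ell,K_c$ be positive integers, put $L=\ell K_c$, and suppose $L\le |\mathbb{F}|-S$ and $S\ge (\ell+1)K_c-1$. Then for coded distributed batch matrix multiplication (CDBMM) over $\mathbb{F}$ with $S$ servers and batch size $L$ (with $\mathbf{A}_l\in\mathbb{F}^{\lambda\times\kappa}$, $\mathbf{B}_l\in\mathbb{F}^{\kappa\times\mu}$ for $l\in[L]$) there exists a CDBMM code that simultaneously achieves: (i) recovery threshold $R=(\ell+1)K_c-1$; (ii) upload costs $(U_A,U_B)=\left(\frac{S}{K_c},\frac{S}{K_c}\right)$; (iii) download cost $D=\frac{(\ell+1)K_c-1}{\ell K_c}$; (iv) server computation complexity $\mathcal{C}_s=\mathcal{O}(\lambda\kappa\mu/K_c)$; (v) encoding complexities $(\mathcal{C}_{eA},\mathcal{C}_{eB})=\left(\widetilde{\mathcal{O}}\left(\frac{\lambda\kappa S\log^2 S}{K_c}\right),\widetilde{\mathcal{O}}\left(\frac{\kappa\mu S\log^2 S}{K_c}\right)\right)$; (vi) decoding complexity $\mathcal{C}_d=\widetilde{\mathcal{O}}(\lambda\mu\log^2 R)$.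
   Context: Notation: $[n]=\{1,\dots,n\}$. CDBMM problem. One source holds $\mathbf{A}=(\mathbf{A}_1,\dots,\mathbf{A}_L)$ with $\mathbf{A}_l\in\mathbb{F}^{\lambda\times\kappa}$, another holds $\mathbf{B}=(\mathbf{B}_1,\dots,\mathbf{B}_L)$ with $\mathbf{B}_l\in\mathbb{F}^{\kappa\times\mu}$. A user wants $\mathbf{A}\mathbf{B}=(\mathbf{A}_1\mathbf{B}_1,\dots,\mathbf{A}_L\mathbf{B}_L)$. A CDBMM code $(\boldsymbol{f},\boldsymbol{g},\boldsymbol{h},\boldsymbol{d})$ consists of encoding functions $\boldsymbol{f}=(f_1,\dots,f_S)$, $\boldsymbol{g}=(g_1,\dots,g_S)$, answer functions $\boldsymbol{h}=(h_1,\dots,h_S)$ and decoding functions $\boldsymbol{d}=\{d_{\mathcal{R}}:\mathcal{R}\subset[S]\}$. Server $s$ receives $\widetilde{A}^s=f_s(\mathbf{A})$ and $\widetilde{B}^s=g_s(\mathbf{B})$ (tuples of elements of $\mathbb{F}$) and computes the answer $Y_s=h_s(\widetilde{A}^s,\widetilde{B}^s)$ (a tuple of elements of $\mathbb{F}$). The code is $r$-recoverable if for every $\mathcal{R}\subset[S]$ with $|\mathcal{R}|=r$ and all $\mathbf{A},\mathbf{B}$, $\mathbf{A}\mathbf{B}=d_{\mathcal{R}}((Y_s)_{s\in\mathcal{R}})$. The recovery threshold $R$ of the code is the minimum integer $r$ such that the code is $r$-recoverable. Costs. $|\cdot|$ denotes the number of elements of $\mathbb{F}$ in a tuple. Upload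 costs: $U_A=\frac{\sum_{s\in[S]}|\widetilde{A}^s|}{L\lambda\kappa}$, $U_B=\frac{\sum_{s\in[S]}|\widetilde{B}^s|}{L\kappa\mu}$. Download cost: $D=\max_{\mathcal{R}\subset[S],|\mathcal{R}|=R}\frac{\sum_{s\in\mathcal{R}}|Y_s|}{L\lambda\mu}$. Complexities are orders of the number of arithmetic operations in $\mathbb{F}$, normalized (divided) by $L$: $\mathcal{C}_s$ for computing $h_s$ at each server; $\mathcal{C}_{eA}$ and $\mathcal{C}_{eB}$ for computing all of $\boldsymbol{f}$ and all of $\boldsymbol{g}$, respectively; $\mathcal{C}_d$ for computing $d_{\mathcal{R}}((Y_s)_{s\in\mathcal{R}})$, maximized over $\mathcal{R}\subset[S]$ with $|\mathcal{R}|=R$. The notation $\widetilde{\mathcal{O}}(a\log^2 b)$ means $\mathcal{O}(a\log^2 b)$ if the field supports the Fast Fourier Transform, and $\mathcal{O}(a\log^2 b\,\log\log b)$ otherwise. The $\mathcal{O}$ statements are asymptotic order statements with constants not depending on the parameters. *)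

theory Defs
  imports
    Jordan_Normal_Form.Matrix
    "HOL-Algebra.Multiplicative_Group"
    "HOL-Library.Extended_Real"
begin

text \<open>
  The finite field is a structure F with an explicit carrier rather than a type of class
  \<open>field\<close>: the constants in the order bounds must not depend on the field, so the field has to be
  quantified inside the existential quantifier over the constant. (Every finite field is isomorphic
  to one whose carrier consists of elements of any given infinite type.) Types from
  \<open>Jordan_Normal_Form\<close> serve only as containers for matrices; products use the operations of F.
\<close>

section \<open>Arithmetic complexity over a field\<close>

text \<open>
  Straight-line programs: the memory initially holds the input tuple, each instruction performs one
  arithmetic operation and appends its result, and the outputs are read off without cost. Field
  constants are free, division by zero and reading an undefined register are failures.
\<close>

datatype arith_op = Plus | Minus | Times | Divide

datatype 'a operand = Const 'a | Reg nat

datatype 'a instr = Instr arith_op "'a operand" "'a operand"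

fun operand_val :: "'a ring \<Rightarrow> 'a list \<Rightarrow> 'a operand \<Rightarrow> 'a option" where
  "operand_val F mem (Const c) = (if c \<in> carrier F then Some c else None)"
| "operand_val F mem (Reg i) = (if i < length mem then Some (mem ! i) else None)"

fun apply_op :: "'a ring \<Rightarrow> arith_op \<Rightarrow> 'a \<Rightarrow> 'a \<Rightarrow> 'a option" where
  "apply_op F Plus a b = Some (a \<oplus>\<^bsub>F\<^esub> b)"
| "apply_op F Minus a b = Some (a \<ominus>\<^bsub>F\<^esub> b)"
| "apply_op F Times a b = Some (a \<otimes>\<^bsub>F\<^esub> b)"
| "apply_op F Divide a b = (if b = \<zero>\<^bsub>F\<^esub> then None else Some (a \<otimes>\<^bsub>F\<^esub> inv\<^bsub>F\<^esub> b))"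

fun exec :: "'a ring \<Rightarrow> 'a instr list \<Rightarrow> 'a list \<Rightarrow> 'a list option" where
  "exec F [] mem = Some mem"
| "exec F (Instr f x y # p) mem =
     Option.bind (operand_val F mem x) (\<lambda>a.
     Option.bind (operand_val F mem y) (\<lambda>b.
     Option.bind (apply_op F f a b) (\<lambda>c. exec F p (mem @ [c]))))"

definition run_slp :: "'a ring \<Rightarrow> 'a instr list \<Rightarrow> 'a operand list \<Rightarrow> 'a list \<Rightarrow> 'a list option" where
  "run_slp F p outs xs =
     Option.bind (exec F p xs) (\<lambda>mem. those (map (operand_val F mem) outs))"

text \<open>
  The least number of arithmetic operations that suffices to obtain the tuple \<open>out x\<close> from the
  tuple \<open>inp x\<close>, for all x in X (infinite if there is no such program).
\<close>

definition arith_complexity :: "'a ring \<Rightarrow> 'x set \<Rightarrow> ('x \<Rightarrow> 'a list) \<Rightarrow> ('x \<Rightarrow> 'a list) \<Rightarrow> ereal" where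
  "arith_complexity F X inp out =
     (INF p \<in> {p. \<exists>outs. \<forall>x\<in>X. run_slp F p outs (inp x) = Some (out x)}. ereal (real (length p)))"

text \<open>
  A ring is usually said to support the FFT if it has primitive \<open>2^k\<close>-th roots of unity for all k,
  which no finite field satisfies; over a finite field the notion is relative to the problem size b.
\<close>

definition supports_fft :: "'a ring \<Rightarrow> nat \<Rightarrow> bool" where
  "supports_fft F b \<longleftrightarrow>
     (\<exists>k. b \<le> 2 ^ k \<and> (\<exists>\<omega>\<in>carrier (mult_of F). group.ord (mult_of F) \<omega> = 2 ^ k))"

text \<open>
  \<open>a log\<^sup>2 b\<close>, with the additional factor \<open>log log b\<close> if there is no FFT. That factor is bounded
  below by 1, since \<open>log log b\<close> vanishes for \<open>b = 2\<close>.
\<close>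

definition O_tilde :: "'a ring \<Rightarrow> real \<Rightarrow> nat \<Rightarrow> real" where
  "O_tilde F a b =
     a * (log 2 (real b))\<^sup>2 * (if supports_fft F b then 1 else max 1 (log 2 (log 2 (real b))))"

section \<open>Coded distributed batch matrix multiplication\<close>

definition tuples :: "'a ring \<Rightarrow> nat \<Rightarrow> 'a list set" where
  "tuples F n = {xs. length xs = n \<and> set xs \<subseteq> carrier F}"

definition batches :: "'a ring \<Rightarrow> nat \<Rightarrow> nat \<Rightarrow> nat \<Rightarrow> 'a mat list set" where
  "batches F L m n =
     {As. length As = L \<and> (\<forall>A\<in>set As. A \<in> carrier_mat m n \<and> elements_mat A \<subseteq> carrier F)}"

definition batch_entries :: "'a mat list \<Rightarrow> 'a list" where
  "batch_entries As = concat (map (concat \<circ> mat_to_list) As)"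

definition mat_mult :: "'a ring \<Rightarrow> 'a mat \<Rightarrow> 'a mat \<Rightarrow> 'a mat" where
  "mat_mult F A B =
     mat (dim_row A) (dim_col B)
       (\<lambda>(i, j). \<Oplus>\<^bsub>F\<^esub>k\<in>{..<dim_col A}. A $$ (i, k) \<otimes>\<^bsub>F\<^esub> B $$ (k, j))"

definition batch_mult :: "'a ring \<Rightarrow> 'a mat list \<Rightarrow> 'a mat list \<Rightarrow> 'a mat list" where
  "batch_mult F As Bs = map2 (mat_mult F) As Bs"

text \<open>
  The decoding functions are part of the code; \<open>dec R\<close> is applied to the family of the answers
  indexed by R (extended by \<open>undefined\<close>). The numbers of field elements in the tuples
  \<open>encA s As\<close>, \<open>encB s Bs\<close> and \<open>ans s a b\<close> are \<open>sizeA s\<close>, \<open>sizeB s\<close> and \<open>sizeY s\<close>; they may depend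
  on the server but not on the data.
\<close>

record 'a cdbmm_code =
  sizeA :: "nat \<Rightarrow> nat"
  sizeB :: "nat \<Rightarrow> nat"
  sizeY :: "nat \<Rightarrow> nat"
  encA :: "nat \<Rightarrow> 'a mat list \<Rightarrow> 'a list"
  encB :: "nat \<Rightarrow> 'a mat list \<Rightarrow> 'a list"
  ans :: "nat \<Rightarrow> 'a list \<Rightarrow> 'a list \<Rightarrow> 'a list"
  dec :: "nat set \<Rightarrow> (nat \<Rightarrow> 'a list) \<Rightarrow> 'a mat list"

definition is_cdbmm_code ::
    "'a ring \<Rightarrow> nat \<Rightarrow> nat \<Rightarrow> nat \<Rightarrow> nat \<Rightarrow> nat \<Rightarrow> 'a cdbmm_code \<Rightarrow> bool" where
  "is_cdbmm_code F S L lam kap mu c \<longleftrightarrow>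
     (\<forall>s\<in>{1..S}.
        encA c s \<in> batches F L lam kap \<rightarrow> tuples F (sizeA c s) \<and>
        encB c s \<in> batches F L kap mu \<rightarrow> tuples F (sizeB c s) \<and>
        ans c s \<in> tuples F (sizeA c s) \<rightarrow> tuples F (sizeB c s) \<rightarrow> tuples F (sizeY c s)) \<and>
     (\<forall>R\<subseteq>{1..S}. dec c R \<in> (\<Pi>\<^sub>E s\<in>R. tuples F (sizeY c s)) \<rightarrow> batches F L lam mu)"

definition answer :: "'a cdbmm_code \<Rightarrow> 'a mat list \<Rightarrow> 'a mat list \<Rightarrow> nat \<Rightarrow> 'a list" where
  "answer c As Bs s = ans c s (encA c s As) (encB c s Bs)"

definition recoverable ::
    "'a ring \<Rightarrow> nat \<Rightarrow> nat \<Rightarrow> nat \<Rightarrow> nat \<Rightarrow> nat \<Rightarrow> 'a cdbmm_code \<Rightarrow> nat \<Rightarrow> bool" where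
  "recoverable F S L lam kap mu c r \<longleftrightarrow>
     (\<forall>R\<subseteq>{1..S}. card R = r \<longrightarrow>
        (\<forall>As\<in>batches F L lam kap. \<forall>Bs\<in>batches F L kap mu.
           dec c R (\<lambda>s\<in>R. answer c As Bs s) = batch_mult F As Bs))"

text \<open>The minimum always exists, as the condition is vacuous for r > S.\<close>

definition recovery_threshold ::
    "'a ring \<Rightarrow> nat \<Rightarrow> nat \<Rightarrow> nat \<Rightarrow> nat \<Rightarrow> nat \<Rightarrow> 'a cdbmm_code \<Rightarrow> nat" where
  "recovery_threshold F S L lam kap mu c = (LEAST r. recoverable F S L lam kap mu c r)"

definition threshold_sets ::
    "'a ring \<Rightarrow> nat \<Rightarrow> nat \<Rightarrow> nat \<Rightarrow> nat \<Rightarrow> nat \<Rightarrow> 'a cdbmm_code \<Rightarrow> nat set set" where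
  "threshold_sets F S L lam kap mu c =
     {R. R \<subseteq> {1..S} \<and> card R = recovery_threshold F S L lam kap mu c}"

definition upload_cost_A :: "nat \<Rightarrow> nat \<Rightarrow> nat \<Rightarrow> nat \<Rightarrow> 'a cdbmm_code \<Rightarrow> real" where
  "upload_cost_A S L lam kap c = real (\<Sum>s\<in>{1..S}. sizeA c s) / real (L * lam * kap)"

definition upload_cost_B :: "nat \<Rightarrow> nat \<Rightarrow> nat \<Rightarrow> nat \<Rightarrow> 'a cdbmm_code \<Rightarrow> real" where
  "upload_cost_B S L kap mu c = real (\<Sum>s\<in>{1..S}. sizeB c s) / real (L * kap * mu)"

definition download_cost ::
    "'a ring \<Rightarrow> nat \<Rightarrow> nat \<Rightarrow> nat \<Rightarrow> nat \<Rightarrow> nat \<Rightarrow> 'a cdbmm_code \<Rightarrow> real" where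
  "download_cost F S L lam kap mu c =
     (MAX R\<in>threshold_sets F S L lam kap mu c.
        real (\<Sum>s\<in>R. sizeY c s) / real (L * lam * mu))"

definition server_complexity :: "'a ring \<Rightarrow> nat \<Rightarrow> 'a cdbmm_code \<Rightarrow> nat \<Rightarrow> ereal" where
  "server_complexity F L c s =
     arith_complexity F (tuples F (sizeA c s) \<times> tuples F (sizeB c s))
       (\<lambda>(a, b). a @ b) (\<lambda>(a, b). ans c s a b) / ereal (real L)"

definition encoding_complexity_A ::
    "'a ring \<Rightarrow> nat \<Rightarrow> nat \<Rightarrow> nat \<Rightarrow> nat \<Rightarrow> 'a cdbmm_code \<Rightarrow> ereal" where
  "encoding_complexity_A F S L lam kap c =
     arith_complexity F (batches F L lam kap)
       batch_entries (\<lambda>As. concat (map (\<lambda>s. encA c s As) [1..<Suc S])) / ereal (real L)"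

definition encoding_complexity_B ::
    "'a ring \<Rightarrow> nat \<Rightarrow> nat \<Rightarrow> nat \<Rightarrow> nat \<Rightarrow> 'a cdbmm_code \<Rightarrow> ereal" where
  "encoding_complexity_B F S L kap mu c =
     arith_complexity F (batches F L kap mu)
       batch_entries (\<lambda>Bs. concat (map (\<lambda>s. encB c s Bs) [1..<Suc S])) / ereal (real L)"

definition decoding_complexity ::
    "'a ring \<Rightarrow> nat \<Rightarrow> nat \<Rightarrow> nat \<Rightarrow> nat \<Rightarrow> nat \<Rightarrow> 'a cdbmm_code \<Rightarrow> ereal" where
  "decoding_complexity F S L lam kap mu c =
     (SUP R\<in>threshold_sets F S L lam kap mu c.
        arith_complexity F (\<Pi>\<^sub>E s\<in>R. tuples F (sizeY c s))
          (\<lambda>Y. concat (map Y (sorted_list_of_set R))) (\<lambda>Y. batch_entries (dec c R Y))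
        / ereal (real L))"

end

theory Submission
  imports Defs "HOL-Computational_Algebra.Polynomial"
begin

text \<open>
  All points are powers of a generator g of the multiplicative group: \<open>g^s\<close> for server s and \<open>g^i\<close> for
  the data index \<open>i < L\<close>. The indices form \<open>ell\<close> blocks of size \<open>Kc\<close>. For a block l let \<open>A_l(x)\<close> and
  \<open>B_l(x)\<close> interpolate the matrices of the block, and let \<open>Q_l(x)\<close> be the product of all \<open>x - g^i\<close>
  with i outside of it. Server s receives \<open>A_l(g^s)\<close> and \<open>Q_l(g^s) B_l(g^s)\<close> and answers with the value
  at \<open>g^s\<close> of \<open>P = \<Sum>l. A_l Q_l B_l\<close>, which has degree at most \<open>L + Kc - 2\<close>. So \<open>L + Kc - 1\<close> answers
  determine P, and \<open>P(g^i) = Q_l(g^i) A_i B_i\<close> for i in block l.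

  Encoding and decoding both interpolate at some powers of g and evaluate at the first powers of g. The
  interpolation is a product tree, in which every multiplication has one fixed factor, and the
  evaluation is one such multiplication (Bluestein). Both are therefore linear maps whose cost is
  governed by the multiplication by a fixed polynomial, for which Fourier transforms are used: over the
  field itself if it has the roots of unity, and otherwise recursively as in the algorithm of
  Schoenhage and Strassen, in radix 2 or, for characteristic 2, in radix 3.
\<close>

section \<open>Computations modulo an ideal\<close>

text \<open>Server points and data points may coincide, as both are the first powers of
  \<open>g\<close>. This is harmless because the factor \<open>Q_l\<close> replaces the Cauchy
  denominators customary for such codes by polynomials. It lets Bluestein's method serve encoding
  and decoding alike. \<open>L + S <= |F|\<close> keeps the L data exponents and the S server
  exponents each within one period of \<open>g\<close>.

  Of the squared logarithm, one factor is the depth of the product tree and one belongs to the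
  multiplication. So a product must cost O(n log n), up to log log n, over every field with one
  constant, although neither roots of unity nor an inverse of 2 need exist. Missing roots are
  supplied by quotients R[x]/phi. Types cannot depend on r, M or the field, so congruence modulo an
  ideal stands in for every quotient, including the passage to the field itself. Division by the
  radix is postponed by counting powers of r, and is finally absorbed into the fixed factor, whose
  scaling is free.

  A second obstacle is size 1: there log 1 = 0, and the bounds leave no operation at all for
  encoding or decoding.\<close>

definition ring_ideal :: "'r::comm_ring_1 set \<Rightarrow> bool" where
  "ring_ideal I \<longleftrightarrow> 0 \<in> I \<and> (\<forall>a\<in>I. \<forall>b\<in>I. a + b \<in> I) \<and> (\<forall>a\<in>I. \<forall>c. c * a \<in> I)"

lemma ring_ideal_0: "ring_ideal I \<Longrightarrow> 0 \<in> I"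
  and ring_ideal_add: "ring_ideal I \<Longrightarrow> a \<in> I \<Longrightarrow> b \<in> I \<Longrightarrow> a + b \<in> I"
  and ring_ideal_mult: "ring_ideal I \<Longrightarrow> a \<in> I \<Longrightarrow> c * a \<in> I"
  by (auto simp: ring_ideal_def)

lemma ring_ideal_mult_right: "ring_ideal I \<Longrightarrow> a \<in> I \<Longrightarrow> a * c \<in> I"
  using ring_ideal_mult by (metis mult.commute)

lemma ring_ideal_uminus: "ring_ideal I \<Longrightarrow> a \<in> I \<Longrightarrow> - a \<in> I"
  using ring_ideal_mult[of I a "-1"] by simp

lemma ring_ideal_diff: "ring_ideal I \<Longrightarrow> a \<in> I \<Longrightarrow> b \<in> I \<Longrightarrow> a - b \<in> I"
  using ring_ideal_add[of I a "-b"] ring_ideal_uminus by auto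

lemma ring_ideal_sum: "ring_ideal I \<Longrightarrow> (\<And>i. i \<in> A \<Longrightarrow> f i \<in> I) \<Longrightarrow> sum f A \<in> I"
  by (induction A rule: infinite_finite_induct) (auto intro: ring_ideal_add ring_ideal_0)

definition eqm :: "'r::comm_ring_1 set \<Rightarrow> 'r \<Rightarrow> 'r \<Rightarrow> bool" where
  "eqm I a b \<longleftrightarrow> a - b \<in> I"

lemma eqm_refl: "ring_ideal I \<Longrightarrow> eqm I a a"
  by (simp add: eqm_def ring_ideal_0)

lemma eqm_sym: "ring_ideal I \<Longrightarrow> eqm I a b \<Longrightarrow> eqm I b a"
  unfolding eqm_def using ring_ideal_uminus[of I "a - b"] by simp

lemma eqm_trans: "ring_ideal I \<Longrightarrow> eqm I a b \<Longrightarrow> eqm I b c \<Longrightarrow> eqm I a c"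
  unfolding eqm_def using ring_ideal_add[of I "a - b" "b - c"] by simp

lemma eqm_add: "ring_ideal I \<Longrightarrow> eqm I a b \<Longrightarrow> eqm I c d \<Longrightarrow> eqm I (a + c) (b + d)"
  unfolding eqm_def using ring_ideal_add[of I "a - b" "c - d"] by (simp add: algebra_simps)

lemma eqm_mult:
  assumes "ring_ideal I" "eqm I a b" "eqm I c d"
  shows "eqm I (a * c) (b * d)"
proof -
  have "a * c - b * d = c * (a - b) + b * (c - d)" by (simp add: algebra_simps)
  then show ?thesis
    using assms unfolding eqm_def by (auto intro!: ring_ideal_add ring_ideal_mult)
qed

lemma eqm_diff: "ring_ideal I \<Longrightarrow> eqm I a b \<Longrightarrow> eqm I c d \<Longrightarrow> eqm I (a - c) (b - d)"
  unfolding eqm_def using ring_ideal_diff[of I "a - b" "c - d"] by (simp add: algebra_simps)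

lemma eqm_sum: "ring_ideal I \<Longrightarrow> (\<And>i. i \<in> A \<Longrightarrow> eqm I (f i) (g i)) \<Longrightarrow> eqm I (sum f A) (sum g A)"
  unfolding eqm_def using ring_ideal_sum[of I A "\<lambda>i. f i - g i"] by (simp add: sum_subtractf)

lemma eqm_pow: "ring_ideal I \<Longrightarrow> eqm I a b \<Longrightarrow> eqm I (a ^ n) (b ^ n)"
  by (induction n) (auto intro: eqm_mult eqm_refl)

text \<open>Instructions do not overwrite registers, so the state of a computation is just the set K of the
  known values. One step multiplies two known values by elements of C and adds the products; C holds
  the constants and, for the servers, also the inputs. W has to be reached only modulo I.\<close>

inductive derives :: "'r::comm_ring_1 set \<Rightarrow> 'r set \<Rightarrow> 'r set \<Rightarrow> nat \<Rightarrow> 'r set \<Rightarrow> bool"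
  for I C where
  known: "\<forall>w\<in>W. \<exists>k\<in>insert 0 K. eqm I w k \<Longrightarrow> derives I C K c W"
| step: "u \<in> insert 0 K \<Longrightarrow> v \<in> insert 0 K \<Longrightarrow> a \<in> C \<Longrightarrow> b \<in> C \<Longrightarrow>
    derives I C (insert (a * u + b * v) K) c W \<Longrightarrow> derives I C K (Suc c) W"

lemma derives_le: "derives I C K c W \<Longrightarrow> c \<le> d \<Longrightarrow> derives I C K d W"
proof (induction arbitrary: d rule: derives.induct)
  case (known W K c)
  then show ?case by (auto intro: derives.known)
next
  case (step u K v a b c W)
  then obtain d' where "d = Suc d'" "c \<le> d'" by (cases d) auto
  then show ?case using derives.step[OF step.hyps(1-4) step.IH] by simp
qed

text \<open>Congruent substitutes for the known values can follow the same steps, since sums and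
  products respect congruence. Other changes of the known set are reduced to this one.\<close>

lemma derives_mono_known:
  assumes I: "ring_ideal I"
  shows "derives I C K c W \<Longrightarrow> \<forall>k\<in>K. \<exists>k'\<in>insert 0 K'. eqm I k k' \<Longrightarrow> derives I C K' c W"
proof (induction arbitrary: K' rule: derives.induct)
  case (known W K c)
  have "\<exists>k\<in>insert 0 K'. eqm I w k" if w: "w \<in> W" for w
  proof -
    from known(1) w obtain k where k: "k \<in> insert 0 K" "eqm I w k" by blast
    show ?thesis
    proof (cases "k = 0")
      case True then show ?thesis using k by auto
    next
      case False
      with k have "k \<in> K" by simp
      with known(2) obtain k' where "k' \<in> insert 0 K'" "eqm I k k'" by blast
      with eqm_trans[OF I k(2)] show ?thesis by blast
    qed
  qed
  then show ?case by (intro derives.known ballI)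
next
  case (step u K v a b c W)
  have ex: "\<exists>x'\<in>insert 0 K'. eqm I x x'" if "x \<in> insert 0 K" for x
    using that step.prems eqm_refl[OF I, of 0] by (cases "x = 0") auto
  from ex[OF step.hyps(1)] obtain u' where u': "u' \<in> insert 0 K'" "eqm I u u'" by blast
  from ex[OF step.hyps(2)] obtain v' where v': "v' \<in> insert 0 K'" "eqm I v v'" by blast
  have e: "eqm I (a * u + b * v) (a * u' + b * v')"
    by (intro eqm_add[OF I] eqm_mult[OF I] eqm_refl[OF I] u'(2) v'(2))
  have "\<exists>k'\<in>insert 0 (insert (a * u' + b * v') K'). eqm I k k'"
    if "k \<in> insert (a * u + b * v) K" for k
  proof (cases "k = a * u + b * v")
    case True then show ?thesis using e by auto
  next
    case False then show ?thesis using ex[of k] that by auto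
  qed
  then have "derives I C (insert (a * u' + b * v') K') c W"
    by (intro step.IH ballI)
  with u'(1) v'(1) step.hyps(3,4) show ?case by (rule derives.step)
qed

lemma derives_subset_known:
  assumes "ring_ideal I" "derives I C K c W" "K \<subseteq> K'"
  shows "derives I C K' c W"
  by (rule derives_mono_known[OF assms(1,2)]) (use assms(3) eqm_refl[OF assms(1)] in blast)

text \<open>Sequential composition. The targets W of the first phase are only congruent to computed
  values, so the second phase is replayed on the latter.\<close>

lemma derives_cut:
  assumes I: "ring_ideal I"
  shows "derives I C K c W \<Longrightarrow> derives I C (K \<union> W) d Z \<Longrightarrow> derives I C K (c + d) Z"
proof (induction rule: derives.induct)
  case (known W K c)
  have "derives I C K d Z"
    by (rule derives_mono_known[OF I known(2)]) (use known(1) eqm_refl[OF I] in auto)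
  then show ?case by (rule derives_le) simp
next
  case (step u K v a b c W)
  have "derives I C (insert (a * u + b * v) K) (c + d) Z"
    by (rule step.IH, rule derives_subset_known[OF I step.prems]) auto
  then show ?case using derives.step[OF step.hyps(1-4)] by simp
qed

lemma derives_sub: "derives I C K c W \<Longrightarrow> W' \<subseteq> W \<Longrightarrow> derives I C K c W'"
proof (induction rule: derives.induct)
  case (known W K c)
  show ?case by (rule derives.known) (use known in auto)
next
  case (step u K v a b c W)
  show ?case by (rule derives.step[OF step.hyps(1-4) step.IH[OF step.prems]])
qed

lemma derives_keep:
  assumes I: "ring_ideal I"
  shows "derives I C K c W \<Longrightarrow> derives I C K c (K \<union> W)"
proof (induction rule: derives.induct)
  case (known W K c)
  show ?case by (rule derives.known) (use known eqm_refl[OF I] in auto)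
next
  case (step u K v a b c W)
  have "derives I C (insert (a * u + b * v) K) c (K \<union> W)"
    by (rule derives_sub[OF step.IH]) auto
  with step.hyps(1-4) show ?case by (rule derives.step)
qed

lemma derives_cong:
  assumes I: "ring_ideal I" and d: "derives I C K c W"
    and W': "\<And>w. w \<in> W' \<Longrightarrow> \<exists>k\<in>insert 0 (K \<union> W). eqm I w k"
  shows "derives I C K c W'"
  using derives_cut[OF I d, of 0 W'] W' by (auto intro: derives.known)

lemma derives_trans:
  "ring_ideal I \<Longrightarrow> derives I C K c W \<Longrightarrow> derives I C W d Z \<Longrightarrow> derives I C K (c + d) Z"
  by (rule derives_cut) (auto intro: derives_subset_known)

lemma derives_Un:
  assumes I: "ring_ideal I" and "derives I C K c W" and "derives I C K d Z"
  shows "derives I C K (c + d) (W \<union> Z)"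
proof (rule derives_cut[OF I assms(2)])
  show "derives I C (K \<union> W) d (W \<union> Z)"
    using derives_keep[OF I derives_subset_known[OF I assms(3), of "K \<union> W"]]
    by (rule derives_sub) auto
qed

lemma derives_UN:
  assumes I: "ring_ideal I" and "finite A" and "\<And>i. i \<in> A \<Longrightarrow> derives I C K (c i) (W i)"
  shows "derives I C K (sum c A) (\<Union>i\<in>A. W i)"
  using assms(2,3)
proof (induction A rule: finite_induct)
  case empty then show ?case by (auto intro: derives.known)
next
  case (insert x F)
  then show ?case using derives_Un[OF I, of C K "c x" "W x"] by simp
qed

lemma derives_UN_card:
  assumes "ring_ideal I" and "finite A" and "\<And>i. i \<in> A \<Longrightarrow> derives I C K c (W i)"
    and "card A \<le> n"
  shows "derives I C K (n * c) (\<Union>i\<in>A. W i)"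
  using derives_UN[OF assms(1-2), of C K "\<lambda>_. c" W] assms(3-4)
  by (auto elim!: derives_le)

text \<open>Multiply and accumulate: the partial sum re-enters with the coefficient 1, so every
  summand costs one step.\<close>

lemma derives_sum:
  assumes I: "ring_ideal I" and "finite A" and one: "1 \<in> C"
    and "\<And>i. i \<in> A \<Longrightarrow> c i \<in> C" and "\<And>i. i \<in> A \<Longrightarrow> u i \<in> insert 0 K"
  shows "derives I C K (card A) {\<Sum>i\<in>A. c i * u i}"
  using assms(2,4,5)
proof (induction A rule: finite_induct)
  case empty then show ?case using eqm_refl[OF I] by (auto intro: derives.known)
next
  case (insert x F)
  let ?s = "\<Sum>i\<in>F. c i * u i"
  have "derives I C (K \<union> {?s}) 1 {\<Sum>i\<in>insert x F. c i * u i}"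
  proof -
    have "derives I C (insert (c x * u x + 1 * ?s) (K \<union> {?s})) 0 {\<Sum>i\<in>insert x F. c i * u i}"
      using insert eqm_refl[OF I] by (intro derives.known) auto
    then show ?thesis
      unfolding One_nat_def by (rule derives.step[rotated 4]) (use insert one in auto)
  qed
  from derives_cut[OF I insert.IH this] insert show ?case by simp
qed

text \<open>The counting rule for one layer of any linear computation: k outputs, each a linear form
  with at most n terms. The index type is left free because the sums below run over numbers,
  booleans or pairs.\<close>

lemma derives_sums:
  assumes I: "ring_ideal I" and one: "1 \<in> C"
    and "\<And>w. w \<in> W \<Longrightarrow> \<exists>A c u. finite A \<and> card A \<le> n \<and> c ` A \<subseteq> C \<and> u ` A \<subseteq> insert 0 K \<and>
           eqm I w (\<Sum>i\<in>(A::'i set). c i * u i)"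
    and "finite W" "card W \<le> k"
  shows "derives I C K (k * n) W"
proof -
  have "derives I C K n {w}" if w: "w \<in> W" for w
  proof -
    obtain A :: "'i set" and c u where A: "finite A" "card A \<le> n" "c ` A \<subseteq> C" "u ` A \<subseteq> insert 0 K"
      "eqm I w (\<Sum>i\<in>A. c i * u i)"
      using assms(3)[OF w] by metis
    have "derives I C K (card A) {\<Sum>i\<in>A. c i * u i}"
      by (rule derives_sum[OF I A(1) one]) (use A in auto)
    then have "derives I C K (card A) {w}"
      by (rule derives_cong[OF I]) (use A in auto)
    then show ?thesis using A(2) by (rule derives_le)
  qed
  then have "derives I C K (k * n) (\<Union>w\<in>W. {w})"
    by (intro derives_UN_card[OF I]) (use assms in auto)
  then show ?thesis by simp
qed

lemma derives_scale:
  assumes I: "ring_ideal I" and C: "1 \<in> C" and A: "finite A" "card A \<le> n" and u: "\<And>i. i \<in> A \<Longrightarrow> u i \<in> C"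
  shows "derives I C (y ` A) n ((\<lambda>i. u i * y i) ` A)"
proof -
  have "derives I C (y ` A) (n * 1) ((\<lambda>i. u i * y i) ` A)"
  proof (rule derives_sums[OF I C])
    show "card ((\<lambda>i. u i * y i) ` A) \<le> n" using card_image_le[OF A(1)] A(2) order.trans by blast
    fix x assume "x \<in> (\<lambda>i. u i * y i) ` A"
    then obtain i where "i \<in> A" "x = u i * y i" by auto
    then show "\<exists>B c v. finite B \<and> card B \<le> 1 \<and> c ` B \<subseteq> C \<and> v ` B \<subseteq> insert 0 (y ` A) \<and>
        eqm I x (\<Sum>i\<in>(B::nat set). c i * v i)"
      using u by (intro exI[of _ "{0}"] exI[of _ "\<lambda>_. u i"] exI[of _ "\<lambda>_. y i"]) (auto simp: eqm_refl[OF I])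
  qed (use A in simp)
  then show ?thesis by simp
qed

section \<open>Radix r Fourier transforms\<close>

definition dft :: "'r::comm_ring_1 \<Rightarrow> (nat \<Rightarrow> 'r) \<Rightarrow> nat \<Rightarrow> nat \<Rightarrow> 'r" where
  "dft w a n e = (\<Sum>i<n. a i * w ^ (e * i))"

text \<open>Only the exponents prime to r are used: the corresponding powers of w are the roots of
  \<open>1 + y^t + ... + y^((r-1)t)\<close>, \<open>t = r^s\<close>, so that \<open>(r - 1) t\<close> coefficients are determined.\<close>

definition nondiv :: "nat \<Rightarrow> nat \<Rightarrow> nat set" where
  "nondiv r s = {e. e < r ^ Suc s \<and> \<not> r dvd e}"

text \<open>In the presence of zero divisors the order of \<open>w\<close> does not imply
  orthogonality, so the vanishing of the character sums is demanded. Sums of r terms suffice, as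
  each layer of the transform separates only r residue classes.\<close>

definition principal_root :: "'r::comm_ring_1 set \<Rightarrow> nat \<Rightarrow> nat \<Rightarrow> 'r \<Rightarrow> bool" where
  "principal_root J r s w \<longleftrightarrow> eqm J (w ^ (r ^ Suc s)) 1 \<and>
     (\<forall>j. \<not> r dvd j \<longrightarrow> (\<Sum>i<r. w ^ (r ^ s * i * j)) \<in> J)"

lemma principal_root_Suc: "principal_root J r (Suc s) w \<Longrightarrow> principal_root J r s (w ^ r)"
  unfolding principal_root_def by (simp add: power_mult[symmetric] mult.assoc)

lemma finite_nondiv [simp]: "finite (nondiv r s)"
  by (simp add: nondiv_def)

lemma card_nondiv_le:
  assumes "r > 0" shows "card (nondiv r s) \<le> (r - 1) * r ^ s"
proof -
  have "nondiv r s \<subseteq> (\<lambda>(p, q). q * r + p) ` ({1..<r} \<times> {..<r ^ s})"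
  proof
    fix e assume e: "e \<in> nondiv r s"
    then have "e mod r \<in> {1..<r}" using assms
      by (auto simp: nondiv_def dvd_eq_mod_eq_0 Suc_le_eq)
    moreover have "e div r < r ^ s" using e assms
      by (auto simp: nondiv_def less_mult_imp_div_less mult.commute)
    ultimately show "e \<in> (\<lambda>(p, q). q * r + p) ` ({1..<r} \<times> {..<r ^ s})"
      by (intro image_eqI[of _ _ "(e mod r, e div r)"]) auto
  qed
  then have "card (nondiv r s) \<le> card ({1..<r} \<times> {..<r ^ s})"
    by (rule order.trans[OF card_mono card_image_le, rotated]) auto
  then show ?thesis by simp
qed

lemma sum_lessThan_mult:
  fixes f :: "nat \<Rightarrow> 'r::comm_monoid_add"
  shows "(\<Sum>i<n * r. f i) = (\<Sum>j<r. \<Sum>i<n. f (i * r + j))"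
proof -
  have "(\<Sum>i<n * r. f i) = (\<Sum>m<n. sum f {m * r..<m * r + r})"
    by (simp add: sum.nat_group)
  also have "\<dots> = (\<Sum>m<n. \<Sum>j<r. f (m * r + j))"
    by (simp add: sum.atLeastLessThan_shift_0 atLeast0LessThan)
  finally show ?thesis by (subst sum.swap)
qed

text \<open>Decimation in time: the coefficients are sorted by their index modulo r.\<close>

lemma dft_split: "dft w a (n * r) e = (\<Sum>j<r. w ^ (e * j) * dft (w ^ r) (\<lambda>i. a (i * r + j)) n e)"
proof -
  have "a (i * r + j) * w ^ (e * (i * r + j)) = w ^ (e * j) * (a (i * r + j) * (w ^ r) ^ (e * i))" for i j
  proof -
    have "w ^ (e * (i * r + j)) = w ^ (e * j) * (w ^ r) ^ (e * i)"
      unfolding power_mult[symmetric] power_add[symmetric] by (simp add: algebra_simps)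
    then show ?thesis by (simp only: mult_ac)
  qed
  then show ?thesis unfolding dft_def sum_lessThan_mult sum_distrib_left by simp
qed

lemma dft_smult: "dft w (\<lambda>i. c * a i) n e = c * dft w a n e"
  by (simp add: dft_def sum_distrib_left mult.assoc)

lemma eqm_pow_one: "ring_ideal J \<Longrightarrow> eqm J (w ^ T) 1 \<Longrightarrow> eqm J (w ^ (T * n)) 1"
  using eqm_pow[of J "w ^ T" 1 n] by (simp add: power_mult)

lemma eqm_pow_period:
  assumes J: "ring_ideal J" and "eqm J (w ^ T) 1"
  shows "eqm J (w ^ (x + T * n)) (w ^ x)"
  using eqm_mult[OF J eqm_refl[OF J, of "w ^ x"] eqm_pow_one[OF assms, of n]] by (simp add: power_add)

lemma dft_period:
  assumes J: "ring_ideal J" and "eqm J (w ^ T) 1"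
  shows "eqm J (dft w a n (e + T * l)) (dft w a n e)"
  unfolding dft_def
proof (intro eqm_sum[OF J] eqm_mult[OF J] eqm_refl[OF J])
  fix i
  show "eqm J (w ^ ((e + T * l) * i)) (w ^ (e * i))"
    using eqm_pow_period[OF assms, of "e * i" "l * i"] by (simp add: algebra_simps)
qed

text \<open>Repeated use of \<open>dft_split\<close>. Over all subtransforms together, a layer
  computes at most \<open>(r - 1) * r ^ s\<close> values with at most r terms each, and there are s
  + 1 layers.\<close>

lemma dft_forward:
  assumes J: "ring_ideal J" and r: "r \<ge> 2"
  shows "eqm J (w ^ (r ^ Suc s)) 1 \<Longrightarrow> (\<And>e. w ^ e \<in> C) \<Longrightarrow>
    derives J C (a ` {..<(r - 1) * r ^ s}) (r * (r - 1) * r ^ s * Suc s)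
      (dft w a ((r - 1) * r ^ s) ` nondiv r s)"
proof (induction s arbitrary: w a)
  case 0
  have "derives J C (a ` {..<r - 1}) ((r - 1) * (r - 1)) (dft w a (r - 1) ` nondiv r 0)"
  proof (rule derives_sums[OF J])
    show "1 \<in> C" using 0(2)[of 0] by simp
    show "card (dft w a (r - 1) ` nondiv r 0) \<le> r - 1"
      using order.trans[OF card_image_le card_nondiv_le[of r 0]] r by simp
    fix v assume "v \<in> dft w a (r - 1) ` nondiv r 0"
    then obtain e where e: "v = dft w a (r - 1) e" by auto
    show "\<exists>A c u. finite A \<and> card A \<le> r - 1 \<and> c ` A \<subseteq> C \<and> u ` A \<subseteq> insert 0 (a ` {..<r - 1}) \<and>
        eqm J v (\<Sum>i\<in>(A::nat set). c i * u i)"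
      by (intro exI[of _ "{..<r - 1}"] exI[of _ "\<lambda>i. w ^ (e * i)"] exI[of _ a])
        (use e eqm_refl[OF J] 0(2) in \<open>auto simp: dft_def mult.commute\<close>)
  qed simp_all
  then show ?case using r by (auto elim!: derives_le)
next
  case (Suc s)
  let ?n = "(r - 1) * r ^ s"
  let ?T = "r ^ Suc s"
  define b where "b j = (\<lambda>i. a (i * r + j))" for j
  let ?K = "a ` {..<(r - 1) * r ^ Suc s}"
  let ?W = "\<Union>j\<in>{..<r}. dft (w ^ r) (b j) ?n ` nondiv r s"
  have one: "eqm J ((w ^ r) ^ ?T) 1"
    using Suc.prems(1) by (simp add: power_mult[symmetric] mult.commute)
  have "derives J C ?K (r * (r * (r - 1) * r ^ s * Suc s)) ?W"
  proof (rule derives_UN_card[OF J])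
    fix j assume j: "j \<in> {..<r}"
    have "b j ` {..<?n} \<subseteq> ?K"
    proof (rule image_subsetI)
      fix i assume "i \<in> {..<?n}"
      then have "i + 1 \<le> (r - 1) * r ^ s" by simp
      then have "(i + 1) * r \<le> (r - 1) * r ^ s * r" by (rule mult_le_mono1)
      moreover have "i * r + j < (i + 1) * r" using j by simp
      ultimately have "i * r + j < (r - 1) * r ^ s * r" by (rule less_le_trans[rotated])
      then have "i * r + j < (r - 1) * r ^ Suc s" by (simp only: power_Suc mult_ac)
      then show "b j i \<in> ?K" by (simp add: b_def)
    qed
    moreover have "derives J C (b j ` {..<?n}) (r * (r - 1) * r ^ s * Suc s)
        (dft (w ^ r) (b j) ?n ` nondiv r s)"
      using Suc.prems(2) by (intro Suc.IH one) (simp add: power_mult[symmetric])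
    ultimately show "derives J C ?K (r * (r - 1) * r ^ s * Suc s) (dft (w ^ r) (b j) ?n ` nondiv r s)"
      using derives_subset_known[OF J] by blast
  qed auto
  moreover have "derives J C ?W ((r - 1) * r ^ Suc s * r) (dft w a ((r - 1) * r ^ Suc s) ` nondiv r (Suc s))"
  proof (rule derives_sums[OF J])
    show "1 \<in> C" using Suc.prems(2)[of 0] by simp
    show "card (dft w a ((r - 1) * r ^ Suc s) ` nondiv r (Suc s)) \<le> (r - 1) * r ^ Suc s"
      using order.trans[OF card_image_le card_nondiv_le[of r "Suc s"]] r by simp
    fix v assume "v \<in> dft w a ((r - 1) * r ^ Suc s) ` nondiv r (Suc s)"
    then obtain e where e: "v = dft w a ((r - 1) * r ^ Suc s) e" "e \<in> nondiv r (Suc s)" by auto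
    let ?e = "e mod ?T"
    have e': "?e \<in> nondiv r s"
      using e(2) r by (auto simp: nondiv_def dvd_mod_iff)
    have v1: "v = (\<Sum>j<r. w ^ (e * j) * dft (w ^ r) (b j) ?n e)"
      unfolding e(1) b_def using dft_split[of w a ?n r e] by (simp add: ac_simps)
    have v: "eqm J v (\<Sum>j<r. w ^ (e * j) * dft (w ^ r) (b j) ?n ?e)"
      unfolding v1
    proof (intro eqm_sum[OF J] eqm_mult[OF J] eqm_refl[OF J])
      fix j
      show "eqm J (dft (w ^ r) (b j) ?n e) (dft (w ^ r) (b j) ?n ?e)"
        using dft_period[OF J one, of "b j" ?n ?e "e div ?T"] by simp
    qed
    show "\<exists>A c u. finite A \<and> card A \<le> r \<and> c ` A \<subseteq> C \<and> u ` A \<subseteq> insert 0 ?W \<and>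
        eqm J v (\<Sum>i\<in>(A::nat set). c i * u i)"
      by (intro exI[of _ "{..<r}"] exI[of _ "\<lambda>j. w ^ (e * j)"] exI[of _ "\<lambda>j. dft (w ^ r) (b j) ?n ?e"])
        (use v e' in \<open>auto simp: Suc.prems(2) intro: imageI\<close>)
  qed simp_all
  ultimately have "derives J C ?K (r * (r * (r - 1) * r ^ s * Suc s) + (r - 1) * r ^ Suc s * r)
      (dft w a ((r - 1) * r ^ Suc s) ` nondiv r (Suc s))"
    by (rule derives_trans[OF J])
  moreover have "r * (r * q * p * Suc s) + q * (r * p) * r = r * q * (r * p) * Suc (Suc s)" for q p :: nat
    by (simp add: algebra_simps)
  from this[of "r - 1" "r ^ s"]
  have "r * (r * (r - 1) * r ^ s * Suc s) + (r - 1) * r ^ Suc s * r = r * (r - 1) * r ^ Suc s * Suc (Suc s)"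
    by (simp only: power_Suc)
  ultimately show ?case by (simp only:)
qed

lemma nondiv_add:
  assumes "e \<in> nondiv r s" "l < r"
  shows "e + r ^ Suc s * l \<in> nondiv r (Suc s)"
proof -
  have "e < r ^ Suc s" using assms by (simp add: nondiv_def)
  moreover have "r ^ Suc s * (l + 1) \<le> r ^ Suc s * r" using assms by (intro mult_le_mono2) simp
  ultimately have "e + r ^ Suc s * l < r ^ Suc (Suc s)" by (simp add: algebra_simps)
  moreover have "\<not> r dvd e + r ^ Suc s * l"
    using assms by (simp add: nondiv_def dvd_add_left_iff mult.assoc)
  ultimately show ?thesis by (simp add: nondiv_def)
qed

text \<open>A layer is inverted by a character sum over the r exponents \<open>e + t * l\<close>
  that agree modulo \<open>t\<close>. Such a sum yields r times the wanted value, and nothing is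
  divided, so the layers accumulate the factor \<open>r ^ Suc s\<close>.\<close>

lemma dft_inverse:
  assumes J: "ring_ideal J" and r: "r \<ge> 2"
  shows "principal_root J r s w \<Longrightarrow> (\<And>e. w ^ e \<in> C \<and> - (w ^ e) \<in> C) \<Longrightarrow>
    derives J C (dft w a ((r - 1) * r ^ s) ` nondiv r s) (2 * r * (r - 1) * r ^ s * Suc s)
      ((\<lambda>i. of_nat (r ^ Suc s) * a i) ` {..<(r - 1) * r ^ s})"
proof (induction s arbitrary: w a)
  case 0
  define S where "S x = (\<Sum>e<r. w ^ (x * e))" for x
  have S0: "S x \<in> J" if "\<not> r dvd x" for x
  proof -
    have "(\<Sum>i<r. w ^ (r ^ 0 * i * x)) \<in> J"
      using 0(1) that unfolding principal_root_def by blast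
    then show ?thesis unfolding S_def by (simp only: power_0 mult_1 mult.commute[of _ x])
  qed
  have "eqm J (S r) (\<Sum>e<r. 1)"
    unfolding S_def using 0(1) by (intro eqm_sum[OF J] eqm_pow_one[OF J]) (simp add: principal_root_def)
  then have Sr: "eqm J (S r) (of_nat r)" by simp
  have E: "nondiv r 0 = {1..<r}" by (auto simp: nondiv_def Suc_le_eq dest: dvd_imp_le intro!: gr0I)
  let ?u = "dft w a (r - 1)"
  let ?W = "(\<lambda>i. of_nat r * a i) ` {..<r - 1}"
  have "derives J C (?u ` nondiv r 0) ((r - 1) * (2 * (r - 1))) ?W"
  proof (rule derives_sums[OF J])
    show "1 \<in> C" using 0(2)[of 0] by simp
    show "card ?W \<le> r - 1" using card_image_le[of "{..<r - 1}"] by simp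
    fix v assume "v \<in> ?W"
    then obtain j where j: "j < r - 1" "v = of_nat r * a j" by auto
    \<comment> \<open>The value at \<open>e = 0\<close> is not known. As a has only \<open>r - 1\<close> coefficients, \<open>\<Sum>e<r. w ^ e * u e\<close>
      vanishes and yields it.\<close>
    have 1: "(\<Sum>e\<in>{1..<r}. (w ^ ((r - j) * e) - w ^ e) * ?u e)
        = (\<Sum>e<r. (w ^ ((r - j) * e) - w ^ e) * ?u e)"
      by (intro sum.mono_neutral_left) (auto simp: not_le Suc_le_eq)
    have 2: "(\<Sum>e<r. (w ^ ((r - j) * e) - w ^ e) * ?u e) = (\<Sum>i<r - 1. a i * (S (r - j + i) - S (i + 1)))"
      unfolding dft_def S_def sum_distrib_left sum_subtractf[symmetric]
      by (subst sum.swap) (intro sum.cong refl; simp add: algebra_simps power_add)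
    have 3: "eqm J (\<Sum>i<r - 1. a i * (S (r - j + i) - S (i + 1))) (\<Sum>i<r - 1. if i = j then of_nat r * a j else 0)"
    proof (rule eqm_sum[OF J])
      fix i assume i: "i \<in> {..<r - 1}"
      have a: "S (i + 1) \<in> J" using i by (intro S0) (auto dest: dvd_imp_le)
      show "eqm J (a i * (S (r - j + i) - S (i + 1))) (if i = j then of_nat r * a j else 0)"
      proof (cases "i = j")
        case True
        have "eqm J (S (r - j + i) - S (i + 1)) (of_nat r - 0)"
          by (intro eqm_diff[OF J]) (use True Sr a j in \<open>auto simp: eqm_def\<close>)
        from eqm_mult[OF J eqm_refl[OF J, of "a i"] this] True show ?thesis by (simp add: mult.commute)
      next
        case False
        have "\<not> r dvd r - j + i"
        proof
          assume d: "r dvd r - j + i"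
          have "r - j + i < 2 * r" "0 < r - j + i" using i j by auto
          obtain k where k: "r - j + i = r * k" using d by (rule dvdE)
          have "k \<noteq> 0" using k \<open>0 < r - j + i\<close> by (intro notI) simp
          moreover have "\<not> k \<ge> 2"
            using mult_le_mono2[of 2 k r] k \<open>r - j + i < 2 * r\<close> by linarith
          ultimately have "k = 1" by simp
          with k False j show False by simp
        qed
        then have "S (r - j + i) - S (i + 1) \<in> J" by (intro ring_ideal_diff[OF J] S0 a)
        then show ?thesis using False by (auto simp: eqm_def intro: ring_ideal_mult[OF J])
      qed
    qed
    have 4: "(\<Sum>i<r - 1. if i = j then of_nat r * a j else 0) = v" using j by simp
    \<comment> \<open>\<open>C\<close> is only known to contain signed powers of w, not their
      differences. Every e is therefore used twice, told apart by a boolean.\<close>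
    have 5: "(\<Sum>e\<in>{1..<r}. (w ^ ((r - j) * e) - w ^ e) * ?u e)
       = (\<Sum>i\<in>UNIV \<times> {1..<r}. (case i of (t, e) \<Rightarrow> if t then w ^ ((r - j) * e) else - (w ^ e)) *
           (case i of (t, e) \<Rightarrow> ?u e))"
      unfolding sum.cartesian_product' UNIV_bool
      by (simp add: left_diff_distrib sum_subtractf sum_negf)
    have "eqm J v (\<Sum>i\<in>UNIV \<times> {1..<r}. (case i of (t, e) \<Rightarrow> if t then w ^ ((r - j) * e) else - (w ^ e)) *
           (case i of (t, e) \<Rightarrow> ?u e))"
      using eqm_sym[OF J 3] unfolding 4 2[symmetric] 1[symmetric] 5 .
    then show "\<exists>A c u. finite A \<and> card A \<le> 2 * (r - 1) \<and> c ` A \<subseteq> C \<and>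
        u ` A \<subseteq> insert 0 (?u ` nondiv r 0) \<and> eqm J v (\<Sum>i\<in>(A::(bool \<times> nat) set). c i * u i)"
      by (intro exI[of _ "UNIV \<times> {1..<r}"] exI[of _ "\<lambda>(t, e). if t then w ^ ((r - j) * e) else - (w ^ e)"]
          exI[of _ "\<lambda>(t, e). ?u e"])
        (use 0(2) E in \<open>auto simp: case_prod_unfold\<close>)
  qed simp_all
  then show ?case using r by (auto elim!: derives_le)
next
  case (Suc s)
  let ?n = "(r - 1) * r ^ s"
  define t where "t = r ^ Suc s"
  define T where "T = r ^ Suc (Suc s)"
  have Tt: "T = r * t" by (simp add: T_def t_def)
  define b where "b j = (\<lambda>i. a (i * r + j))" for j
  let ?u = "dft w a ((r - 1) * r ^ Suc s)"
  let ?K = "?u ` nondiv r (Suc s)"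
  let ?W = "(\<lambda>(j, e). of_nat r * dft (w ^ r) (b j) ?n e) ` ({..<r} \<times> nondiv r s)"
  have wT: "eqm J (w ^ T) 1" using Suc.prems(1) by (simp add: principal_root_def T_def)
  have wrt: "eqm J ((w ^ r) ^ t) 1" using wT by (simp add: Tt power_mult)
  have "T > 0" using r by (simp add: T_def)
  have one: "1 \<in> C" using Suc.prems(2)[of 0] by simp
  have "derives J C ?K (r * ((r - 1) * r ^ s) * r) ?W"
  proof (rule derives_sums[OF J one])
    have "card ({..<r} \<times> nondiv r s) \<le> r * ((r - 1) * r ^ s)"
      using card_nondiv_le[of r s] r by (auto simp: card_cartesian_product intro!: mult_le_mono2)
    then show "card ?W \<le> r * ((r - 1) * r ^ s)"
      by (rule order.trans[OF card_image_le, rotated]) simp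
    fix v assume "v \<in> ?W"
    then obtain j e where je: "j < r" "e \<in> nondiv r s" "v = of_nat r * dft (w ^ r) (b j) ?n e" by auto
    \<comment> \<open>Since \<open>w ^ T\<close> is 1, the factor \<open>T - 1\<close> plays the
      role of -1 among natural exponents: \<open>x j'\<close> represents the difference j' -
      j.\<close>
    define x where "x j' = (T - 1) * j + j'" for j'
    have x_j: "x j = T * j" using \<open>T > 0\<close> by (simp add: x_def algebra_simps)
    let ?D = "\<lambda>j. dft (w ^ r) (b j) ?n"
    have "w ^ ((T - 1) * (e + t * l) * j) * ?u (e + t * l)
        = (\<Sum>j'<r. w ^ ((e + t * l) * x j') * ?D j' (e + t * l))" for l
    proof -
      have n: "(r - 1) * r ^ Suc s = ?n * r" by (simp only: power_Suc mult_ac)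
      have "w ^ ((T - 1) * (e + t * l) * j) * w ^ ((e + t * l) * j') = w ^ ((e + t * l) * x j')" for j'
        unfolding power_add[symmetric] x_def by (simp only: distrib_left mult_ac)
      then show ?thesis
        unfolding n dft_split sum_distrib_left b_def mult.assoc[symmetric] by simp
    qed
    moreover have "eqm J (\<Sum>l<r. \<Sum>j'<r. w ^ ((e + t * l) * x j') * ?D j' (e + t * l))
        (\<Sum>l<r. \<Sum>j'<r. w ^ ((e + t * l) * x j') * ?D j' e)"
      by (intro eqm_sum[OF J] eqm_mult[OF J] eqm_refl[OF J] dft_period[OF J wrt])
    moreover have "(\<Sum>l<r. \<Sum>j'<r. w ^ ((e + t * l) * x j') * ?D j' e)
        = (\<Sum>j'<r. w ^ (e * x j') * ?D j' e * (\<Sum>l<r. w ^ (t * l * x j')))"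
    proof (subst sum.swap, intro sum.cong refl)
      fix j'
      have "w ^ ((e + t * l) * x j') * ?D j' e = w ^ (e * x j') * ?D j' e * w ^ (t * l * x j')" for l
        unfolding distrib_right power_add by (simp only: mult_ac)
      then show "(\<Sum>l<r. w ^ ((e + t * l) * x j') * ?D j' e) = w ^ (e * x j') * ?D j' e * (\<Sum>l<r. w ^ (t * l * x j'))"
        by (simp add: sum_distrib_left)
    qed
    ultimately have 1: "eqm J (\<Sum>l<r. w ^ ((T - 1) * (e + t * l) * j) * ?u (e + t * l))
        (\<Sum>j'<r. w ^ (e * x j') * ?D j' e * (\<Sum>l<r. w ^ (t * l * x j')))"
      by (simp only:)
    \<comment> \<open>Orthogonality in l: for \<open>j' = j\<close> all exponents are multiples of
      T, and otherwise \<open>x j'\<close> is congruent to j' - j modulo r, which is not 0.\<close>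
    have 2: "eqm J (\<Sum>j'<r. w ^ (e * x j') * ?D j' e * (\<Sum>l<r. w ^ (t * l * x j'))) (\<Sum>j'<r. if j' = j then v else 0)"
    proof (rule eqm_sum[OF J])
      fix j' assume j': "j' \<in> {..<r}"
      show "eqm J (w ^ (e * x j') * dft (w ^ r) (b j') ?n e * (\<Sum>l<r. w ^ (t * l * x j')))
          (if j' = j then v else 0)"
      proof (cases "j' = j")
        case True
        have "eqm J (\<Sum>l<r. w ^ (T * (t * l * j))) (\<Sum>l<r. 1)"
          by (intro eqm_sum[OF J] eqm_pow_one[OF J wT])
        then have "eqm J (\<Sum>l<r. w ^ (t * l * x j)) (of_nat r)"
          by (simp add: x_j mult_ac)
        moreover have "eqm J (w ^ (e * x j)) 1"
          using eqm_pow_one[OF J wT, of "e * j"] by (simp add: x_j mult_ac)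
        ultimately have "eqm J (w ^ (e * x j) * dft (w ^ r) (b j) ?n e * (\<Sum>l<r. w ^ (t * l * x j)))
            (1 * dft (w ^ r) (b j) ?n e * of_nat r)"
          by (intro eqm_mult[OF J] eqm_refl[OF J])
        then show ?thesis using True by (simp add: je(3) mult.commute)
      next
        case False
        have "\<not> r dvd x j'"
        proof
          assume "r dvd x j'"
          moreover have "x j' + j = T * j + j'"
            using \<open>T > 0\<close> unfolding x_def by (cases T) simp_all
          moreover have "r dvd T * j" by (simp add: Tt)
          ultimately have "j mod r = j' mod r"
            by (metis dvd_eq_mod_eq_0 mod_add_left_eq add_0)
          then show False using False j' je(1) by simp
        qed
        then have "(\<Sum>l<r. w ^ (t * l * x j')) \<in> J"
          using Suc.prems(1) by (simp add: principal_root_def t_def)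
        then show ?thesis using False by (simp add: eqm_def ring_ideal_mult[OF J])
      qed
    qed
    have 3: "(\<Sum>j'<r. if j' = j then v else 0) = v" using je(1) by simp
    have "eqm J v (\<Sum>l<r. w ^ ((T - 1) * (e + t * l) * j) * ?u (e + t * l))"
      using eqm_sym[OF J eqm_trans[OF J 1 2]] unfolding 3 .
    then show "\<exists>A c u. finite A \<and> card A \<le> r \<and> c ` A \<subseteq> C \<and> u ` A \<subseteq> insert 0 ?K \<and>
        eqm J v (\<Sum>i\<in>(A::nat set). c i * u i)"
      by (intro exI[of _ "{..<r}"] exI[of _ "\<lambda>l. w ^ ((T - 1) * (e + t * l) * j)"]
          exI[of _ "\<lambda>l. ?u (e + t * l)"])
        (use Suc.prems(2) nondiv_add[OF je(2)] in \<open>auto simp: t_def\<close>)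
  qed simp
  moreover have "derives J C ?W (r * (2 * r * (r - 1) * r ^ s * Suc s))
      (\<Union>j\<in>{..<r}. (\<lambda>i. of_nat (r ^ Suc s) * (of_nat r * b j i)) ` {..<?n})"
  proof (rule derives_UN_card[OF J])
    fix j assume j: "j \<in> {..<r}"
    have "derives J C (dft (w ^ r) (\<lambda>i. of_nat r * b j i) ?n ` nondiv r s) (2 * r * (r - 1) * r ^ s * Suc s)
      ((\<lambda>i. of_nat (r ^ Suc s) * (of_nat r * b j i)) ` {..<?n})"
      using Suc.prems(2) by (intro Suc.IH principal_root_Suc Suc.prems) (simp add: power_mult[symmetric])
    then show "derives J C ?W (2 * r * (r - 1) * r ^ s * Suc s)
      ((\<lambda>i. of_nat (r ^ Suc s) * (of_nat r * b j i)) ` {..<?n})"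
      by (rule derives_subset_known[OF J]) (use j in \<open>auto simp: dft_smult\<close>)
  qed simp_all
  ultimately have *: "derives J C ?K (r * ((r - 1) * r ^ s) * r + r * (2 * r * (r - 1) * r ^ s * Suc s))
      (\<Union>j\<in>{..<r}. (\<lambda>i. of_nat (r ^ Suc s) * (of_nat r * b j i)) ` {..<?n})"
    by (rule derives_trans[OF J])
  have "derives J C ?K (r * ((r - 1) * r ^ s) * r + r * (2 * r * (r - 1) * r ^ s * Suc s))
      ((\<lambda>i. of_nat (r ^ Suc (Suc s)) * a i) ` {..<(r - 1) * r ^ Suc s})"
  proof (rule derives_sub[OF *], clarify)
    fix i assume i: "i < (r - 1) * r ^ Suc s"
    have "of_nat (r ^ Suc (Suc s)) * a i = of_nat (r ^ Suc s) * (of_nat r * b (i mod r) (i div r))"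
      by (simp add: b_def mult_ac)
    moreover have "i mod r < r" "i div r < ?n"
      using i r by (auto simp: less_mult_imp_div_less mult_ac)
    ultimately show "of_nat (r ^ Suc (Suc s)) * a i \<in>
        (\<Union>j\<in>{..<r}. (\<lambda>i. of_nat (r ^ Suc s) * (of_nat r * b j i)) ` {..<?n})"
      by blast
  qed
  moreover have "r * (q * p) * r + r * (2 * r * q * p * Suc s) \<le> 2 * r * q * (r * p) * Suc (Suc s)" for q p :: nat
    by (simp add: algebra_simps)
  from this[of "r - 1" "r ^ s"]
  have "r * ((r - 1) * r ^ s) * r + r * (2 * r * (r - 1) * r ^ s * Suc s)
      \<le> 2 * r * (r - 1) * r ^ Suc s * Suc (Suc s)"
    by (simp only: power_Suc)
  ultimately show ?case by (rule derives_le)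
qed

section \<open>Remainders modulo \<open>1 + x^M + ... + x^((r-1)M)\<close>\<close>

text \<open>A bound on the length instead of the degree counts the coefficients to be computed, and
  length 0 singles out the zero polynomial.\<close>

definition short :: "nat \<Rightarrow> 'r::comm_ring_1 poly \<Rightarrow> bool" where
  "short n p \<longleftrightarrow> (\<forall>i\<ge>n. coeff p i = 0)"

abbreviation cf :: "'r::comm_ring_1 poly \<Rightarrow> 'r set" where
  "cf p \<equiv> range (coeff p)"

lemma short_0 [simp]: "short n 0"
  by (simp add: short_def)

lemma short_mono: "short m p \<Longrightarrow> m \<le> n \<Longrightarrow> short n p"
  by (simp add: short_def)

lemma short_add: "short n p \<Longrightarrow> short n q \<Longrightarrow> short n (p + q)"
  and short_diff: "short n p \<Longrightarrow> short n q \<Longrightarrow> short n (p - q)"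
  and short_smult: "short n p \<Longrightarrow> short n (smult c p)"
  by (simp_all add: short_def)

lemma short_sum: "(\<And>i. i \<in> A \<Longrightarrow> short n (f i)) \<Longrightarrow> short n (sum f A)"
  by (induction A rule: infinite_finite_induct) (auto intro: short_add)

lemma short_degree: "short (Suc (degree p)) p"
  by (auto simp: short_def intro: coeff_eq_0)

lemma degree_less_imp_short: "degree p < n \<Longrightarrow> short n p"
  by (auto simp: short_def intro: coeff_eq_0)

lemma short_mult:
  assumes "short m p" "short n q"
  shows "short (m + n - 1) (p * q)"
  unfolding short_def coeff_mult
proof (intro allI impI sum.neutral ballI)
  fix k i assume "m + n - 1 \<le> k" "i \<in> {..k}"
  then have "m \<le> i \<or> n \<le> k - i" by auto
  then show "coeff p i * coeff q (k - i) = 0" using assms by (auto simp: short_def)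
qed

lemma short_monom_mult: "short n p \<Longrightarrow> short (m + n) (monom c m * p)"
  by (auto simp: short_def coeff_monom_mult)

lemma poly_shift_cutoff: "(p :: 'r::comm_ring_1 poly) = poly_cutoff n p + monom 1 n * poly_shift n p"
  by (rule poly_eqI) (auto simp: coeff_poly_cutoff coeff_monom_mult coeff_poly_shift)

text \<open>For prime r and \<open>M = r ^ k\<close> this is the cyclotomic polynomial of order
  \<open>r ^ Suc k\<close>.\<close>

definition phi :: "nat \<Rightarrow> nat \<Rightarrow> 'r::comm_ring_1 poly" where
  "phi r M = (\<Sum>i<r. monom 1 (M * i))"

lemma phi_telescope: "phi r M * (monom 1 M - 1) = (monom 1 (r * M) - 1 :: 'a::comm_ring_1 poly)"
proof -
  have "phi r M = (\<Sum>i<r. monom 1 M ^ i :: 'a poly)" by (simp add: phi_def monom_power)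
  then show ?thesis
    using power_diff_1_eq[of "monom 1 M :: 'a poly" r]
    by (simp add: monom_power mult.commute[of _ "monom 1 M - 1"] mult.commute[of r])
qed

text \<open>As h has length at most M, its r shifted copies lie side by side without
  overlap.\<close>

lemma coeff_phi_mult:
  assumes "short M h" "M > 0"
  shows "coeff (h * phi r M) k = (if k < r * M then coeff h (k mod M) else 0)"
proof -
  have "coeff (h * phi r M) k = (\<Sum>j<r. if k < M * j then 0 else coeff h (k - M * j))"
    by (simp add: phi_def sum_distrib_left coeff_sum mult.commute[of h] coeff_monom_mult cong: if_cong)
  also have "\<dots> = (\<Sum>j<r. if j = k div M then coeff h (k mod M) else 0)"
  proof (rule sum.cong[OF refl])
    fix j
    consider "j = k div M" | "j < k div M" | "j > k div M" by linarith
    then show "(if k < M * j then 0 else coeff h (k - M * j)) = (if j = k div M then coeff h (k mod M) else 0)"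
    proof cases
      case 1
      moreover have "\<not> k < M * (k div M)" by (simp add: not_less)
      ultimately show ?thesis by (simp add: minus_mult_div_eq_mod)
    next
      case 2
      then have "M * Suc j \<le> M * (k div M)" by (intro mult_le_mono2) simp
      also have "\<dots> \<le> k" by simp
      finally have "k - M * j \<ge> M" by simp
      then show ?thesis using assms 2 by (simp add: short_def)
    next
      case 3
      then have "k < M * j" using \<open>M > 0\<close> by (simp add: div_less_iff_less_mult mult.commute)
      then show ?thesis using 3 by simp
    qed
  qed
  also have "\<dots> = (if k < r * M then coeff h (k mod M) else 0)"
    using \<open>M > 0\<close> by (simp add: div_less_iff_less_mult)
  finally show ?thesis .
qed

lemma coeff_phi: "M > 0 \<Longrightarrow> coeff (phi r M) k = (if k < r * M \<and> M dvd k then 1 else 0)"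
  using coeff_phi_mult[of M 1 r k] by (auto simp: short_def coeff_1 dvd_eq_mod_eq_0)

lemma
  assumes "M > 0" "r > 0"
  shows degree_phi: "degree (phi r M :: 'r::comm_ring_1 poly) = (r - 1) * M"
    and lead_coeff_phi: "coeff (phi r M :: 'r poly) ((r - 1) * M) = 1"
proof -
  show 1: "coeff (phi r M :: 'r poly) ((r - 1) * M) = 1"
    using assms by (simp add: coeff_phi)
  show "degree (phi r M :: 'r poly) = (r - 1) * M"
  proof (rule antisym)
    show "degree (phi r M :: 'r poly) \<le> (r - 1) * M"
    proof (rule degree_le, intro allI impI)
      fix k assume k: "(r - 1) * M < k"
      have "\<not> (k < r * M \<and> M dvd k)"
      proof
        assume *: "k < r * M \<and> M dvd k"
        then obtain q where "k = M * q" by (auto elim: dvdE)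
        with * k have "q < r" "r - 1 < q" by (auto simp: mult.commute)
        then show False by simp
      qed
      then show "coeff (phi r M :: 'r poly) k = 0" using assms by (simp add: coeff_phi)
    qed
    show "(r - 1) * M \<le> degree (phi r M :: 'r poly)"
      by (rule le_degree) (simp only: 1 one_neq_zero not_False_eq_True)
  qed
qed

text \<open>Since \<open>phi r M\<close> is monic, the leading coefficient of a multiple cannot
  cancel, even with zero divisors around.\<close>

lemma phi_dvd_short_eq_0:
  assumes "M > 0" "r > 0" "short ((r - 1) * M) u" "phi r M dvd u"
  shows "u = (0 :: 'r::comm_ring_1 poly)"
proof (rule ccontr)
  assume "u \<noteq> 0"
  obtain q where q: "u = phi r M * q" using assms(4) by (rule dvdE)
  then have "q \<noteq> 0" using \<open>u \<noteq> 0\<close> by auto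
  have "coeff u ((r - 1) * M + degree q) = coeff q (degree q)"
    using coeff_mult_degree_sum[of "phi r M :: 'r poly" q] q assms
    by (simp add: degree_phi lead_coeff_phi[unfolded One_nat_def])
  then show False using assms(3) \<open>q \<noteq> 0\<close> by (simp add: short_def)
qed

text \<open>Long division by a monic polynomial needs no inverses: each round removes the top
  coefficient.\<close>

lemma phi_remainder_exists:
  assumes "M > 0" "r > 0"
  shows "\<exists>u. short ((r - 1) * M) u \<and> phi r M dvd (p :: 'r::comm_ring_1 poly) - u"
proof -
  have "short n p \<Longrightarrow> \<exists>u. short ((r - 1) * M) u \<and> phi r M dvd p - u" for n and p :: "'r poly"
  proof (induction n arbitrary: p)
    case 0
    then have "short ((r - 1) * M) p" by (rule short_mono) simp
    then show ?case by (intro exI[of _ p]) simp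
  next
    case (Suc m)
    show ?case
    proof (cases "Suc m \<le> (r - 1) * M")
      case True
      with Suc.prems have "short ((r - 1) * M) p" by (rule short_mono)
      then show ?thesis by (intro exI[of _ p]) simp
    next
      case False
      define q where "q = monom (coeff p m) (m - (r - 1) * M)"
      have "short m (p - q * phi r M)"
        unfolding short_def
      proof (intro allI impI)
        fix i assume "i \<ge> m"
        show "coeff (p - q * phi r M) i = 0"
        proof (cases "i = m")
          case True
          then show ?thesis using False assms by (simp add: q_def coeff_monom_mult lead_coeff_phi[unfolded One_nat_def])
        next
          case 2: False
          have "(r - 1) * M < i - (m - (r - 1) * M)"
            using 2 \<open>i \<ge> m\<close> False by linarith
          then have "coeff (phi r M :: 'r poly) (i - (m - (r - 1) * M)) = 0"
            by (intro coeff_eq_0) (simp only: degree_phi[OF assms])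
          then show ?thesis using Suc.prems 2 \<open>i \<ge> m\<close>
            by (simp add: q_def coeff_monom_mult short_def del: One_nat_def)
        qed
      qed
      from Suc.IH[OF this] obtain u where u: "short ((r - 1) * M) u" "phi r M dvd p - q * phi r M - u"
        by (elim exE conjE)
      have "phi r M dvd (p - q * phi r M - u) + q * phi r M"
        by (rule dvd_add[OF u(2) dvd_triv_right])
      then show ?thesis by (intro exI[of _ u] conjI u(1)) (simp add: algebra_simps)
    qed
  qed
  from this[OF short_degree] show ?thesis .
qed

definition red :: "nat \<Rightarrow> nat \<Rightarrow> 'r::comm_ring_1 poly \<Rightarrow> 'r poly" where
  "red r M p = (SOME u. short ((r - 1) * M) u \<and> phi r M dvd p - u)"

text \<open>Modulo \<open>phi r M\<close> the variable x is a root of unity of order \<open>r M\<close>, and multiplying by a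
  power of x is a shift followed by one subtraction per coefficient.\<close>

definition phi_ideal :: "nat \<Rightarrow> nat \<Rightarrow> 'r::comm_ring_1 poly set" where
  "phi_ideal r M = {p. phi r M dvd p}"

lemma ring_ideal_phi: "ring_ideal (phi_ideal r M)"
  by (auto simp: ring_ideal_def phi_ideal_def)

context
  fixes r M :: nat
  assumes M: "M > 0" and r: "r > 0"
begin

lemma red_short: "short ((r - 1) * M) (red r M p)"
  and eqm_red: "eqm (phi_ideal r M) p (red r M p)"
  using someI_ex[OF phi_remainder_exists[OF M r, of p]] by (auto simp: red_def phi_ideal_def eqm_def)

lemma red_unique:
  assumes "short ((r - 1) * M) u" "eqm (phi_ideal r M) p u"
  shows "red r M p = u"
proof -
  have "phi r M dvd red r M p - u"
    using eqm_trans[OF ring_ideal_phi eqm_sym[OF ring_ideal_phi eqm_red] assms(2)]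
    by (simp add: eqm_def phi_ideal_def)
  from phi_dvd_short_eq_0[OF M r short_diff[OF red_short assms(1)] this] show ?thesis by simp
qed

lemma red_cong: "eqm (phi_ideal r M) p q \<Longrightarrow> red r M p = red r M q"
  by (rule red_unique[OF red_short eqm_trans[OF ring_ideal_phi _ eqm_red]])

lemma red_id: "short ((r - 1) * M) u \<Longrightarrow> red r M u = u"
  by (rule red_unique) (auto intro: eqm_refl ring_ideal_phi)

lemma red_add: "red r M (p + q) = red r M p + red r M q"
  by (intro red_unique short_add red_short eqm_add[OF ring_ideal_phi] eqm_red)

lemma eqm_smult: "eqm (phi_ideal r M) p q \<Longrightarrow> eqm (phi_ideal r M) (smult c p) (smult c q)"
  by (auto simp: eqm_def phi_ideal_def smult_diff_right[symmetric] intro: dvd_smult)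

lemma red_smult: "red r M (smult c p) = smult c (red r M p)"
  by (intro red_unique short_smult red_short eqm_smult eqm_red)

lemma red_mult: "red r M (p * red r M q) = red r M (p * q)"
  by (rule red_cong[OF eqm_mult[OF ring_ideal_phi eqm_refl[OF ring_ideal_phi]
      eqm_sym[OF ring_ideal_phi eqm_red]]])

lemma red_0 [simp]: "red r M 0 = 0"
  by (rule red_id) simp

text \<open>Up to length \<open>r * M\<close> one round of division is enough: the top M
  coefficients form a polynomial h, and \<open>h * phi r M\<close> is subtracted as a whole.\<close>

lemma coeff_red:
  assumes "short (r * M) q"
  shows "coeff (red r M q) i = (if i < (r - 1) * M then coeff q i - coeff q ((r - 1) * M + i mod M) else 0)"
proof -
  define h where "h = poly_cutoff M (poly_shift ((r - 1) * M) q)"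
  have h: "short M h" by (simp add: h_def short_def coeff_poly_cutoff)
  have *: "coeff (h * phi r M) k = (if k < r * M then coeff q ((r - 1) * M + k mod M) else 0)" for k
    using M by (simp add: coeff_phi_mult[OF h M]) (simp add: h_def coeff_poly_cutoff coeff_poly_shift add.commute)
  have u: "coeff (q - h * phi r M) k =
      (if k < (r - 1) * M then coeff q k - coeff q ((r - 1) * M + k mod M) else 0)" for k
  proof -
    have "r * M = (r - 1) * M + M" using r by (cases r) auto
    show ?thesis
    proof (cases "k < (r - 1) * M \<or> k \<ge> r * M")
      case True
      then show ?thesis using * assms \<open>r * M = _\<close> by (auto simp: short_def)
    next
      case False
      then obtain l where "k = (r - 1) * M + l" "l < M"
        using \<open>r * M = _\<close> by (metis add_less_cancel_left le_Suc_ex not_le)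
      then show ?thesis using * False by simp
    qed
  qed
  have "red r M q = q - h * phi r M"
  proof (rule red_unique)
    show "short ((r - 1) * M) (q - h * phi r M)" by (simp add: short_def u del: coeff_diff)
    show "eqm (phi_ideal r M) q (q - h * phi r M)" by (simp add: eqm_def phi_ideal_def)
  qed
  then show ?thesis by (simp add: u del: coeff_diff)
qed

lemma eqm_monom_period: "eqm (phi_ideal r M) (monom 1 (r * M)) 1"
  unfolding eqm_def phi_ideal_def by (simp add: phi_telescope[symmetric])

lemma red_monom_mult:
  assumes u: "short ((r - 1) * M) u"
  shows "\<exists>c1\<in>cf u. \<exists>c2\<in>cf u. coeff (red r M (monom 1 e * u)) i = c1 - c2"
proof -
  define T where "T = r * M"
  have T: "T > 0" "(r - 1) * M \<le> T" using M r by (auto simp: T_def)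
  define e' where "e' = e mod T"
  have e': "e' < T" using T by (simp add: e'_def)
  define p where "p = monom 1 e' * u"
  \<comment> \<open>The cyclic shift: what extends beyond T wraps around, because
    \<open>x ^ T\<close> is 1. One wrap suffices, as u has length at most T and e' is below
    T.\<close>
  define q where "q = poly_cutoff T p + poly_shift T p"
  have cu: "coeff u k = 0" if "k \<ge> (r - 1) * M" for k using u that by (simp add: short_def)
  have 0: "0 \<in> cf u" using cu[of "(r - 1) * M"] by (metis order_refl rangeI)
  have cp: "coeff p k = (if k < e' then 0 else coeff u (k - e'))" for k
    by (simp add: p_def coeff_monom_mult)
  have cq: "coeff q k = (if k < T then if k < e' then coeff u (k + T - e') else coeff u (k - e') else 0)" for k
    using e' T by (auto simp: q_def coeff_poly_cutoff coeff_poly_shift cp cu)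
  have "monom 1 e * u = monom 1 e' * (monom 1 T) ^ (e div T) * u"
    by (simp add: monom_power mult_monom e'_def add.commute)
  moreover have "eqm (phi_ideal r M) (monom 1 e' * (monom 1 T) ^ (e div T) * u) (monom 1 e' * 1 ^ (e div T) * u)"
    unfolding T_def
    by (intro eqm_mult[OF ring_ideal_phi] eqm_pow[OF ring_ideal_phi] eqm_monom_period eqm_refl[OF ring_ideal_phi])
  ultimately have "eqm (phi_ideal r M) (monom 1 e * u) p"
    by (simp add: p_def)
  moreover have "eqm (phi_ideal r M) p q"
  proof -
    have "eqm (phi_ideal r M) (poly_cutoff T p + monom 1 T * poly_shift T p) (poly_cutoff T p + 1 * poly_shift T p)"
      unfolding T_def
      by (intro eqm_add[OF ring_ideal_phi] eqm_mult[OF ring_ideal_phi] eqm_monom_period eqm_refl[OF ring_ideal_phi])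
    then show ?thesis unfolding q_def using poly_shift_cutoff[of p T] by simp
  qed
  ultimately have "red r M (monom 1 e * u) = red r M q"
    using red_cong eqm_trans[OF ring_ideal_phi] by blast
  moreover have "coeff (red r M q) i = (if i < (r - 1) * M then coeff q i - coeff q ((r - 1) * M + i mod M) else 0)"
    by (rule coeff_red) (simp add: short_def cq T_def)
  moreover have q: "coeff q k \<in> cf u" for k unfolding cq using 0 by simp
  ultimately show ?thesis
  proof (cases "i < (r - 1) * M")
    case True
    with \<open>red r M (monom 1 e * u) = red r M q\<close> \<open>coeff (red r M q) i = _\<close> show ?thesis
      by (intro bexI[OF _ q[of i]] bexI[OF _ q[of "(r - 1) * M + i mod M"]]) simp
  next
    case False
    with \<open>red r M (monom 1 e * u) = red r M q\<close> \<open>coeff (red r M q) i = _\<close> show ?thesis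
      by (intro bexI[OF _ 0] bexI[OF _ 0]) simp
  qed
qed

lemma red_signed_monom_mult:
  assumes "a \<in> range (monom 1) \<union> uminus ` range (monom 1)"
  shows "\<exists>c1\<in>cf (red r M u). \<exists>c2\<in>cf (red r M u). coeff (red r M (a * u)) i = c1 - c2"
proof -
  obtain e where "a = monom 1 e \<or> a = - monom 1 e" using assms by auto
  then show ?thesis
  proof
    assume "a = monom 1 e"
    then show ?thesis using red_monom_mult[OF red_short, of u e i] by (simp add: red_mult)
  next
    assume a: "a = - monom 1 e"
    have "red r M (a * u) = smult (-1) (red r M (monom 1 e * red r M u))"
      unfolding red_mult red_smult[symmetric] by (simp add: a)
    then have *: "coeff (red r M (a * u)) i = - coeff (red r M (monom 1 e * red r M u)) i" by simp
    obtain c1 c2 where c: "c1 \<in> cf (red r M u)" "c2 \<in> cf (red r M u)"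
      "coeff (red r M (monom 1 e * red r M u)) i = c1 - c2"
      using red_monom_mult[OF red_short, of u e i] by blast
    show ?thesis by (intro bexI[OF _ c(2)] bexI[OF _ c(1)]) (simp add: * c(3))
  qed
qed

end

lemma derives_cf:
  assumes I: "ring_ideal I" and "short d u" and "derives I C K c (coeff u ` {..<d})"
  shows "derives I C K c (cf u)"
proof (rule derives_cong[OF I assms(3)])
  fix w assume "w \<in> cf u"
  then obtain i where i: "w = coeff u i" by auto
  show "\<exists>k\<in>insert 0 (K \<union> coeff u ` {..<d}). eqm I w k"
    using assms(2) i eqm_refl[OF I, of w] by (cases "i < d") (auto simp: short_def)
qed

text \<open>Simulation one level down. A step whose factors are signed powers of x becomes, for each
  of the \<open>(r - 1) * M\<close> coefficients, a signed sum of four known coefficients. Thus the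
  roots of unity of the quotient demand only the constants 1 and -1 in the base ring.\<close>

lemma derives_phi:
  assumes I: "ring_ideal I" and r: "r > 0" and M: "M > 0" and C: "1 \<in> C" "-1 \<in> C"
  shows "derives (phi_ideal r M) (range (monom 1) \<union> uminus ` range (monom 1)) K c W \<Longrightarrow>
    (\<Union>k\<in>K. cf (red r M k)) \<subseteq> K' \<Longrightarrow> derives I C K' (c * ((r - 1) * M * 4)) (\<Union>w\<in>W. cf (red r M w))"
proof (induction arbitrary: K' rule: derives.induct)
  case (known W K c)
  show ?case
  proof (rule derives.known, clarify)
    fix w i assume "w \<in> W"
    then obtain k where k: "k \<in> insert 0 K" "eqm (phi_ideal r M) w k" using known(1) by blast
    then have w: "red r M w = red r M k" using red_cong[OF M r] by blast
    have "coeff (red r M k) i \<in> insert 0 K'"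
    proof (cases "k = 0")
      case True
      then show ?thesis by (simp add: red_0[OF M r])
    next
      case False
      then have "k \<in> K" using k(1) by simp
      then show ?thesis using known(2) by blast
    qed
    then show "\<exists>k\<in>insert 0 K'. eqm I (coeff (red r M w) i) k"
      unfolding w using eqm_refl[OF I] by (rule bexI[rotated])
  qed
next
  case (step u K v a b c W)
  let ?w = "a * u + b * v"
  let ?d = "(r - 1) * M"
  have kn: "cf (red r M x) \<subseteq> insert 0 K'" if "x \<in> insert 0 K" for x
  proof (cases "x = 0")
    case True
    then show ?thesis by (simp add: red_0[OF M r])
  next
    case False
    then have "x \<in> K" using that by simp
    then show ?thesis using step.prems by blast
  qed
  have "derives I C K' (?d * 4) (coeff (red r M ?w) ` {..<?d})"
  proof (rule derives_sums[OF I C(1)])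
    show "card (coeff (red r M ?w) ` {..<?d}) \<le> ?d" using card_image_le[of "{..<?d}"] by simp
    fix x assume "x \<in> coeff (red r M ?w) ` {..<?d}"
    then obtain i where i: "x = coeff (red r M ?w) i" by auto
    obtain c1 c2 where c12: "c1 \<in> cf (red r M u)" "c2 \<in> cf (red r M u)" "coeff (red r M (a * u)) i = c1 - c2"
      using red_signed_monom_mult[OF M r step.hyps(3)] by blast
    obtain c3 c4 where c34: "c3 \<in> cf (red r M v)" "c4 \<in> cf (red r M v)" "coeff (red r M (b * v)) i = c3 - c4"
      using red_signed_monom_mult[OF M r step.hyps(4)] by blast
    define U where "U = (\<lambda>n. [c1, c2, c3, c4] ! n)"
    have x: "x = (\<Sum>n\<in>{..<4::nat}. (-1) ^ n * U n)"
      unfolding i red_add[OF M r] coeff_add c12 c34 by (simp add: U_def numeral_eq_Suc)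
    have "c1 \<in> insert 0 K'" "c2 \<in> insert 0 K'" "c3 \<in> insert 0 K'" "c4 \<in> insert 0 K'"
      using c12(1,2) c34(1,2) kn[OF step.hyps(1)] kn[OF step.hyps(2)] by blast+
    then have U: "U ` {..<4} \<subseteq> insert 0 K'"
      by (auto simp: U_def less_Suc_eq numeral_eq_Suc)
    have S: "(\<lambda>n. (-1) ^ n) ` {..<4::nat} \<subseteq> C"
      using C by (auto simp: less_Suc_eq numeral_eq_Suc)
    show "\<exists>A c u. finite A \<and> card A \<le> 4 \<and> c ` A \<subseteq> C \<and> u ` A \<subseteq> insert 0 K' \<and>
        eqm I x (\<Sum>i\<in>(A::nat set). c i * u i)"
      by (intro exI[of _ "{..<4}"] exI[of _ "\<lambda>n. (-1) ^ n"] exI[of _ U] conjI U S)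
        (simp_all add: x eqm_refl[OF I])
  qed simp
  then have "derives I C K' (?d * 4) (cf (red r M ?w))"
    by (rule derives_cf[OF I red_short[OF M r]])
  moreover have "derives I C (K' \<union> cf (red r M ?w)) (c * (?d * 4)) (\<Union>w\<in>W. cf (red r M w))"
    by (rule step.IH) (use step.prems in blast)
  ultimately have "derives I C K' (?d * 4 + c * (?d * 4)) (\<Union>w\<in>W. cf (red r M w))"
    by (rule derives_cut[OF I])
  then show ?case by simp
qed

section \<open>Fast multiplication by a fixed polynomial\<close>

text \<open>A subring: the transform of the fixed factor is precomputed and has to consist of
  admissible constants again.\<close>

definition const_ring :: "'r::comm_ring_1 set \<Rightarrow> bool" where
  "const_ring C \<longleftrightarrow> 1 \<in> C \<and> (\<forall>a\<in>C. \<forall>b\<in>C. a - b \<in> C \<and> a * b \<in> C)"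

lemma
  assumes "const_ring C"
  shows const_ring_1: "1 \<in> C" and const_ring_diff: "a \<in> C \<Longrightarrow> b \<in> C \<Longrightarrow> a - b \<in> C"
    and const_ring_mult: "a \<in> C \<Longrightarrow> b \<in> C \<Longrightarrow> a * b \<in> C" and const_ring_0: "0 \<in> C"
    and const_ring_uminus: "a \<in> C \<Longrightarrow> - a \<in> C" and const_ring_add: "a \<in> C \<Longrightarrow> b \<in> C \<Longrightarrow> a + b \<in> C"
proof -
  show 1: "1 \<in> C" and d: "\<And>a b. a \<in> C \<Longrightarrow> b \<in> C \<Longrightarrow> a - b \<in> C" and "a \<in> C \<Longrightarrow> b \<in> C \<Longrightarrow> a * b \<in> C"
    using assms by (auto simp: const_ring_def)
  show 0: "0 \<in> C" using d[OF 1 1] by simp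
  show u: "\<And>a. a \<in> C \<Longrightarrow> - a \<in> C" using d[OF 0] by simp
  show "a \<in> C \<Longrightarrow> b \<in> C \<Longrightarrow> a + b \<in> C" using d[OF _ u, of a b] by simp
qed

lemma const_ring_sum: "const_ring C \<Longrightarrow> (\<And>i. i \<in> A \<Longrightarrow> f i \<in> C) \<Longrightarrow> sum f A \<in> C"
  by (induction A rule: infinite_finite_induct) (auto intro: const_ring_0 const_ring_add)

lemma const_ring_prod: "const_ring C \<Longrightarrow> (\<And>i. i \<in> A \<Longrightarrow> f i \<in> C) \<Longrightarrow> prod f A \<in> C"
  by (induction A rule: infinite_finite_induct) (auto intro: const_ring_1 const_ring_mult)

lemma const_ring_power: "const_ring C \<Longrightarrow> a \<in> C \<Longrightarrow> a ^ n \<in> C"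
  by (induction n) (auto intro: const_ring_1 const_ring_mult)

lemma const_ring_of_nat: "const_ring C \<Longrightarrow> of_nat n \<in> C"
  by (induction n) (auto intro: const_ring_0 const_ring_1 const_ring_add)

lemma cf_subset_iff: "cf p \<subseteq> C \<longleftrightarrow> (\<forall>i. coeff p i \<in> C)"
  by auto

lemma cf_mult: "const_ring C \<Longrightarrow> cf p \<subseteq> C \<Longrightarrow> cf q \<subseteq> C \<Longrightarrow> cf (p * q) \<subseteq> C"
  unfolding cf_subset_iff coeff_mult by (auto intro!: const_ring_sum const_ring_mult)

lemma cf_sum: "const_ring C \<Longrightarrow> (\<And>i. i \<in> A \<Longrightarrow> cf (f i) \<subseteq> C) \<Longrightarrow> cf (sum f A) \<subseteq> C"
  unfolding cf_subset_iff coeff_sum by (blast intro: const_ring_sum)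

lemma cf_monom: "const_ring C \<Longrightarrow> c \<in> C \<Longrightarrow> cf (monom c n) \<subseteq> C"
  unfolding cf_subset_iff by (auto intro: const_ring_0)

lemma red_sum: "M > 0 \<Longrightarrow> r > 0 \<Longrightarrow> red r M (sum f A) = (\<Sum>i\<in>A. red r M (f i))"
  by (induction A rule: infinite_finite_induct) (auto simp: red_add)

lemma red_as_sum:
  assumes "M > 0" "r > 0"
  shows "red r M p = (\<Sum>l\<le>degree p. smult (coeff p l) (red r M (monom 1 l)))"
proof -
  have "red r M p = red r M (\<Sum>l\<le>degree p. monom (coeff p l) l)"
    by (simp only: poly_as_sum_of_monoms)
  also have "\<dots> = (\<Sum>l\<le>degree p. red r M (smult (coeff p l) (monom 1 l)))"
    using assms by (simp add: red_sum smult_monom)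
  finally show ?thesis by (simp only: red_smult[OF assms])
qed

text \<open>Reduction only adds and subtracts coefficients, so any additive subgroup S is preserved.
  Besides \<open>C\<close> this is applied to the polynomials of bounded length, as coefficients of
  polynomials in y.\<close>

lemma coeff_red_closed:
  assumes M: "M > 0" and r: "r \<ge> 2" and z: "0 \<in> S" and d: "\<And>a b. a \<in> S \<Longrightarrow> b \<in> S \<Longrightarrow> a - b \<in> S"
    and p: "\<And>i. coeff p i \<in> S"
  shows "coeff (red r M p) i \<in> S"
proof -
  have add: "a + b \<in> S" if "a \<in> S" "b \<in> S" for a b
    using d[OF that(1) d[OF z that(2)]] by simp
  have sum: "sum f A \<in> S" if "\<And>i. i \<in> A \<Longrightarrow> f i \<in> S" for f and A :: "nat set"
    using that by (induction A rule: infinite_finite_induct) (auto intro: z add)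
  have r0: "r > 0" using r by simp
  have "coeff (smult (coeff p l) (red r M (monom 1 l))) i \<in> S" for l
  proof -
    have s: "short ((r - 1) * M) [:coeff p l:]"
      using M r by (auto simp: short_def coeff_pCons split: nat.splits)
    have e: "smult (coeff p l) (red r M (monom 1 l)) = red r M (monom 1 l * [:coeff p l:])"
      by (simp add: red_smult[OF M r0, symmetric] mult.commute)
    have "x \<in> S" if "x \<in> cf [:coeff p l:]" for x
      using that z p by (auto simp: coeff_pCons split: nat.splits)
    then show ?thesis using red_monom_mult[OF M r0 s, of l i] d unfolding e by auto
  qed
  then show ?thesis unfolding red_as_sum[OF M r0, of p] coeff_sum by (intro sum)
qed

lemma cf_red: "const_ring C \<Longrightarrow> M > 0 \<Longrightarrow> r \<ge> 2 \<Longrightarrow> cf p \<subseteq> C \<Longrightarrow> cf (red r M p) \<subseteq> C"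
  unfolding cf_subset_iff using coeff_red_closed[of M r C p]
  by (auto intro: const_ring_0 const_ring_diff)

text \<open>The factor \<open>r ^ E\<close> avoids divisions by r, which need not be possible in the ring.\<close>

definition red_mult_cost ::
    "'r::comm_ring_1 set \<Rightarrow> 'r set \<Rightarrow> nat \<Rightarrow> nat \<Rightarrow> nat \<Rightarrow> nat \<Rightarrow> bool" where
  "red_mult_cost I C r k E T \<longleftrightarrow>
     (\<forall>a b. short ((r - 1) * r ^ k) a \<longrightarrow> short ((r - 1) * r ^ k) b \<longrightarrow> cf b \<subseteq> C \<longrightarrow>
        derives I C (cf a) T (cf (red r (r ^ k) (smult (of_nat (r ^ E)) (a * b)))))"

text \<open>Schoolbook product, the start of the recursion: each output is a linear form in the
  coefficients of a, with constants taken from the reduced shifts of b.\<close>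

lemma red_mult_cost_naive:
  assumes I: "ring_ideal I" and C: "const_ring C" and r: "r \<ge> 2"
  shows "red_mult_cost I C r k 0 (((r - 1) * r ^ k) * ((r - 1) * r ^ k))"
  unfolding red_mult_cost_def
proof (intro allI impI)
  fix a b :: "'a poly"
  let ?d = "(r - 1) * r ^ k"
  let ?M = "r ^ k"
  assume a: "short ?d a" and b: "short ?d b" "cf b \<subseteq> C"
  have M: "?M > 0" "r > 0" using r by auto
  have a_sum: "a = (\<Sum>l<?d. smult (coeff a l) (monom 1 l))"
    using a by (intro poly_eqI) (auto simp: coeff_sum short_def smult_monom)
  have "a * b = (\<Sum>l<?d. smult (coeff a l) (monom 1 l)) * b" using a_sum by (rule arg_cong)
  then have "red r ?M (a * b) = (\<Sum>l<?d. red r ?M (smult (coeff a l) (monom 1 l * b)))"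
    by (simp only: sum_distrib_right red_sum[OF M] mult_smult_left)
  then have ab: "red r ?M (a * b) = (\<Sum>l<?d. smult (coeff a l) (red r ?M (monom 1 l * b)))"
    by (simp only: red_smult[OF M])
  have "derives I C (cf a) (?d * ?d) (coeff (red r ?M (a * b)) ` {..<?d})"
  proof (rule derives_sums[OF I const_ring_1[OF C]])
    show "card (coeff (red r ?M (a * b)) ` {..<?d}) \<le> ?d" using card_image_le[of "{..<?d}"] by simp
    fix x assume "x \<in> coeff (red r ?M (a * b)) ` {..<?d}"
    then obtain i where i: "x = coeff (red r ?M (a * b)) i" by auto
    have x: "x = (\<Sum>l<?d. coeff (red r ?M (monom 1 l * b)) i * coeff a l)"
      unfolding i ab by (simp add: coeff_sum mult.commute)
    have c: "coeff (red r ?M (monom 1 l * b)) i \<in> C" for l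
      using cf_red[OF C M(1) r cf_mult[OF C cf_monom[OF C const_ring_1[OF C]] b(2)]] by blast
    show "\<exists>A c u. finite A \<and> card A \<le> ?d \<and> c ` A \<subseteq> C \<and> u ` A \<subseteq> insert 0 (cf a) \<and>
        eqm I x (\<Sum>i\<in>(A::nat set). c i * u i)"
      by (intro exI[of _ "{..<?d}"] exI[of _ "\<lambda>l. coeff (red r ?M (monom 1 l * b)) i"] exI[of _ "coeff a"])
        (use c eqm_refl[OF I] x in auto)
  qed simp
  then show "derives I C (cf a) (?d * ?d) (cf (red r ?M (smult (of_nat (r ^ 0)) (a * b))))"
    using derives_cf[OF I red_short[OF M]] by simp
qed

text \<open>As r is prime, multiplication by j permutes the residues modulo r. Modulo
  \<open>z ^ r = 1\<close> the sum is therefore \<open>phi r M\<close> itself.\<close>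

lemma sum_power_phi_ideal:
  assumes r: "r = 2 \<or> r = 3" and M: "M > 0" and j: "\<not> r dvd j"
  shows "(\<Sum>i<r. monom 1 (M * i * j)) \<in> (phi_ideal r M :: 'r::comm_ring_1 poly set)"
proof -
  let ?J = "phi_ideal r M :: 'r poly set"
  let ?z = "monom 1 M :: 'r poly"
  have r0: "r > 0" using r by auto
  have "eqm ?J (?z ^ r) 1"
    using eqm_monom_period[OF M r0] by (simp add: monom_power mult.commute)
  then have red_exp: "eqm ?J (?z ^ n) (?z ^ (n mod r))" for n
    using eqm_pow_period[OF ring_ideal_phi, of r M ?z r "n mod r" "n div r"] by simp
  have 1: "eqm ?J (\<Sum>i<r. ?z ^ (i * j)) (\<Sum>i<r. ?z ^ (i * j mod r))"
    by (intro eqm_sum[OF ring_ideal_phi] red_exp)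
  have 2: "(\<Sum>i<r. ?z ^ (i * j mod r)) = (\<Sum>i<r. ?z ^ i)"
    using r
  proof
    assume r2: "r = 2"
    then have "j mod 2 = 1" using j by presburger
    then show ?thesis using r2 by (simp add: numeral_2_eq_2)
  next
    assume r3: "r = 3"
    have s3: "sum f {..<3} = f 0 + f 1 + f 2" for f :: "nat \<Rightarrow> 'r poly"
      by (simp add: numeral_3_eq_3 numeral_2_eq_2)
    have "(j mod 3 = 1 \<and> 2 * j mod 3 = 2) \<or> (j mod 3 = 2 \<and> 2 * j mod 3 = 1)"
      using j r3 by presburger
    then show ?thesis unfolding r3 s3 by (elim disjE conjE) (simp_all add: add_ac)
  qed
  have 3: "(\<Sum>i<r. ?z ^ i) = phi r M" by (simp add: phi_def monom_power)
  have "(\<Sum>i<r. ?z ^ (i * j)) - phi r M \<in> ?J" using 1 unfolding 2 3 eqm_def .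
  moreover have "phi r M \<in> ?J" by (simp add: phi_ideal_def)
  ultimately have "(\<Sum>i<r. ?z ^ (i * j)) - phi r M + phi r M \<in> ?J"
    by (rule ring_ideal_add[OF ring_ideal_phi])
  then have "(\<Sum>i<r. ?z ^ (i * j)) \<in> ?J" by simp
  then show ?thesis by (simp add: monom_power mult.assoc)
qed

lemma principal_root_monom:
  assumes r: "r = 2 \<or> r = 3" and q: "q > 0"
  shows "principal_root (phi_ideal r (q * r ^ s)) r s (monom 1 q :: 'r::comm_ring_1 poly)"
  unfolding principal_root_def
proof (intro conjI allI impI)
  have M: "q * r ^ s > 0" and r0: "r > 0" using r q by auto
  show "eqm (phi_ideal r (q * r ^ s)) (monom 1 q ^ r ^ Suc s :: 'r poly) 1"
    using eqm_monom_period[OF M r0] by (simp add: monom_power mult_ac)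
  fix j assume "\<not> r dvd j"
  from sum_power_phi_ideal[OF r M this]
  show "(\<Sum>i<r. monom 1 q ^ (r ^ s * i * j)) \<in> (phi_ideal r (q * r ^ s) :: 'r poly set)"
    by (simp add: monom_power mult_ac)
qed

section \<open>The recursive product modulo \<open>phi r (r ^ k)\<close>\<close>

definition slices :: "nat \<Rightarrow> nat \<Rightarrow> 'r::comm_ring_1 poly \<Rightarrow> 'r poly poly" where
  "slices m n a = (\<Sum>l<n. monom (poly_cutoff m (poly_shift (m * l) a)) l)"

lemma coeff_slices:
  "coeff (slices m n a) l = (if l < n then poly_cutoff m (poly_shift (m * l) a) else 0)"
  by (simp add: slices_def coeff_sum)

lemma poly_slices:
  assumes "short (m * n) a" and m: "m > 0"
  shows "poly (slices m n a) (monom 1 m) = a"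
proof (rule poly_eqI)
  fix k
  have "coeff (poly (slices m n a) (monom 1 m)) k =
      (\<Sum>l<n. coeff (poly_cutoff m (poly_shift (m * l) a) * monom 1 (m * l)) k)"
    by (simp add: slices_def poly_sum poly_monom coeff_sum monom_power mult.commute)
  also have "\<dots> = (\<Sum>l<n. if l = k div m then coeff a k else 0)"
  proof (rule sum.cong[OF refl])
    fix l
    have "(m * l \<le> k \<and> k - m * l < m) \<longleftrightarrow> l = k div m"
    proof
      assume "m * l \<le> k \<and> k - m * l < m"
      then have "m * l \<le> k" "k < m * Suc l" by auto
      then show "l = k div m" by (rule div_nat_eqI[symmetric])
    next
      assume "l = k div m"
      then show "m * l \<le> k \<and> k - m * l < m" using m by (simp add: minus_mult_div_eq_mod)
    qed
    then show "coeff (poly_cutoff m (poly_shift (m * l) a) * monom 1 (m * l)) k = (if l = k div m then coeff a k else 0)"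
      by (auto simp: mult.commute[of _ "monom 1 (m * l)"] coeff_monom_mult coeff_poly_cutoff coeff_poly_shift)
  qed
  also have "\<dots> = coeff a k"
    using assms by (auto simp: short_def div_less_iff_less_mult mult.commute not_less)
  finally show "coeff (poly (slices m n a) (monom 1 m)) k = coeff a k" .
qed

lemma poly_eq_dft: "short n A \<Longrightarrow> poly A (w ^ e) = dft w (coeff A) n e"
proof -
  assume A: "short n A"
  have "A = (\<Sum>i<n. monom (coeff A i) i)"
    using A by (intro poly_eqI) (auto simp: coeff_sum short_def)
  then have "poly A (w ^ e) = poly (\<Sum>i<n. monom (coeff A i) i) (w ^ e)" by simp
  then show ?thesis by (simp add: poly_sum poly_monom dft_def power_mult)
qed

text \<open>The points \<open>w ^ e\<close> with e not divisible by r are roots of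
  \<open>phi r (r ^ s)\<close> modulo J, so reduction does not change the values there.\<close>

lemma eqm_poly_red:
  fixes P :: "'d::comm_ring_1 poly"
  assumes J: "ring_ideal J" and "principal_root J r s w" and e: "\<not> r dvd e" and r: "r > 0"
  shows "eqm J (poly (red r (r ^ s) P) (w ^ e)) (poly P (w ^ e))"
proof -
  have "eqm (phi_ideal r (r ^ s)) P (red r (r ^ s) P)" using eqm_red[of "r ^ s" r P] r by simp
  then obtain Q where Q: "P - red r (r ^ s) P = phi r (r ^ s) * Q"
    unfolding eqm_def phi_ideal_def by (auto elim: dvdE)
  have "poly (phi r (r ^ s)) (w ^ e) = (\<Sum>i<r. w ^ (r ^ s * i * e))"
    by (simp add: phi_def poly_sum poly_monom power_mult[symmetric] mult_ac)
  then have "poly (phi r (r ^ s)) (w ^ e) \<in> J" using assms by (simp add: principal_root_def)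
  then have "poly P (w ^ e) - poly (red r (r ^ s) P) (w ^ e) \<in> J"
    unfolding poly_diff[symmetric] Q poly_mult by (rule ring_ideal_mult_right[OF J])
  then show ?thesis using eqm_sym[OF J] by (simp add: eqm_def)
qed

text \<open>Pieces of length \<open>2 * m\<close> placed at distance m overlap at most in
  pairs.\<close>

lemma coeff_overlap_add:
  assumes f: "\<And>l. short (2 * m) (f l)" and m: "m > 0"
  shows "\<exists>c1\<in>insert 0 (\<Union>l\<in>{..<n}. cf (f l)). \<exists>c2\<in>insert 0 (\<Union>l\<in>{..<n}. cf (f l)).
    coeff (\<Sum>l<n. f l * monom 1 (m * l)) k = c1 + c2"
proof -
  define g where "g l = (if l < n \<and> m * l \<le> k then coeff (f l) (k - m * l) else 0)" for l
  \<comment> \<open>In the first m positions there is no previous piece, and truncated subtraction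
    would count piece 0 twice.\<close>
  define c2 where "c2 = (if k div m = 0 then 0 else g (k div m - 1))"
  have "coeff (\<Sum>l<n. f l * monom 1 (m * l)) k = (\<Sum>l<n. g l)"
    by (auto simp: coeff_sum g_def mult.commute[of _ "monom 1 (m * _)"] coeff_monom_mult intro!: sum.cong)
  also have "\<dots> = sum g ({..<n} \<union> {k div m - 1, k div m})"
    by (rule sum.mono_neutral_left) (auto simp: g_def)
  also have "\<dots> = sum g {k div m - 1, k div m}"
  proof (rule sum.mono_neutral_right)
    show "\<forall>i\<in>{..<n} \<union> {k div m - 1, k div m} - {k div m - 1, k div m}. g i = 0"
    proof
      fix l assume "l \<in> {..<n} \<union> {k div m - 1, k div m} - {k div m - 1, k div m}"
      then have l: "l \<noteq> k div m - 1" "l \<noteq> k div m" by auto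
      show "g l = 0"
      proof (cases "m * l \<le> k")
        case True
        then have "l \<le> k div m" using m by (simp add: less_eq_div_iff_mult_less_eq mult.commute)
        with l have "l + 2 \<le> k div m" by linarith
        then have "m * (l + 2) \<le> m * (k div m)" by (rule mult_le_mono2)
        also have "\<dots> \<le> k" by simp
        finally have "2 * m \<le> k - m * l" by (simp add: algebra_simps)
        then show ?thesis using f by (simp add: g_def short_def)
      qed (simp add: g_def)
    qed
  qed auto
  also have "\<dots> = g (k div m) + c2"
    by (cases "k div m = 0") (simp_all add: c2_def add.commute)
  finally have "coeff (\<Sum>l<n. f l * monom 1 (m * l)) k = g (k div m) + c2" .
  moreover have "g l \<in> insert 0 (\<Union>l\<in>{..<n}. cf (f l))" for l by (auto simp: g_def)
  moreover from this have "c2 \<in> insert 0 (\<Union>l\<in>{..<n}. cf (f l))" by (simp add: c2_def)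
  ultimately show ?thesis by blast
qed

lemma smult_sum_right: "smult c (sum f A) = (\<Sum>i\<in>A. smult c (f i))"
  by (induction A rule: infinite_finite_induct) (auto simp: smult_add_right)

text \<open>The recursion of Schoenhage and Strassen (\<open>r = 2\<close>), and of Schoenhage for characteristic 2
  (\<open>r = 3\<close>): cutting the arguments into slices of length m turns the product into one of polynomials
  in \<open>y = x^m\<close> modulo \<open>phi r t\<close>, with coefficients of length at most \<open>2 m = (r - 1) M\<close>. These may be
  reduced modulo \<open>phi r M\<close>, where a power of x serves as the root of unity of the Fourier transform.\<close>

lemma red_mult_cost_step:
  fixes I C :: "'r::comm_ring_1 set"
  assumes I: "ring_ideal I" and C: "const_ring C" and r: "r = 2 \<or> r = 3"
    and si: "s \<le> i" and m: "(r - 1) * r ^ i = 2 * m" and mt: "m * r ^ s = r ^ k"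
    and cost: "red_mult_cost I C r i E T"
  shows "red_mult_cost I C r k (E + Suc s)
    ((r - 1) * r ^ s * T + (r - 1) * r ^ k * (24 * r * Suc s + 4))"
  unfolding red_mult_cost_def
proof (intro allI impI)
  fix a b :: "'r poly"
  assume a: "short ((r - 1) * r ^ k) a" and b: "short ((r - 1) * r ^ k) b" and bC: "cf b \<subseteq> C"
  define n t M where "n = (r - 1) * r ^ s" and "t = r ^ s" and "M = r ^ i"
  define J where "J = (phi_ideal r M :: 'r poly set)"
  define D where "D = (range (monom 1) \<union> uminus ` range (monom 1) :: 'r poly set)"
  \<comment> \<open>Since \<open>M = r ^ (i - s) * r ^ s\<close>, this power of x is a principal
    root of order \<open>r ^ Suc s\<close> modulo \<open>phi r M\<close>.\<close>
  define w where "w = (monom 1 (r ^ (i - s)) :: 'r poly)"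
  have r2: "r \<ge> 2" and r0: "r > 0" using r by auto
  have M0: "M > 0" and t0: "t > 0" using r0 by (auto simp: M_def t_def)
  have N0: "r ^ k > 0" using r0 by simp
  have m0: "m > 0" using mt N0 by (cases m) auto
  have rM: "(r - 1) * M = 2 * m" using m by (simp add: M_def)
  have Mq: "M = r ^ (i - s) * r ^ s" using si by (simp add: M_def power_add[symmetric])
  have J: "ring_ideal J" by (simp add: J_def ring_ideal_phi)
  have root: "principal_root J r s w"
    unfolding J_def w_def Mq by (rule principal_root_monom[OF r]) (use r0 in simp)
  have D: "w ^ e \<in> D \<and> - (w ^ e) \<in> D" for e
    by (auto simp: D_def w_def monom_power)
  have C1: "1 \<in> C" "-1 \<in> C" using C by (auto intro: const_ring_1 const_ring_uminus)
  define A B where "A = slices m n a" and "B = slices m n b"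
  have mn: "m * n = (r - 1) * r ^ k" unfolding n_def mt[symmetric] by (simp only: mult_ac)
  have A: "short n A" and B: "short n B" by (auto simp: A_def B_def short_def coeff_slices)
  have cA: "short m (coeff A l)" "cf (coeff A l) \<subseteq> insert 0 (cf a)" for l
    by (auto simp: A_def coeff_slices short_def coeff_poly_cutoff coeff_poly_shift)
  have cB: "short m (coeff B l)" "cf (coeff B l) \<subseteq> C" for l
    using bC const_ring_0[OF C] by (auto simp: B_def coeff_slices short_def coeff_poly_cutoff coeff_poly_shift)
  have phi_der: "derives I C K' (c * (8 * m)) (\<Union>w\<in>W. cf (red r M w))"
    if "derives J D K c W" "(\<Union>k\<in>K. cf (red r M k)) \<subseteq> K'" for K K' c W
    using derives_phi[OF I r0 M0 C1, of K c W K'] that rM by (simp add: J_def D_def)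
  have short_le: "short ((r - 1) * M) p" if "short m p" for p :: "'r poly"
  proof (rule short_mono[OF that])
    show "m \<le> (r - 1) * M" unfolding rM by simp
  qed

  define G H where "G = r * (r - 1) * r ^ s * Suc s" and "H = 2 * r * (r - 1) * r ^ s * Suc s"
  let ?a = "\<lambda>e. poly A (w ^ e)" and ?b = "\<lambda>e. poly B (w ^ e)"
  let ?U = "\<Union>e\<in>nondiv r s. cf (red r M (?a e))"
  have "derives J D (coeff A ` {..<n}) G (?a ` nondiv r s)"
    using dft_forward[OF J r2, of w s D "coeff A"] root D
    unfolding G_def n_def[symmetric] poly_eq_dft[OF A] principal_root_def by blast
  moreover have "(\<Union>x\<in>coeff A ` {..<n}. cf (red r M x)) \<subseteq> insert 0 (cf a)"
    by (simp only: UN_simps red_id[OF M0 r0 short_le[OF cA(1)]]) (intro UN_least cA(2))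
  ultimately have "derives I C (insert 0 (cf a)) (G * (8 * m)) (\<Union>x\<in>?a ` nondiv r s. cf (red r M x))"
    by (rule phi_der)
  then have "derives I C (insert 0 (cf a)) (G * (8 * m)) ?U" by simp
  then have D1: "derives I C (cf a) (G * (8 * m)) ?U"
    by (rule derives_mono_known[OF I]) (use eqm_refl[OF I] in auto)

  \<comment> \<open>The recursive products, one for each exponent in \<open>nondiv r s\<close>. They
    carry the factor \<open>r ^ E\<close> of the smaller size.\<close>
  define v where "v e = red r M (smult (of_nat (r ^ E)) (red r M (?a e) * red r M (?b e)))" for e
  have "derives I C ?U (n * T) (\<Union>e\<in>nondiv r s. cf (v e))"
  proof (rule derives_UN_card[OF I])
    show "card (nondiv r s) \<le> n" using card_nondiv_le[OF r0] by (simp add: n_def)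
    fix e assume e: "e \<in> nondiv r s"
    have "cf (w ^ j) \<subseteq> C" for j
      unfolding w_def monom_power by (intro cf_monom[OF C] const_ring_power[OF C] const_ring_1[OF C])
    then have "cf (?b e) \<subseteq> C"
      unfolding poly_eq_dft[OF B] dft_def by (intro cf_sum[OF C] cf_mult[OF C] cB)
    then have "cf (red r M (?b e)) \<subseteq> C" by (rule cf_red[OF C M0 r2])
    then have "derives I C (cf (red r M (?a e))) T (cf (v e))"
      using cost red_short[OF M0 r0] unfolding red_mult_cost_def v_def M_def by blast
    then show "derives I C ?U T (cf (v e))"
      by (rule derives_subset_known[OF I]) (use e in blast)
  qed simp
  with D1 have D2: "derives I C (cf a) (G * (8 * m) + n * T) (\<Union>e\<in>nondiv r s. cf (v e))"
    by (rule derives_trans[OF I])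

  \<comment> \<open>The product as a polynomial in y, reduced modulo \<open>phi r t\<close>. The
    values v are the transform of its multiple Q, reduced modulo \<open>phi r M\<close>.\<close>
  define P where "P = red r t (A * B)"
  define Q where "Q = smult [:of_nat (r ^ E):] P"
  have P: "short n P" using red_short[OF t0 r0] by (simp add: P_def n_def t_def)
  then have Q: "short n Q" by (simp add: Q_def short_smult)
  have val: "red r M (poly Q (w ^ e)) = v e" if e: "e \<in> nondiv r s" for e
  proof -
    have "eqm J (poly P (w ^ e)) (?a e * ?b e)"
      unfolding P_def poly_mult[symmetric] t_def
      by (rule eqm_poly_red[OF J root _ r0]) (use e in \<open>simp add: nondiv_def\<close>)
    moreover have "eqm J (?a e * ?b e) (red r M (?a e) * red r M (?b e))"
      unfolding J_def by (intro eqm_mult[OF ring_ideal_phi] eqm_red[OF M0 r0])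
    ultimately have "eqm J (poly P (w ^ e)) (red r M (?a e) * red r M (?b e))"
      by (rule eqm_trans[OF J])
    then have "eqm J (smult (of_nat (r ^ E)) (poly P (w ^ e)))
        (smult (of_nat (r ^ E)) (red r M (?a e) * red r M (?b e)))"
      unfolding J_def by (rule eqm_smult[OF M0 r0])
    then show ?thesis
      unfolding v_def J_def by (intro red_cong[OF M0 r0]) (simp add: Q_def)
  qed
  have inv: "derives J D ((\<lambda>e. poly Q (w ^ e)) ` nondiv r s) H ((\<lambda>l. of_nat (r ^ Suc s) * coeff Q l) ` {..<n})"
    using dft_inverse[OF J r2 root, of D "coeff Q"] D
    unfolding H_def n_def[symmetric] poly_eq_dft[OF Q] by blast
  define f where "f l = smult (of_nat (r ^ (E + Suc s))) (coeff P l)" for l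
  have f_eq: "of_nat (r ^ Suc s) * coeff Q l = f l" for l
    by (simp add: Q_def f_def power_add of_nat_poly mult_ac)
  \<comment> \<open>Coefficients of P have length at most \<open>2 * m = (r - 1) * M\<close>, so
    they are recovered exactly from their residues modulo \<open>phi r M\<close>.\<close>
  have cP: "short (2 * m) (coeff P l)" for l
  proof -
    have "coeff (A * B) j \<in> Collect (short (2 * m))" for j
      unfolding coeff_mult mem_Collect_eq
      using short_mult[OF cA(1) cB(1)] by (intro short_sum) (rule short_mono, auto)
    then have "coeff P l \<in> Collect (short (2 * m))"
      unfolding P_def by (intro coeff_red_closed[OF t0 r2]) (auto intro: short_diff)
    then show ?thesis by simp
  qed
  have f: "short (2 * m) (f l)" for l unfolding f_def by (rule short_smult[OF cP])
  have "derives I C (\<Union>e\<in>nondiv r s. cf (v e)) (H * (8 * m)) (\<Union>x\<in>f ` {..<n}. cf (red r M x))"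
    by (rule phi_der[OF inv[unfolded f_eq]]) (auto simp: val)
  then have D3: "derives I C (\<Union>e\<in>nondiv r s. cf (v e)) (H * (8 * m)) (\<Union>l\<in>{..<n}. cf (f l))"
    using red_id[OF M0 r0, of "f _", unfolded rM, OF f] by simp

  define F where "F = (\<Sum>l<n. f l * monom 1 (m * l))"
  let ?c = "of_nat (r ^ (E + Suc s)) :: 'r"
  let ?R = "red r (r ^ k) (smult ?c (a * b))"
  have "?R = red r (r ^ k) F"
  proof (rule red_cong[OF N0 r0])
    obtain Z where Z: "A * B - P = phi r t * Z"
      using eqm_red[OF t0 r0, of "A * B"] unfolding P_def eqm_def phi_ideal_def by (auto elim: dvdE)
    have "a = poly A (monom 1 m)" "b = poly B (monom 1 m)"
      using poly_slices[of m n a] poly_slices[of m n b] a b m0 by (simp_all add: A_def B_def mn)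
    then have "a * b - poly P (monom 1 m) = poly (A * B - P) (monom 1 m)"
      by simp
    also have "\<dots> = poly (phi r t) (monom 1 m) * poly Z (monom 1 m)" by (simp add: Z)
    \<comment> \<open>Because \<open>m * t = r ^ k\<close>, the substitution
      \<open>y = x ^ m\<close> carries the modulus in y to the modulus in x.\<close>
    also have "poly (phi r t) (monom 1 m) = (phi r (r ^ k) :: 'r poly)"
      by (simp add: phi_def poly_sum poly_monom monom_power mt[symmetric] t_def mult_ac)
    finally have "eqm (phi_ideal r (r ^ k)) (a * b) (poly P (monom 1 m))"
      by (simp add: eqm_def phi_ideal_def)
    then have "eqm (phi_ideal r (r ^ k)) (smult ?c (a * b)) (smult ?c (poly P (monom 1 m)))"
      by (rule eqm_smult[OF N0 r0])
    moreover have "poly P (monom 1 m) = (\<Sum>l<n. coeff P l * monom 1 (m * l))"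
      using poly_eq_dft[OF P, of "monom 1 m" 1] by (simp add: dft_def monom_power)
    then have "smult ?c (poly P (monom 1 m)) = F"
      by (simp only: F_def f_def smult_sum_right mult_smult_left)
    ultimately show "eqm (phi_ideal r (r ^ k)) (smult ?c (a * b)) F" by simp
  qed
  have Fs: "short (r * r ^ k) F"
    unfolding F_def
  proof (rule short_sum)
    fix l assume "l \<in> {..<n}"
    then have "m * Suc l \<le> m * n" by (intro mult_le_mono2) simp
    moreover have "m * 1 \<le> m * r ^ s" using r0 by (intro mult_le_mono2) simp
    then have "m \<le> r ^ k" by (simp only: mt mult_1_right)
    moreover have "r * r ^ k = (r - 1 + 1) * r ^ k" using r0 by simp
    then have "r * r ^ k = (r - 1) * r ^ k + r ^ k" by (simp only: distrib_right mult_1_left)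
    moreover have "m * Suc l = m * l + m" by simp
    ultimately have le: "m * l + 2 * m \<le> r * r ^ k" unfolding mn by linarith
    have "short (m * l + 2 * m) (f l * monom 1 (m * l))"
      using short_monom_mult[OF f[of l], where m = "m * l" and c = 1] by (simp add: mult.commute)
    then show "short (r * r ^ k) (f l * monom 1 (m * l))" using le by (rule short_mono)
  qed
  let ?d = "(r - 1) * r ^ k"
  let ?K = "\<Union>l\<in>{..<n}. cf (f l)"
  \<comment> \<open>Two overlapping pieces meet at a position of F, and \<open>coeff_red\<close>
    subtracts one further position: four terms.\<close>
  have "derives I C ?K (?d * 4) (coeff ?R ` {..<?d})"
  proof (rule derives_sums[OF I C1(1)])
    show "card (coeff ?R ` {..<?d}) \<le> ?d" using card_image_le[of "{..<?d}"] by simp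
    fix x assume "x \<in> coeff ?R ` {..<?d}"
    then obtain j where j: "j < ?d" "x = coeff ?R j" by auto
    obtain c1 c2 where c12: "c1 \<in> insert 0 ?K" "c2 \<in> insert 0 ?K" "coeff F j = c1 + c2"
      using coeff_overlap_add[where f = f and n = n and k = j, OF f m0, folded F_def] by (elim bexE) (rule that)
    obtain c3 c4 where c34: "c3 \<in> insert 0 ?K" "c4 \<in> insert 0 ?K"
        "coeff F (?d + j mod r ^ k) = c3 + c4"
      using coeff_overlap_add[where f = f and n = n and k = "?d + j mod r ^ k", OF f m0, folded F_def] by (elim bexE) (rule that)
    define X where "X = (\<lambda>q. [c1, c3, c2, c4] ! q)"
    have x: "x = (\<Sum>q\<in>{..<4::nat}. (-1) ^ q * X q)"
      unfolding j(2) \<open>?R = red r (r ^ k) F\<close>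
      using j(1) coeff_red[OF N0 r0 Fs, of j] c12(3) c34(3) by (simp add: X_def numeral_eq_Suc)
    have "X ` {..<4} \<subseteq> L" if "c1 \<in> L" "c2 \<in> L" "c3 \<in> L" "c4 \<in> L" for L
      unfolding X_def using that by (auto simp: less_Suc_eq numeral_eq_Suc)
    note X = this[OF c12(1,2) c34(1,2)]
    have S: "(\<lambda>n. (-1) ^ n) ` {..<4::nat} \<subseteq> C"
      using C1 by (auto simp: less_Suc_eq numeral_eq_Suc)
    show "\<exists>A c u. finite A \<and> card A \<le> 4 \<and> c ` A \<subseteq> C \<and> u ` A \<subseteq> insert 0 ?K \<and>
        eqm I x (\<Sum>i\<in>(A::nat set). c i * u i)"
      by (intro exI[of _ "{..<4}"] exI[of _ "\<lambda>n. (-1) ^ n"] exI[of _ X] conjI X S)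
        (simp_all add: x eqm_refl[OF I])
  qed simp
  then have "derives I C ?K (?d * 4) (cf ?R)"
    by (rule derives_cf[OF I red_short[OF N0 r0]])
  then have "derives I C (cf a) (G * (8 * m) + n * T + (H * (8 * m) + ?d * 4)) (cf ?R)"
    by (rule derives_trans[OF I D2 derives_trans[OF I D3]])
  \<comment> \<open>Each of the G + H transform steps costs
    \<open>4 * ((r - 1) * M) = 8 * m\<close>. As H is twice G, the factor is
    \<open>3 * 8 = 24\<close>.\<close>
  moreover have "G * (8 * m) + n * T + (H * (8 * m) + ?d * 4) = n * T + ?d * (24 * r * Suc s + 4)"
    unfolding G_def H_def mt[symmetric] by (simp add: algebra_simps)
  ultimately show "derives I C (cf a) ((r - 1) * r ^ s * T + ?d * (24 * r * Suc s + 4)) (cf ?R)"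
    by (simp only: n_def)
qed

text \<open>This amounts to \<open>(k + 2) ^ 2 <= 2 * k ^ 2\<close>. Of the gain 1 from halving the
  argument of the logarithm, one half survives the shift by 2.\<close>

lemma log_shift_le:
  assumes "k \<ge> 6"
  shows "2 * log 2 (real k + 2) \<le> 2 * log 2 (real k) + 1"
proof -
  have "log 2 ((real k + 2) ^ 2) \<le> log 2 (2 * real k ^ 2)"
  proof (rule log_mono)
    have k: "real k \<ge> 6" using assms by simp
    then have "6 * real k \<le> real k ^ 2"
      unfolding power2_eq_square by (intro mult_right_mono) auto
    moreover have "(real k + 2) ^ 2 = real k ^ 2 + 4 * real k + 4"
      by (simp add: power2_eq_square algebra_simps)
    ultimately show "(real k + 2) ^ 2 \<le> 2 * real k ^ 2" using k by linarith
  qed (use assms in auto)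
  then show ?thesis using assms by (simp add: log_mult log_nat_power)
qed

text \<open>Divided by the number of coefficients, the cost satisfies \<open>\<tau> k \<le> 2 \<tau> i + O(k)\<close> with
  \<open>i \<le> k / 2 + 1\<close>. The shift in \<open>k - 2\<close> absorbs the summand 1.\<close>

lemma red_mult_cost_bound:
  fixes I C :: "'r::comm_ring_1 set"
  assumes I: "ring_ideal I" and C: "const_ring C" and r: "r = 2 \<or> r = 3"
  shows "k \<ge> 3 \<Longrightarrow> \<exists>E T. red_mult_cost I C r k E T \<and>
    real T \<le> real ((r - 1) * r ^ k) * (500 * (real k - 2) * log 2 (real k))"
proof (induction k rule: less_induct)
  case (less k)
  show ?case
  proof (cases "k \<ge> 6")
    case False
    let ?d = "(r - 1) * r ^ k"
    have "k = 3 \<or> k = 4 \<or> k = 5" using less.prems False by auto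
    \<comment> \<open>The largest case is \<open>2 * 3 ^ 5 = 486\<close>, so the constant 500 admits
      the quadratic cost of the naive product.\<close>
    then have "?d \<le> 500" using r by auto
    then have "real ?d \<le> 500" by linarith
    also have "\<dots> \<le> 500 * ((real k - 2) * log 2 (real k))"
    proof -
      have "1 \<le> log 2 (real k)" using less.prems by (subst le_log_iff) auto
      then have "1 * 1 \<le> (real k - 2) * log 2 (real k)"
        using less.prems by (intro mult_mono) auto
      then show ?thesis by simp
    qed
    finally have "real ?d \<le> 500 * (real k - 2) * log 2 (real k)" by (simp only: mult.assoc)
    then have "real ?d * real ?d \<le> real ?d * (500 * (real k - 2) * log 2 (real k))"
      by (intro mult_left_mono) simp_all
    then have "real (?d * ?d) \<le> real ?d * (500 * (real k - 2) * log 2 (real k))"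
      by (simp only: of_nat_mult[of ?d ?d])
    moreover have "r \<ge> 2" using r by auto
    ultimately show ?thesis using red_mult_cost_naive[OF I C, of r k] by blast
  next
    case True
    \<comment> \<open>From \<open>(r - 1) * r ^ i = 2 * m\<close> follows
      \<open>m = 2 ^ (i - 1)\<close> or \<open>m = 3 ^ i\<close>. Then
      \<open>m * r ^ s = r ^ k\<close> makes \<open>i + s\<close> equal to k + 1 or k. The split is
      balanced, with \<open>s <= i\<close> for the sake of the root of unity.\<close>
    define s i where "s = (if r = 2 then (k + 1) div 2 else k div 2)"
      and "i = (if r = 2 then k + 1 - s else k - s)"
    define m where "m = (if r = 2 then 2 ^ (i - 1) else 3 ^ i :: nat)"
    have si: "s \<le> i" by (auto simp: s_def i_def)
    have i: "i \<ge> 3" "i < k" "2 * i \<le> k + 2" using True by (auto simp: s_def i_def)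
    have s: "Suc s \<le> k" using True by (auto simp: s_def)
    have m: "(r - 1) * r ^ i = 2 * m"
    proof -
      obtain i' where "i = Suc i'" using i(1) by (cases i) auto
      then show ?thesis using r by (elim disjE) (simp_all add: m_def)
    qed
    have mt: "m * r ^ s = r ^ k"
    proof (cases "r = 2")
      case True
      then have "i - 1 + s = k" using \<open>k \<ge> 6\<close> by (auto simp: i_def s_def)
      then show ?thesis using True by (simp add: m_def power_add[symmetric])
    next
      case False
      then have "i + s = k" by (auto simp: i_def s_def)
      then show ?thesis using False r by (simp add: m_def power_add[symmetric])
    qed
    obtain E T where ET: "red_mult_cost I C r i E T"
      "real T \<le> real ((r - 1) * r ^ i) * (500 * (real i - 2) * log 2 (real i))"
      using less.IH[OF i(2,1)] by blast
    let ?d = "(r - 1) * r ^ k"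
    let ?n = "(r - 1) * r ^ s"
    have "real (?n * T) \<le> real ?n * (real ((r - 1) * r ^ i) * (500 * (real i - 2) * log 2 (real i)))"
      unfolding of_nat_mult[of ?n T] by (intro mult_left_mono ET) simp
    also have "\<dots> = real ?d * (500 * (2 * (real i - 2)) * log 2 (real i))"
    proof -
      have "?n * ((r - 1) * r ^ i) = ?d * 2"
        unfolding m mt[symmetric] by (simp only: mult_ac)
      then have e: "real ?n * real ((r - 1) * r ^ i) = real ?d * 2"
        by (metis of_nat_mult of_nat_numeral)
      have gen: "x * (y * (500 * z * L)) = d * (500 * (2 * z) * L)" if "x * y = d * 2" for x y z L d :: real
      proof -
        have "x * (y * (500 * z * L)) = (x * y) * (500 * z * L)" by (simp only: mult.assoc)
        then show ?thesis unfolding that by (simp only: mult_ac)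
      qed
      show ?thesis by (rule gen[OF e])
    qed
    also have "\<dots> \<le> real ?d * (500 * (real k - 2) * (log 2 (real k + 2) - 1))"
    proof -
      have "log 2 (real i) \<le> log 2 ((real k + 2) / 2)"
        using i by (intro log_mono) auto
      then have "log 2 (real i) \<le> log 2 (real k + 2) - 1"
        by (simp add: log_divide)
      moreover have "0 \<le> log 2 (real i)" using i by simp
      moreover have "2 * (real i - 2) \<le> real k - 2" "0 \<le> 2 * (real i - 2)" using i by auto
      ultimately show ?thesis by (intro mult_left_mono mult_mono) auto
    qed
    finally have 1: "real (?n * T) \<le> real ?d * (500 * (real k - 2) * (log 2 (real k + 2) - 1))" .
    have "24 * r * Suc s + 4 \<le> 24 * 3 * k + 4 * k"
      using r s True by (intro add_mono mult_mono) auto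
    then have "real (24 * r * Suc s + 4) \<le> real (24 * 3 * k + 4 * k)" by (rule of_nat_mono)
    then have 2: "real (?d * (24 * r * Suc s + 4)) \<le> real ?d * (76 * real k)"
      unfolding of_nat_mult[of ?d "24 * r * Suc s + 4"] by (intro mult_left_mono) auto
    \<comment> \<open>The half left by \<open>log_shift_le\<close> is worth
      \<open>250 * (k - 2)\<close>, which pays for the transforms, \<open>76 * k\<close>.\<close>
    have 3: "500 * (real k - 2) * (log 2 (real k + 2) - 1) + 76 * real k
        \<le> 500 * (real k - 2) * log 2 (real k)"
    proof -
      have "(real k - 2) * (2 * log 2 (real k + 2)) \<le> (real k - 2) * (2 * log 2 (real k) + 1)"
        using log_shift_le[OF True] True by (intro mult_left_mono) auto
      moreover have "real k \<ge> 6" using True by simp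
      ultimately show ?thesis by (simp add: algebra_simps)
    qed
    have "real (?n * T + ?d * (24 * r * Suc s + 4)) = real (?n * T) + real (?d * (24 * r * Suc s + 4))"
      by (rule of_nat_add)
    also have "\<dots> \<le> real ?d * (500 * (real k - 2) * (log 2 (real k + 2) - 1)) + real ?d * (76 * real k)"
      by (rule add_mono[OF 1 2])
    also have "\<dots> = real ?d * (500 * (real k - 2) * (log 2 (real k + 2) - 1) + 76 * real k)"
      by (rule distrib_left[symmetric])
    also have "\<dots> \<le> real ?d * (500 * (real k - 2) * log 2 (real k))"
      by (rule mult_left_mono[OF 3]) simp
    finally show ?thesis using red_mult_cost_step[OF I C r si m mt ET(1)] by blast
  qed
qed

section \<open>Unreduced products with a fixed factor\<close>

definition mult_cost :: "'r::comm_ring_1 set \<Rightarrow> 'r set \<Rightarrow> nat \<Rightarrow> nat \<Rightarrow> bool" where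
  "mult_cost I C k T \<longleftrightarrow>
     (\<forall>a b. short (2 ^ k) a \<longrightarrow> short (2 ^ k) b \<longrightarrow> cf b \<subseteq> C \<longrightarrow> derives I C (cf a) T (cf (a * b)))"

lemma mult_costD:
  "mult_cost I C k T \<Longrightarrow> short (2 ^ k) a \<Longrightarrow> short (2 ^ k) b \<Longrightarrow> cf b \<subseteq> C \<Longrightarrow> derives I C (cf a) T (cf (a * b))"
  unfolding mult_cost_def by blast

lemma mult_cost_le: "mult_cost I C k T \<Longrightarrow> T \<le> T' \<Longrightarrow> mult_cost I C k T'"
  unfolding mult_cost_def by (blast intro: derives_le)

lemma cf_smult: "const_ring C \<Longrightarrow> c \<in> C \<Longrightarrow> cf p \<subseteq> C \<Longrightarrow> cf (smult c p) \<subseteq> C"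
  unfolding cf_subset_iff by (auto intro: const_ring_mult)

text \<open>The fixed factor can be multiplied by \<open>c\<close> in advance, so undoing the
  scaling by \<open>d\<close> takes no operation.\<close>

lemma mult_cost_scaled:
  fixes I C :: "'r::comm_ring_1 set"
  assumes I: "ring_ideal I" and C: "const_ring C" and c: "c \<in> C" "eqm I (d * c) 1"
    and der: "\<And>a b. short (2 ^ k) a \<Longrightarrow> short (2 ^ k) b \<Longrightarrow> cf b \<subseteq> C \<Longrightarrow>
      derives I C (cf a) T (cf (smult d (a * b)))"
  shows "mult_cost I C k T"
  unfolding mult_cost_def
proof (intro allI impI)
  fix a b :: "'r poly" assume a: "short (2 ^ k) a" and b: "short (2 ^ k) b" "cf b \<subseteq> C"
  have "derives I C (cf a) T (cf (smult d (a * smult c b)))"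
    by (intro der a short_smult b cf_smult[OF C] c)
  moreover have "\<exists>k\<in>insert 0 (cf a \<union> cf (smult d (a * smult c b))). eqm I x k" if x: "x \<in> cf (a * b)" for x
  proof -
    from x obtain i where i: "x = coeff (a * b) i" by (rule rangeE)
    have "eqm I ((d * c) * coeff (a * b) i) (1 * coeff (a * b) i)"
      by (intro eqm_mult[OF I] c(2) eqm_refl[OF I])
    moreover have "(d * c) * coeff (a * b) i = coeff (smult d (a * smult c b)) i"
      by (simp add: mult.assoc)
    ultimately have "eqm I x (coeff (smult d (a * smult c b)) i)"
      unfolding i mult_1 by (metis eqm_sym[OF I])
    then show ?thesis by (rule bexI) simp
  qed
  ultimately show "derives I C (cf a) T (cf (a * b))" by (rule derives_cong[OF I])
qed

text \<open>The condition \<open>3 <= q\<close> comes from the range of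
  \<open>red_mult_cost_bound\<close>. It makes 27 the best factor at k = 0.\<close>

lemma power_of_three_between: "\<exists>q\<ge>3. q \<le> k + 3 \<and> (2::nat) ^ k \<le> 3 ^ q \<and> (3::nat) ^ q \<le> 27 * 2 ^ k"
proof (induction k)
  case 0
  show ?case by (rule exI[of _ 3]) simp
next
  case (Suc k)
  then obtain q where q: "q \<ge> 3" "q \<le> k + 3" "(2::nat) ^ k \<le> 3 ^ q" "(3::nat) ^ q \<le> 27 * 2 ^ k" by blast
  show ?case
  proof (cases "(2::nat) ^ Suc k \<le> 3 ^ q")
    case True
    then show ?thesis using q by (intro exI[of _ q]) simp
  next
    case False
    then show ?thesis using q by (intro exI[of _ "Suc q"]) simp
  qed
qed

text \<open>The modulus is chosen so long that the product is its own remainder. The length is at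
  most 54 times \<open>2 ^ k\<close> in radix 3, and \<open>54 * 500 = 27000\<close>.\<close>

lemma mult_cost_any:
  fixes I C :: "'r::comm_ring_1 set"
  assumes I: "ring_ideal I" and C: "const_ring C" and r: "r = 2 \<or> r = 3"
    and v: "v \<in> C" "eqm I (of_nat r * v) 1"
  shows "\<exists>T. mult_cost I C k T \<and> real T \<le> 27000 * 2 ^ k * (real k + 1) * log 2 (real k + 3)"
proof -
  have "\<exists>q\<ge>3. q \<le> k + 3 \<and> 2 * 2 ^ k \<le> (r - 1) * r ^ q \<and> (r - 1) * r ^ q \<le> 54 * 2 ^ k"
    using r
  proof
    assume "r = 2" then show ?thesis by (intro exI[of _ "k + 3"]) (simp add: power_add)
  next
    assume "r = 3" then show ?thesis using power_of_three_between[of k] by auto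
  qed
  then obtain q where q: "q \<ge> 3" "q \<le> k + 3" "2 * 2 ^ k \<le> (r - 1) * r ^ q" "(r - 1) * r ^ q \<le> 54 * 2 ^ k"
    by blast
  obtain E T where ET: "red_mult_cost I C r q E T"
    "real T \<le> real ((r - 1) * r ^ q) * (500 * (real q - 2) * log 2 (real q))"
    using red_mult_cost_bound[OF I C r q(1)] by blast
  have r0: "r ^ q > 0" "r > 0" using r by auto
  have "mult_cost I C k T"
  proof (rule mult_cost_scaled[OF I C, of "v ^ E" "of_nat (r ^ E)"])
    show "v ^ E \<in> C" by (rule const_ring_power[OF C v(1)])
    show "eqm I (of_nat (r ^ E) * v ^ E) 1"
      using eqm_pow[OF I v(2), of E] by (simp add: power_mult_distrib)
    fix a b :: "'r poly" assume a: "short (2 ^ k) a" and b: "short (2 ^ k) b" and bC: "cf b \<subseteq> C"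
    have "short (2 ^ k + 2 ^ k - 1) (a * b)" by (rule short_mult[OF a b])
    then have ab: "short ((r - 1) * r ^ q) (a * b)" by (rule short_mono) (use q(3) in linarith)
    have "short ((r - 1) * r ^ q) a" "short ((r - 1) * r ^ q) b"
      by (rule short_mono[OF a], use q(3) in linarith) (rule short_mono[OF b], use q(3) in linarith)
    then have "derives I C (cf a) T (cf (red r (r ^ q) (smult (of_nat (r ^ E)) (a * b))))"
      using ET(1) bC unfolding red_mult_cost_def by blast
    then show "derives I C (cf a) T (cf (smult (of_nat (r ^ E)) (a * b)))"
      by (simp only: red_id[OF r0 short_smult[OF ab]])
  qed
  moreover have "real T \<le> 27000 * 2 ^ k * (real k + 1) * log 2 (real k + 3)"
  proof -
    have "real ((r - 1) * r ^ q) \<le> real (54 * 2 ^ k)" by (rule of_nat_mono[OF q(4)])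
    then have 1: "real ((r - 1) * r ^ q) \<le> 54 * 2 ^ k" by simp
    have 2: "500 * (real q - 2) * log 2 (real q) \<le> 500 * (real k + 1) * log 2 (real k + 3)"
      using q by (intro mult_mono log_mono) auto
    have "0 \<le> 500 * (real q - 2) * log 2 (real q)" using q by simp
    then have "real ((r - 1) * r ^ q) * (500 * (real q - 2) * log 2 (real q))
        \<le> (54 * 2 ^ k) * (500 * (real k + 1) * log 2 (real k + 3))"
      by (intro mult_mono 1 2) auto
    moreover have "(54 * 2 ^ k) * (500 * (real k + 1) * log 2 (real k + 3))
        = 27000 * 2 ^ k * (real k + 1) * log 2 (real k + 3)"
      by simp
    ultimately show ?thesis using ET(2) by linarith
  qed
  ultimately show ?thesis by blast
qed

text \<open>The product has length below \<open>2 ^ Suc k\<close> and is determined by its values at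
  the odd powers of w, the roots of \<open>y ^ (2 ^ Suc k) + 1\<close>. Hence w has to have four
  times the order of the length \<open>2 ^ k\<close> of the factors.\<close>

lemma mult_cost_fft:
  fixes I C :: "'r::comm_ring_1 set"
  assumes I: "ring_ideal I" and C: "const_ring C" and w: "w \<in> C" "eqm I (w ^ (2 ^ Suc k)) (-1)"
    and v: "v \<in> C" "eqm I (2 * v) 1"
  shows "mult_cost I C k (28 * 2 ^ k * Suc k)"
proof (rule mult_cost_scaled[OF I C])
  let ?s = "Suc k" and ?n = "2 ^ Suc k :: nat"
  show "v ^ Suc ?s \<in> C" by (rule const_ring_power[OF C v(1)])
  show "eqm I (of_nat (2 ^ Suc ?s) * v ^ Suc ?s) 1"
    using eqm_pow[OF I v(2), of "Suc ?s"] by (simp only: power_mult_distrib of_nat_power of_nat_numeral power_one)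
  fix a b :: "'r poly" assume a: "short (2 ^ k) a" and b: "short (2 ^ k) b" and bC: "cf b \<subseteq> C"
  have 1: "eqm I (w ^ (2 ^ Suc ?s)) 1"
    using eqm_pow[OF I w(2), of 2] by (simp add: power_mult[symmetric] mult.commute)
  have root: "principal_root I 2 ?s w"
    unfolding principal_root_def
  proof (intro conjI allI impI 1)
    fix j :: nat assume j: "\<not> 2 dvd j"
    have "eqm I (1 + (w ^ ?n) ^ j) (1 + (-1) ^ j)"
      by (intro eqm_add[OF I] eqm_refl[OF I] eqm_pow[OF I] w)
    then have "1 + (w ^ ?n) ^ j \<in> I" using j by (simp add: eqm_def)
    then show "(\<Sum>i<2. w ^ (2 ^ ?s * i * j)) \<in> I"
      by (simp add: numeral_2_eq_2 power_mult)
  qed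
  have wC: "w ^ e \<in> C \<and> - (w ^ e) \<in> C" for e
    using const_ring_power[OF C w(1)] const_ring_uminus[OF C] by blast
  have n: "(2 - 1) * 2 ^ ?s = ?n" by simp
  have sa: "short ?n a" "short ?n b" "short ?n (a * b)"
    by (auto intro: short_mono[OF a] short_mono[OF b] short_mono[OF short_mult[OF a b]])
  let ?V = "\<lambda>p. (\<lambda>e. poly p (w ^ e)) ` nondiv 2 ?s"
  have "derives I C (coeff a ` {..<?n}) (2 * (2 - 1) * 2 ^ ?s * Suc ?s) (dft w (coeff a) ?n ` nondiv 2 ?s)"
    by (rule dft_forward[OF I _ 1, of C "coeff a", unfolded n]) (simp_all only: wC order_refl)
  then have D1: "derives I C (cf a) (2 * (2 - 1) * 2 ^ ?s * Suc ?s) (?V a)"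
    unfolding poly_eq_dft[OF sa(1)] by (rule derives_subset_known[OF I]) blast
  have "derives I C (?V a) ?n ((\<lambda>e. poly b (w ^ e) * poly a (w ^ e)) ` nondiv 2 ?s)"
  proof (rule derives_scale[OF I const_ring_1[OF C] finite_nondiv])
    show "card (nondiv 2 ?s) \<le> ?n" using card_nondiv_le[of 2 ?s] by simp
    show "poly b (w ^ e) \<in> C" for e
      unfolding poly_eq_dft[OF sa(2)] dft_def using bC wC
      by (intro const_ring_sum[OF C] const_ring_mult[OF C]) auto
  qed
  then have D2: "derives I C (?V a) ?n (?V (a * b))" by (simp only: poly_mult mult.commute)
  have D3: "derives I C (?V (a * b)) (2 * 2 * (2 - 1) * 2 ^ ?s * Suc ?s) ((\<lambda>i. of_nat (2 ^ Suc ?s) * coeff (a * b) i) ` {..<?n})"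
    unfolding poly_eq_dft[OF sa(3)]
    by (rule dft_inverse[OF I _ root, of C "coeff (a * b)", unfolded n]) (simp_all only: wC order_refl)
  have "derives I C (cf a) (2 * (2 - 1) * 2 ^ ?s * Suc ?s + ?n + 2 * 2 * (2 - 1) * 2 ^ ?s * Suc ?s)
      ((\<lambda>i. of_nat (2 ^ Suc ?s) * coeff (a * b) i) ` {..<?n})"
    by (rule derives_trans[OF I derives_trans[OF I D1 D2] D3])
  moreover have "coeff (smult (of_nat (2 ^ Suc ?s)) (a * b)) = (\<lambda>i. of_nat (2 ^ Suc ?s) * coeff (a * b) i)"
    by (intro ext coeff_smult)
  ultimately have "derives I C (cf a) (2 * (2 - 1) * 2 ^ ?s * Suc ?s + ?n + 2 * 2 * (2 - 1) * 2 ^ ?s * Suc ?s)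
      (coeff (smult (of_nat (2 ^ Suc ?s)) (a * b)) ` {..<?n})"
    by (simp only:)
  from derives_cf[OF I short_smult[OF sa(3)] this]
  show "derives I C (cf a) (28 * 2 ^ k * Suc k) (cf (smult (of_nat (2 ^ Suc ?s)) (a * b)))"
    by (rule derives_le) simp
qed

text \<open>Four products of halves, and at most four terms for each of \<open>4 * 2 ^ k\<close>
  coefficients. The loss of a factor 2 per coefficient is acceptable since only boundedly many
  doublings are made.\<close>

lemma mult_cost_double:
  fixes I C :: "'r::comm_ring_1 set"
  assumes I: "ring_ideal I" and C: "const_ring C" and cost: "mult_cost I C k T"
  shows "mult_cost I C (Suc k) (4 * T + 16 * 2 ^ k)"
  unfolding mult_cost_def
proof (intro allI impI)
  fix a b :: "'r poly" assume a: "short (2 ^ Suc k) a" and b: "short (2 ^ Suc k) b" and bC: "cf b \<subseteq> C"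
  define h :: nat where "h = 2 ^ k"
  define half where "half p i = (if i then poly_shift h p else poly_cutoff h p)" for p :: "'r poly" and i
  have short_half: "short h (half p i)" if "short (2 ^ Suc k) p" for p i
    using that by (auto simp: half_def short_def coeff_poly_shift coeff_poly_cutoff h_def)
  have cf_half: "cf (half p i) \<subseteq> insert 0 (cf p)" for p i
    by (auto simp: half_def coeff_poly_shift coeff_poly_cutoff)
  have split: "p = (\<Sum>i\<in>UNIV. monom 1 (if i then h else 0) * half p i)" for p
    using poly_shift_cutoff[of p h] by (simp add: UNIV_bool half_def monom_0 one_pCons[symmetric])
  let ?S = "UNIV :: (bool \<times> bool) set"
  define P where "P = (\<lambda>(i, j). half a i * half b j)"
  define e where "e = (\<lambda>(i, j). (if i then h else 0) + (if j then h else (0::nat)))"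
  have ab: "a * b = (\<Sum>x\<in>?S. monom 1 (e x) * P x)"
  proof -
    have "a * b = (\<Sum>i\<in>UNIV. monom 1 (if i then h else 0) * half a i) * (\<Sum>j\<in>UNIV. monom 1 (if j then h else 0) * half b j)"
      using split[of a] split[of b] by simp
    also have "\<dots> = (\<Sum>i\<in>UNIV. \<Sum>j\<in>UNIV. monom 1 (e (i, j)) * P (i, j))"
      unfolding sum_product e_def P_def prod.case
    proof (intro sum.cong refl)
      have m: "monom 1 (x + y) = monom 1 x * (monom 1 y :: 'r poly)" for x y
        by (simp add: mult_monom)
      show "monom 1 (if i then h else 0) * half a i * (monom 1 (if j then h else 0) * half b j)
          = monom 1 ((if i then h else 0) + (if j then h else 0)) * (half a i * half b j)" for i j
        unfolding m by (simp only: mult_ac)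
    qed
    also have "\<dots> = (\<Sum>x\<in>?S. monom 1 (e x) * P x)"
      by (simp only: UNIV_Times_UNIV[symmetric] sum.cartesian_product')
    finally show ?thesis .
  qed
  let ?K = "\<Union>x\<in>?S. cf (P x)"
  have "derives I C (cf a) (4 * T) ?K"
  proof (rule derives_UN_card[OF I])
    show "card ?S \<le> 4" by (simp add: card_UNIV_bool flip: UNIV_Times_UNIV)
    fix x :: "bool \<times> bool"
    obtain i j where x: "x = (i, j)" by (cases x)
    have "insert 0 (cf b) \<subseteq> C" using bC const_ring_0[OF C] by simp
    then have "cf (half b j) \<subseteq> C" by (rule subset_trans[OF cf_half])
    then have "derives I C (cf (half a i)) T (cf (P x))"
      unfolding x P_def prod.case
      by (rule mult_costD[OF cost short_half[OF a, unfolded h_def] short_half[OF b, unfolded h_def]])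
    then show "derives I C (cf a) T (cf (P x))"
    proof (rule derives_mono_known[OF I])
      have "\<exists>k'\<in>insert 0 (cf a). eqm I k k'" if "k \<in> cf (half a i)" for k
        using eqm_refl[OF I] subsetD[OF cf_half that] by (rule bexI)
      then show "\<forall>k\<in>cf (half a i). \<exists>k'\<in>insert 0 (cf a). eqm I k k'" by (rule ballI)
    qed
  qed simp
  moreover have "derives I C ?K ((4 * h) * 4) (coeff (a * b) ` {..<4 * h})"
  proof (rule derives_sums[OF I const_ring_1[OF C]])
    show "card (coeff (a * b) ` {..<4 * h}) \<le> 4 * h" using card_image_le[of "{..<4 * h}"] by simp
    fix y assume "y \<in> coeff (a * b) ` {..<4 * h}"
    then obtain l where "y = coeff (a * b) l" by auto
    then have y: "y = (\<Sum>x\<in>?S. 1 * coeff (monom 1 (e x) * P x) l)" unfolding ab coeff_sum by simp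
    show "\<exists>A c u. finite A \<and> card A \<le> 4 \<and> c ` A \<subseteq> C \<and> u ` A \<subseteq> insert 0 ?K \<and>
        eqm I y (\<Sum>i\<in>(A::(bool \<times> bool) set). c i * u i)"
    proof (intro exI conjI)
      show "eqm I y (\<Sum>x\<in>?S. 1 * coeff (monom 1 (e x) * P x) l)" unfolding y by (rule eqm_refl[OF I])
      show "card ?S \<le> 4" by (simp add: card_UNIV_bool flip: UNIV_Times_UNIV)
      show "(\<lambda>x. 1) ` ?S \<subseteq> C" using const_ring_1[OF C] by auto
      show "(\<lambda>x. coeff (monom 1 (e x) * P x) l) ` ?S \<subseteq> insert 0 ?K"
        by (auto simp: coeff_monom_mult)
    qed simp
  qed simp
  ultimately have "derives I C (cf a) (4 * T + 4 * h * 4) (coeff (a * b) ` {..<4 * h})"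
    by (rule derives_trans[OF I])
  moreover have "short (4 * h) (a * b)"
    by (rule short_mono[OF short_mult[OF a b]]) (simp add: h_def)
  ultimately have "derives I C (cf a) (4 * T + 4 * h * 4) (cf (a * b))"
    using derives_cf[OF I] by blast
  then show "derives I C (cf a) (4 * T + 16 * 2 ^ k) (cf (a * b))"
    by (simp add: h_def)
qed

section \<open>Interpolation and evaluation\<close>

text \<open>The numerator of the sum of all \<open>z i / m i\<close> over the common denominator
  \<open>prod m A\<close>. For linear \<open>m i\<close> and suitable weights this is Lagrange's
  interpolation polynomial.\<close>

definition lagr :: "('i \<Rightarrow> 'r::comm_ring_1) \<Rightarrow> ('i \<Rightarrow> 'r poly) \<Rightarrow> 'i set \<Rightarrow> 'r poly" where
  "lagr z m A = (\<Sum>i\<in>A. smult (z i) (\<Prod>j\<in>A - {i}. m j))"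

text \<open>Addition of two fractions with the denominators \<open>prod m A\<close> and
  \<open>prod m B\<close>.\<close>

lemma lagr_Un:
  assumes "finite A" "finite B" "A \<inter> B = {}"
  shows "lagr z m (A \<union> B) = lagr z m A * prod m B + lagr z m B * prod m A"
proof -
  have *: "(\<Sum>i\<in>A. smult (z i) (\<Prod>j\<in>A \<union> B - {i}. m j)) = lagr z m A * prod m B"
    if "finite A" "finite B" "A \<inter> B = {}" for A B
    unfolding lagr_def sum_distrib_right
  proof (intro sum.cong refl)
    fix i assume "i \<in> A"
    then have "A \<union> B - {i} = (A - {i}) \<union> B" "(A - {i}) \<inter> B = {}" using that by auto
    then show "smult (z i) (\<Prod>j\<in>A \<union> B - {i}. m j) = smult (z i) (prod m (A - {i})) * prod m B"
      using that by (simp add: prod.union_disjoint)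
  qed
  have "lagr z m (A \<union> B) = (\<Sum>i\<in>A. smult (z i) (\<Prod>j\<in>A \<union> B - {i}. m j)) + (\<Sum>i\<in>B. smult (z i) (\<Prod>j\<in>B \<union> A - {i}. m j))"
    unfolding lagr_def using assms by (simp add: sum.union_disjoint Un_commute)
  then show ?thesis using assms by (simp add: * Int_commute)
qed

lemma short_prod: "(\<And>i. i \<in> A \<Longrightarrow> short 2 (m i)) \<Longrightarrow> short (card A + 1) (prod m A)"
proof (induction A rule: infinite_finite_induct)
  case (insert x F)
  then have "short (2 + (card F + 1) - 1) (m x * prod m F)" by (intro short_mult) auto
  then show ?case using insert by simp
qed (auto simp: short_def)

lemma short_lagr: "(\<And>i. i \<in> A \<Longrightarrow> short 2 (m i)) \<Longrightarrow> finite A \<Longrightarrow> short (card A) (lagr z m A)"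
  unfolding lagr_def
proof (intro short_sum short_smult)
  fix i assume *: "\<And>i. i \<in> A \<Longrightarrow> short 2 (m i)" "finite A" "i \<in> A"
  have "short (card (A - {i}) + 1) (prod m (A - {i}))" by (rule short_prod) (use * in auto)
  moreover have "card A > 0" using * by (auto simp: card_gt_0_iff)
  ultimately show "short (card A) (prod m (A - {i}))" using * by simp
qed

lemma cf_prod: "const_ring C \<Longrightarrow> (\<And>i. i \<in> A \<Longrightarrow> cf (m i) \<subseteq> C) \<Longrightarrow> cf (prod m A) \<subseteq> C"
proof (induction A rule: infinite_finite_induct)
  case (insert x F)
  then have "cf (m x * prod m F) \<subseteq> C" by (intro cf_mult) auto
  then show ?case using insert by simp
qed (auto simp: coeff_1 intro: const_ring_0 const_ring_1)

text \<open>The cost per coefficient, uniform in the length, so that every level of a product tree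
  costs the same.\<close>

definition mult_rate :: "'r::comm_ring_1 set \<Rightarrow> 'r set \<Rightarrow> nat \<Rightarrow> nat \<Rightarrow> bool" where
  "mult_rate I C k0 \<mu> \<longleftrightarrow> (\<forall>k\<le>k0. mult_cost I C k (\<mu> * 2 ^ k))"

text \<open>A product tree: the numerators of two halves are multiplied by the fixed denominators.\<close>

lemma derives_lagr:
  fixes I C :: "'r::comm_ring_1 set"
  assumes I: "ring_ideal I" and C: "const_ring C" and rate: "mult_rate I C k0 \<mu>"
    and m: "\<And>i. short 2 (m i)" "\<And>i. cf (m i) \<subseteq> C"
  shows "h \<le> k0 \<Longrightarrow> finite A \<Longrightarrow> card A \<le> 2 ^ h \<Longrightarrow>
    derives I C (z ` A) (h * 2 ^ h * (2 * \<mu> + 2)) (cf (lagr z m A))"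
proof (induction h arbitrary: A)
  case 0
  have "cf (lagr z m A) \<subseteq> insert 0 (z ` A)"
  proof (cases "A = {}")
    case True
    then show ?thesis by (simp add: lagr_def)
  next
    case False
    with 0 have "card A = 1" by (simp add: card_gt_0_iff Suc_le_eq le_antisym)
    then obtain x where "A = {x}" by (auto simp: card_1_singleton_iff)
    then show ?thesis by (auto simp: lagr_def coeff_pCons split: nat.splits)
  qed
  then show ?case by (intro derives.known ballI) (use eqm_refl[OF I] in blast)
next
  case (Suc h)
  obtain B where B: "B \<subseteq> A" "card B = min (card A) (2 ^ h)"
    using obtain_subset_with_card_n[of "min (card A) (2 ^ h)" A] by auto
  define D where "D = A - B"
  have fin: "finite B" "finite D" using B Suc.prems finite_subset by (auto simp: D_def)
  have A: "A = B \<union> D" "B \<inter> D = {}" using B by (auto simp: D_def)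
  have "card D = card A - card B" unfolding D_def using B fin by (intro card_Diff_subset) auto
  then have card: "card B \<le> 2 ^ h" "card D \<le> 2 ^ h" using B Suc.prems by auto
  let ?c = "\<lambda>h. h * 2 ^ h * (2 * \<mu> + 2)"
  have half: "derives I C (z ` A) (?c h + \<mu> * 2 ^ Suc h) (cf (lagr z m X * prod m Y))"
    if "X \<subseteq> A" "finite X" "finite Y" "card X \<le> 2 ^ h" "card Y \<le> 2 ^ h" for X Y
  proof -
    have "short (2 ^ Suc h) (lagr z m X)"
      by (rule short_mono[OF short_lagr[OF m(1) that(2)]]) (use that in simp)
    \<comment> \<open>The product of \<open>card Y\<close> linear factors has one coefficient more
      than the numerator. Therefore a product of length \<open>2 ^ Suc h\<close> is used, not
      \<open>2 ^ h\<close>.\<close>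
    moreover have "card Y + 1 \<le> 2 ^ h + 2 ^ h" using that by (intro add_mono) auto
    then have "short (2 ^ Suc h) (prod m Y)"
      by (intro short_mono[OF short_prod[OF m(1)]]) simp
    moreover have "cf (prod m Y) \<subseteq> C" by (rule cf_prod[OF C m(2)])
    ultimately have "derives I C (cf (lagr z m X)) (\<mu> * 2 ^ Suc h) (cf (lagr z m X * prod m Y))"
      by (rule mult_costD[OF rate[unfolded mult_rate_def, rule_format, OF Suc.prems(1)]])
    moreover have "derives I C (z ` X) (?c h) (cf (lagr z m X))"
      using Suc.IH that Suc.prems by simp
    then have "derives I C (z ` A) (?c h) (cf (lagr z m X))"
      by (rule derives_subset_known[OF I]) (use that in blast)
    ultimately show ?thesis using derives_trans[OF I] by blast
  qed
  let ?P = "lagr z m B * prod m D" and ?Q = "lagr z m D * prod m B"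
  have "derives I C (z ` A) ((?c h + \<mu> * 2 ^ Suc h) + (?c h + \<mu> * 2 ^ Suc h)) (cf ?P \<union> cf ?Q)"
    by (intro derives_Un[OF I] half) (use fin card A in auto)
  moreover have "derives I C (cf ?P \<union> cf ?Q) (2 ^ Suc h * 2) (coeff (lagr z m A) ` {..<2 ^ Suc h})"
  proof (rule derives_sums[OF I const_ring_1[OF C]])
    show "card (coeff (lagr z m A) ` {..<2 ^ Suc h}) \<le> 2 ^ Suc h"
      using card_image_le[of "{..<2 ^ Suc h}" "coeff (lagr z m A)"] by simp
    fix x assume "x \<in> coeff (lagr z m A) ` {..<2 ^ Suc h}"
    then obtain i where "x = coeff (lagr z m A) i" by auto
    then have x: "x = (\<Sum>t\<in>(UNIV::bool set). 1 * (if t then coeff ?P i else coeff ?Q i))"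
      using lagr_Un[OF fin A(2), of z m] A(1) by (simp add: UNIV_bool add.commute)
    show "\<exists>A c u. finite A \<and> card A \<le> 2 \<and> c ` A \<subseteq> C \<and> u ` A \<subseteq> insert 0 (cf ?P \<union> cf ?Q) \<and>
        eqm I x (\<Sum>i\<in>(A::bool set). c i * u i)"
    proof (intro exI conjI)
      show "eqm I x (\<Sum>t\<in>(UNIV::bool set). 1 * (if t then coeff ?P i else coeff ?Q i))"
        unfolding x by (rule eqm_refl[OF I])
    qed (use const_ring_1[OF C] in auto)
  qed simp
  ultimately have "derives I C (z ` A) ((?c h + \<mu> * 2 ^ Suc h) + (?c h + \<mu> * 2 ^ Suc h) + 2 ^ Suc h * 2)
      (coeff (lagr z m A) ` {..<2 ^ Suc h})"
    by (rule derives_trans[OF I])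
  moreover have "short (2 ^ Suc h) (lagr z m A)"
    by (rule short_mono[OF short_lagr[OF m(1) Suc.prems(2)] Suc.prems(3)])
  moreover have "(?c h + \<mu> * 2 ^ Suc h) + (?c h + \<mu> * 2 ^ Suc h) + 2 ^ Suc h * 2 = ?c (Suc h)"
    by (simp add: algebra_simps)
  ultimately show ?case using derives_cf[OF I] by metis
qed

text \<open>Triangular numbers take the place of the half squares in the usual form of Bluestein's
  identity, so no square root of g is required.\<close>

definition tri :: "nat \<Rightarrow> nat" where "tri n = (\<Sum>i<n. i)"

lemma tri_add: "tri (e + j) = tri e + tri j + e * j"
  by (induction j) (simp_all add: tri_def)

text \<open>Bluestein's trick: \<open>tri (e + j) = tri e + tri j + e j\<close> turns the evaluation at powers of g
  into a product with the fixed polynomial with coefficients \<open>g ^ tri i\<close>.\<close>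

lemma derives_eval_powers:
  fixes I C :: "'r::comm_ring_1 set"
  assumes I: "ring_ideal I" and C: "const_ring C" and cost: "mult_cost I C (Suc k) T"
    and g: "g \<in> C" "h \<in> C" "eqm I (g * h) 1" and p: "short (2 ^ k) p"
  shows "derives I C (cf p) (2 * 2 ^ k + T) ((\<lambda>e. poly p (g ^ e)) ` {..<2 ^ k})"
proof -
  define n :: nat where "n = 2 ^ k"
  have n: "n > 0" by (simp add: n_def)
  \<comment> \<open>The coefficients are reversed because the index \<open>e + j\<close> asks for a
    correlation. The powers of h, the inverse of g, cancel \<open>g ^ tri j\<close>.\<close>
  define q where "q = (\<Sum>i<n. monom (h ^ tri (n - 1 - i) * coeff p (n - 1 - i)) i)"
  \<comment> \<open>The index \<open>e + j\<close> goes up to \<open>2 * n - 2\<close>, whence the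
    length \<open>2 * n\<close> and the size \<open>Suc k\<close> of the multiplication.\<close>
  define B where "B = (\<Sum>i<2 * n. monom (g ^ tri i) i)"
  have cq: "coeff q i = (if i < n then h ^ tri (n - 1 - i) * coeff p (n - 1 - i) else 0)" for i
    by (simp add: q_def coeff_sum)
  have cB: "coeff B i = (if i < 2 * n then g ^ tri i else 0)" for i
    by (simp add: B_def coeff_sum)
  have gC: "g ^ i \<in> C" "h ^ i \<in> C" for i using g const_ring_power[OF C] by auto
  have q: "short (2 ^ Suc k) q" and B: "short (2 ^ Suc k) B" by (auto simp: short_def cq cB n_def)
  have BC: "cf B \<subseteq> C" using gC const_ring_0[OF C] by (auto simp: cB)
  have "derives I C ((\<lambda>i. coeff p (n - 1 - i)) ` {..<n}) n ((\<lambda>i. h ^ tri (n - 1 - i) * coeff p (n - 1 - i)) ` {..<n})"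
    by (rule derives_scale[OF I const_ring_1[OF C]]) (use gC in auto)
  then have "derives I C (cf p) n ((\<lambda>i. h ^ tri (n - 1 - i) * coeff p (n - 1 - i)) ` {..<n})"
    by (rule derives_subset_known[OF I]) blast
  moreover have "(\<lambda>i. h ^ tri (n - 1 - i) * coeff p (n - 1 - i)) ` {..<n} = coeff q ` {..<n}"
    by (intro image_cong refl) (simp add: cq)
  ultimately have D1: "derives I C (cf p) n (cf q)"
    by (intro derives_cf[OF I, of n]) (simp_all add: short_def cq)
  have D2: "derives I C (cf q) T (cf (q * B))"
    by (rule mult_costD[OF cost q B BC])
  have val: "eqm I (poly p (g ^ e)) (h ^ tri e * coeff (q * B) (n - 1 + e))" if e: "e < n" for e
  proof -
    have "coeff (q * B) (n - 1 + e) = (\<Sum>i<n. coeff q i * coeff B (n - 1 + e - i))"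
      unfolding coeff_mult by (rule sum.mono_neutral_right) (use n in \<open>auto simp: cq\<close>)
    also have "\<dots> = (\<Sum>j<n. coeff q (n - Suc j) * coeff B (n - 1 + e - (n - Suc j)))"
      by (rule sum.nat_diff_reindex[symmetric])
    also have "\<dots> = (\<Sum>j<n. h ^ tri j * coeff p j * g ^ tri (e + j))"
    proof (intro sum.cong refl)
      fix j assume "j \<in> {..<n}"
      then have "n - Suc j < n" "n - 1 - (n - Suc j) = j" "n - 1 + e - (n - Suc j) = e + j" "e + j < 2 * n"
        using n e by auto
      then show "coeff q (n - Suc j) * coeff B (n - 1 + e - (n - Suc j)) = h ^ tri j * coeff p j * g ^ tri (e + j)"
        by (simp add: cq cB)
    qed
    finally have "h ^ tri e * coeff (q * B) (n - 1 + e)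
        = (\<Sum>j<n. (g * h) ^ tri e * (g * h) ^ tri j * (coeff p j * g ^ (e * j)))"
      unfolding sum_distrib_left by (simp add: tri_add power_add power_mult_distrib mult_ac sum_distrib_left)
    moreover have "eqm I (\<Sum>j<n. (g * h) ^ tri e * (g * h) ^ tri j * (coeff p j * g ^ (e * j)))
        (\<Sum>j<n. 1 ^ tri e * 1 ^ tri j * (coeff p j * g ^ (e * j)))"
      by (intro eqm_sum[OF I] eqm_mult[OF I] eqm_pow[OF I] g(3) eqm_refl[OF I])
    moreover have "poly p (g ^ e) = (\<Sum>j<n. 1 ^ tri e * 1 ^ tri j * (coeff p j * g ^ (e * j)))"
      using poly_eq_dft[of n p g e] p by (simp add: dft_def n_def)
    ultimately have "eqm I (h ^ tri e * coeff (q * B) (n - 1 + e)) (poly p (g ^ e))" by simp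
    then show ?thesis by (rule eqm_sym[OF I])
  qed
  have "derives I C ((\<lambda>e. coeff (q * B) (n - 1 + e)) ` {..<n}) n ((\<lambda>e. h ^ tri e * coeff (q * B) (n - 1 + e)) ` {..<n})"
    by (rule derives_scale[OF I const_ring_1[OF C]]) (use gC in auto)
  then have "derives I C (cf (q * B)) n ((\<lambda>e. h ^ tri e * coeff (q * B) (n - 1 + e)) ` {..<n})"
    by (rule derives_subset_known[OF I]) blast
  then have D3: "derives I C (cf (q * B)) n ((\<lambda>e. poly p (g ^ e)) ` {..<n})"
    by (rule derives_cong[OF I]) (use val in blast)
  have "derives I C (cf p) (n + T + n) ((\<lambda>e. poly p (g ^ e)) ` {..<n})"
    by (rule derives_trans[OF I derives_trans[OF I D1 D2] D3])
  moreover have "n + T + n = 2 * 2 ^ k + T" by (simp add: n_def)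
  ultimately show ?thesis by (simp only: n_def)
qed

text \<open>Scaling by the weights u, product tree with the nodes x, evaluation at the powers of g,
  scaling by v. Everything but the values y is constant, so the map is linear with precomputed
  data.\<close>

lemma derives_interpolate_eval:
  fixes I C :: "'r::comm_ring_1 set"
  assumes I: "ring_ideal I" and C: "const_ring C" and rate: "mult_rate I C (Suc k) \<mu>"
    and g: "g \<in> C" "h \<in> C" "eqm I (g * h) 1" and A: "finite A" "card A \<le> 2 ^ k"
    and x: "\<And>i. x i \<in> C" and u: "\<And>i. u i \<in> C" and v: "\<And>e. v e \<in> C"
  shows "derives I C (y ` A) (2 ^ k * Suc k * (2 * \<mu> + 4))
    ((\<lambda>e. v e * (\<Sum>i\<in>A. u i * y i * (\<Prod>j\<in>A - {i}. g ^ e - x j))) ` {..<2 ^ k})"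
proof -
  define z where "z i = u i * y i" for i
  define m where "m j = [:- x j, 1:]" for j
  have m: "short 2 (m j)" "cf (m j) \<subseteq> C" for j
    using x const_ring_uminus[OF C] const_ring_0[OF C] const_ring_1[OF C]
    by (auto simp: m_def short_def coeff_pCons split: nat.splits)
  have "mult_rate I C k \<mu>" using rate by (simp add: mult_rate_def)
  have D1: "derives I C (y ` A) (2 ^ k) (z ` A)"
    unfolding z_def by (rule derives_scale[OF I const_ring_1[OF C] A u])
  have D2: "derives I C (z ` A) (k * 2 ^ k * (2 * \<mu> + 2)) (cf (lagr z m A))"
    by (rule derives_lagr[OF I C \<open>mult_rate I C k \<mu>\<close> m order_refl A])
  have "short (2 ^ k) (lagr z m A)" by (rule short_mono[OF short_lagr[OF m(1) A(1)] A(2)])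
  then have D3: "derives I C (cf (lagr z m A)) (2 * 2 ^ k + \<mu> * 2 ^ Suc k) ((\<lambda>e. poly (lagr z m A) (g ^ e)) ` {..<2 ^ k})"
    using rate by (intro derives_eval_powers[OF I C _ g]) (auto simp: mult_rate_def)
  have D4: "derives I C ((\<lambda>e. poly (lagr z m A) (g ^ e)) ` {..<2 ^ k}) (2 ^ k)
      ((\<lambda>e. v e * poly (lagr z m A) (g ^ e)) ` {..<2 ^ k})"
    by (rule derives_scale[OF I const_ring_1[OF C]]) (use v in auto)
  have "derives I C (y ` A) (2 ^ k + k * 2 ^ k * (2 * \<mu> + 2) + (2 * 2 ^ k + \<mu> * 2 ^ Suc k) + 2 ^ k)
      ((\<lambda>e. v e * poly (lagr z m A) (g ^ e)) ` {..<2 ^ k})"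
    by (rule derives_trans[OF I derives_trans[OF I derives_trans[OF I D1 D2] D3] D4])
  moreover have "poly (lagr z m A) t = (\<Sum>i\<in>A. u i * y i * (\<Prod>j\<in>A - {i}. t - x j))" for t
    by (simp add: lagr_def z_def m_def poly_sum poly_prod)
  moreover have "2 ^ k + k * 2 ^ k * (2 * \<mu> + 2) + (2 * 2 ^ k + \<mu> * 2 ^ Suc k) + 2 ^ k \<le> 2 ^ k * Suc k * (2 * \<mu> + 4)"
    by (simp add: algebra_simps)
  ultimately show ?thesis using derives_le by (simp only:)
qed

section \<open>Multiplication rates\<close>

lemma mult_cost_0:
  fixes I C :: "'r::comm_ring_1 set"
  assumes I: "ring_ideal I" and C: "const_ring C"
  shows "mult_cost I C 0 1"
  unfolding mult_cost_def
proof (intro allI impI)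
  fix a b :: "'r poly" assume a: "short (2 ^ 0) a" and b: "short (2 ^ 0) b" and bC: "cf b \<subseteq> C"
  have ab: "a * b = [:coeff b 0 * coeff a 0:]"
  proof -
    have "a = [:coeff a 0:]" "b = [:coeff b 0:]"
      using a b by (auto simp: poly_eq_iff short_def coeff_pCons split: nat.splits)
    then have "a * b = [:coeff a 0:] * [:coeff b 0:]" by simp
    then show ?thesis by (simp add: mult.commute)
  qed
  have "derives I C (coeff a ` {0}) 1 ((\<lambda>i. coeff b 0 * coeff a i) ` {0})"
    by (rule derives_scale[OF I const_ring_1[OF C]]) (use bC in auto)
  then have "derives I C (coeff a ` {0}) 1 (coeff (a * b) ` {..<1})"
    by (simp add: ab lessThan_Suc)
  then have "derives I C (cf a) 1 (coeff (a * b) ` {..<1})"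
    by (rule derives_subset_known[OF I]) blast
  then show "derives I C (cf a) 1 (cf (a * b))"
    by (rule derives_cf[OF I, rotated]) (simp add: ab short_def coeff_pCons split: nat.splits)
qed

text \<open>Per coefficient, a doubling replaces the cost t by \<open>2 * t + 8\<close>.\<close>

lemma mult_cost_double_iter:
  fixes I C :: "'r::comm_ring_1 set"
  assumes I: "ring_ideal I" and C: "const_ring C" and cost: "mult_cost I C k (t * 2 ^ k)"
  shows "mult_cost I C (k + d) ((2 ^ d * t + 8 * (2 ^ d - 1)) * 2 ^ (k + d))"
proof (induction d)
  case 0
  then show ?case using cost by simp
next
  case (Suc d)
  obtain p where p: "(2::nat) ^ d = Suc p" by (metis not0_implies_Suc power_not_zero zero_neq_numeral)
  have "4 * ((2 ^ d * t + 8 * (2 ^ d - 1)) * 2 ^ (k + d)) + 16 * 2 ^ (k + d)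
      = (2 ^ Suc d * t + 8 * (2 ^ Suc d - 1)) * 2 ^ (k + Suc d)"
    by (simp add: p algebra_simps)
  then show ?case using mult_cost_double[OF I C Suc] by simp
qed

text \<open>A root of unity of order \<open>2 ^ Suc n\<close> gives products of length \<open>2 ^ (n - 1)\<close> only; the interpolation
  needs \<open>2 ^ (n + 3)\<close>, which takes four doublings.\<close>

lemma mult_rate_fft:
  fixes I C :: "'r::comm_ring_1 set"
  assumes I: "ring_ideal I" and C: "const_ring C" and w: "w \<in> C" "eqm I (w ^ (2 ^ n)) (-1)"
    and v: "v \<in> C" "eqm I (2 * v) 1" and k0: "k0 \<le> n + 3"
  shows "mult_rate I C k0 (568 * Suc k0)"
  unfolding mult_rate_def
proof (intro allI impI)
  fix k assume k: "k \<le> k0"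
  have base: "mult_cost I C j ((28 * Suc j) * 2 ^ j)" if "j < n \<or> j = 0" for j
  proof (cases "j < n")
    case True
    have "(w ^ (2 ^ (n - Suc j))) ^ (2 ^ Suc j) = w ^ (2 ^ n)"
      using True unfolding power_mult[symmetric] power_add[symmetric] by simp
    then have "mult_cost I C j (28 * 2 ^ j * Suc j)"
      using mult_cost_fft[OF I C const_ring_power[OF C w(1)] _ v, of "2 ^ (n - Suc j)" j] w(2) by simp
    then show ?thesis by (simp only: mult_ac)
  next
    case False
    then show ?thesis using that mult_cost_le[OF mult_cost_0[OF I C]] by simp
  qed
  \<comment> \<open>Four doublings from length \<open>2 ^ (k - 4)\<close>, or fewer from length 1
    when k is small. In the bound, \<open>568 = 16 * 28 + 8 * 15\<close>.\<close>
  define j d where "j = k - 4" and "d = k - j"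
  have jd: "k = j + d" "d \<le> 4" "j < n \<or> j = 0" "j \<le> k0" using k k0 by (auto simp: j_def d_def)
  have "mult_cost I C k ((2 ^ d * (28 * Suc j) + 8 * (2 ^ d - 1)) * 2 ^ k)"
    using mult_cost_double_iter[OF I C base[OF jd(3)], of d] jd(1) by simp
  moreover have "(2 ^ d * (28 * Suc j) + 8 * (2 ^ d - 1)) * 2 ^ k \<le> (568 * Suc k0) * 2 ^ k"
  proof (rule mult_le_mono1)
    have d: "(2::nat) ^ d \<le> 2 ^ 4" using jd(2) by (rule power_increasing) simp
    have "2 ^ d * (28 * Suc j) \<le> 2 ^ 4 * (28 * Suc k0)" using d jd(4) by (intro mult_le_mono) auto
    moreover have "8 * ((2::nat) ^ d - 1) \<le> 120" using d by simp
    ultimately show "2 ^ d * (28 * Suc j) + 8 * (2 ^ d - 1) \<le> 568 * Suc k0" by simp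
  qed
  ultimately show "mult_cost I C k (568 * Suc k0 * 2 ^ k)" by (rule mult_cost_le)
qed

text \<open>The constant exceeds that of \<open>mult_cost_any\<close> by 1, which pays for rounding
  up to a natural number.\<close>

lemma mult_rate_any:
  fixes I C :: "'r::comm_ring_1 set"
  assumes "ring_ideal I" "const_ring C" "r = 2 \<or> r = 3" "v \<in> C" "eqm I (of_nat r * v) 1"
  shows "\<exists>\<mu>. mult_rate I C k0 \<mu> \<and> real \<mu> \<le> 27001 * (real k0 + 1) * log 2 (real k0 + 3)"
proof -
  define B where "B = 27000 * (real k0 + 1) * log 2 (real k0 + 3)"
  have l: "log 2 (real k0 + 3) \<ge> 1" by (subst le_log_iff) auto
  have B0: "B \<ge> 0" using l by (simp add: B_def)
  have "mult_cost I C k (nat \<lceil>B\<rceil> * 2 ^ k)" if k: "k \<le> k0" for k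
  proof -
    obtain T where T: "mult_cost I C k T" "real T \<le> 27000 * 2 ^ k * (real k + 1) * log 2 (real k + 3)"
      using mult_cost_any[OF assms] by blast
    have "27000 * (real k + 1) * log 2 (real k + 3) \<le> B"
      unfolding B_def using k by (intro mult_mono log_mono) auto
    then have "27000 * (real k + 1) * log 2 (real k + 3) \<le> real (nat \<lceil>B\<rceil>)" by linarith
    then have "(27000 * (real k + 1) * log 2 (real k + 3)) * 2 ^ k \<le> real (nat \<lceil>B\<rceil>) * 2 ^ k"
      by (intro mult_right_mono) auto
    moreover have "27000 * 2 ^ k * (real k + 1) * log 2 (real k + 3) = (27000 * (real k + 1) * log 2 (real k + 3)) * 2 ^ k"
      by (simp only: mult_ac)
    moreover have "real (nat \<lceil>B\<rceil> * 2 ^ k) = real (nat \<lceil>B\<rceil>) * 2 ^ k" by (simp only: of_nat_mult of_nat_power of_nat_numeral)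
    ultimately have "real T \<le> real (nat \<lceil>B\<rceil> * 2 ^ k)" using T(2) by linarith
    then have "T \<le> nat \<lceil>B\<rceil> * 2 ^ k" by (simp only: of_nat_le_iff)
    then show ?thesis by (rule mult_cost_le[OF T(1)])
  qed
  moreover have "real (nat \<lceil>B\<rceil>) \<le> 27001 * (real k0 + 1) * log 2 (real k0 + 3)"
  proof -
    have "1 * 1 \<le> (real k0 + 1) * log 2 (real k0 + 3)" using l by (intro mult_mono) auto
    moreover have "real (nat \<lceil>B\<rceil>) \<le> B + 1" using B0 by linarith
    moreover have "27001 * (real k0 + 1) * log 2 (real k0 + 3) = B + (real k0 + 1) * log 2 (real k0 + 3)"
      by (simp add: B_def algebra_simps)
    ultimately show ?thesis by linarith
  qed
  ultimately show ?thesis unfolding mult_rate_def by blast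
qed

section \<open>A commutative ring mapping onto all finite fields\<close>

text \<open>The field of the theorem is a record, whereas polynomials and the costs above live in a type
  of class \<open>comm_ring_1\<close>. Functions of the field and of the input tuple form one such type for all
  fields simultaneously; a congruence modulo the functions vanishing at F is an equality in F for
  all inputs. The integer component only serves to make 0 and 1 distinct.\<close>

typedef 'a fam = "{f :: int \<times> ('a ring \<Rightarrow> 'a list \<Rightarrow> 'a).
    (\<forall>R xs. cring R \<longrightarrow> snd f R xs \<in> carrier R) \<and> (\<forall>R xs. \<not> cring R \<longrightarrow> snd f R xs = undefined)}"
  by (rule exI[of _ "(0, \<lambda>R xs. if cring R then \<zero>\<^bsub>R\<^esub> else undefined)"])
    (auto intro: cring.cring_simprules)

setup_lifting type_definition_fam

instantiation fam :: (type) comm_ring_1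
begin

lift_definition zero_fam :: "'a fam" is "(0, \<lambda>R xs. if cring R then \<zero>\<^bsub>R\<^esub> else undefined)"
  by (auto intro: cring.cring_simprules)

lift_definition one_fam :: "'a fam" is "(1, \<lambda>R xs. if cring R then \<one>\<^bsub>R\<^esub> else undefined)"
  by (auto intro: cring.cring_simprules)

lift_definition plus_fam :: "'a fam \<Rightarrow> 'a fam \<Rightarrow> 'a fam" is
  "\<lambda>a b. (fst a + fst b, \<lambda>R xs. if cring R then snd a R xs \<oplus>\<^bsub>R\<^esub> snd b R xs else undefined)"
  by (auto intro!: cring.cring_simprules split: if_splits)

lift_definition uminus_fam :: "'a fam \<Rightarrow> 'a fam" is
  "\<lambda>a. (- fst a, \<lambda>R xs. if cring R then \<ominus>\<^bsub>R\<^esub> snd a R xs else undefined)"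
  by (auto intro!: cring.cring_simprules split: if_splits)

lift_definition times_fam :: "'a fam \<Rightarrow> 'a fam \<Rightarrow> 'a fam" is
  "\<lambda>a b. (fst a * fst b, \<lambda>R xs. if cring R then snd a R xs \<otimes>\<^bsub>R\<^esub> snd b R xs else undefined)"
  by (auto intro!: cring.cring_simprules split: if_splits)

definition minus_fam :: "'a fam \<Rightarrow> 'a fam \<Rightarrow> 'a fam" where
  "minus_fam a b = a + - b"

instance
proof
  fix a b c :: "'a fam"
  show "a + b + c = a + (b + c)"
    by transfer (auto simp: fun_eq_iff cring.cring_simprules split: if_splits)
  show "a + b = b + a"
    by transfer (auto simp: fun_eq_iff cring.cring_simprules split: if_splits)
  show "0 + a = a"
    by transfer (auto simp: fun_eq_iff prod_eq_iff cring.cring_simprules split: if_splits)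
  show "- a + a = 0"
    by transfer (auto simp: fun_eq_iff cring.cring_simprules split: if_splits)
  show "a - b = a + - b" by (simp add: minus_fam_def)
  show "a * b * c = a * (b * c)"
    by transfer (auto simp: fun_eq_iff cring.cring_simprules split: if_splits)
  show "a * b = b * a"
    by transfer (auto simp: fun_eq_iff cring.cring_simprules split: if_splits)
  show "1 * a = a"
    by transfer (auto simp: fun_eq_iff prod_eq_iff cring.cring_simprules split: if_splits)
  show "(a + b) * c = a * c + b * c"
    by transfer (auto simp: fun_eq_iff cring.cring_simprules algebra_simps split: if_splits)
  show "0 \<noteq> (1 :: 'a fam)" by transfer simp
qed

end

lift_definition ev :: "'a ring \<Rightarrow> 'a list \<Rightarrow> 'a fam \<Rightarrow> 'a" is "\<lambda>R xs f. snd f R xs" .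

text \<open>An element of the common ring needs a value at every ring; away from F it is zero, and
  only the value at F will matter.\<close>

lift_definition fconst :: "'a ring \<Rightarrow> 'a \<Rightarrow> 'a fam" is
  "\<lambda>F c. (0, \<lambda>R xs. if cring R then if R = F \<and> c \<in> carrier R then c else \<zero>\<^bsub>R\<^esub> else undefined)"
  by (auto intro: cring.cring_simprules)

lift_definition freg :: "nat \<Rightarrow> 'a fam" is
  "\<lambda>i. (0, \<lambda>R xs. if cring R then if i < length xs \<and> xs ! i \<in> carrier R then xs ! i else \<zero>\<^bsub>R\<^esub> else undefined)"
  by (auto intro: cring.cring_simprules)

lemma field_inv_closed: "field R \<Longrightarrow> x \<in> carrier R \<Longrightarrow> x \<noteq> \<zero>\<^bsub>R\<^esub> \<Longrightarrow> inv\<^bsub>R\<^esub> x \<in> carrier R"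
proof -
  assume "field R" "x \<in> carrier R" "x \<noteq> \<zero>\<^bsub>R\<^esub>"
  interpret field R by fact
  show ?thesis using \<open>x \<in> carrier R\<close> \<open>x \<noteq> \<zero>\<^bsub>R\<^esub>\<close> by (intro Units_inv_closed) (simp add: field_Units)
qed

lift_definition finv :: "'a fam \<Rightarrow> 'a fam" is
  "\<lambda>a. (0, \<lambda>R xs. if cring R then if field R \<and> snd a R xs \<noteq> \<zero>\<^bsub>R\<^esub> then inv\<^bsub>R\<^esub> (snd a R xs) else \<zero>\<^bsub>R\<^esub> else undefined)"
  by (auto intro: cring.cring_simprules field_inv_closed)

lemma ev_simps:
  assumes "cring F"
  shows ev_closed: "ev F xs a \<in> carrier F"
    and ev_0: "ev F xs 0 = \<zero>\<^bsub>F\<^esub>" and ev_1: "ev F xs 1 = \<one>\<^bsub>F\<^esub>"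
    and ev_add: "ev F xs (a + b) = ev F xs a \<oplus>\<^bsub>F\<^esub> ev F xs b"
    and ev_mult: "ev F xs (a * b) = ev F xs a \<otimes>\<^bsub>F\<^esub> ev F xs b"
    and ev_uminus: "ev F xs (- a) = \<ominus>\<^bsub>F\<^esub> ev F xs a"
    and ev_const: "c \<in> carrier F \<Longrightarrow> ev F xs (fconst F c) = c"
    and ev_reg: "i < length xs \<Longrightarrow> xs ! i \<in> carrier F \<Longrightarrow> ev F xs (freg i) = xs ! i"
  using assms by (transfer; force split: if_splits)+

lemma ev_finv:
  assumes "field F"
  shows "ev F xs (finv a) = (if ev F xs a = \<zero>\<^bsub>F\<^esub> then \<zero>\<^bsub>F\<^esub> else inv\<^bsub>F\<^esub> (ev F xs a))"
proof -
  interpret field F by fact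
  have "cring F" by (rule is_cring)
  then show ?thesis using assms by transfer simp
qed

section \<open>Congruence at one field, and the passage to straight-line programs\<close>

definition ker :: "'a ring \<Rightarrow> 'a fam set" where
  "ker F = {a. \<forall>xs. ev F xs a = \<zero>\<^bsub>F\<^esub>}"

definition consts_of :: "'a ring \<Rightarrow> 'a fam set" where
  "consts_of F = {a. \<exists>c. \<forall>xs. ev F xs a = c}"

context
  fixes F :: "'a ring"
  assumes F: "field F"
begin

interpretation field F by (rule F)

lemmas cringF = is_cring

lemma ev_diff: "ev F xs (a - b) = ev F xs a \<ominus>\<^bsub>F\<^esub> ev F xs b"
  using ev_add[OF cringF, of xs a "- b"] by (simp add: ev_uminus[OF cringF] a_minus_def)

lemma ring_ideal_ker: "ring_ideal (ker F)"
  by (auto simp: ring_ideal_def ker_def ev_0[OF cringF] ev_add[OF cringF] ev_mult[OF cringF] ev_closed[OF cringF])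

lemma const_ring_consts: "const_ring (consts_of F)"
  by (auto simp: const_ring_def consts_of_def ev_1[OF cringF] ev_diff ev_mult[OF cringF])

lemma eqm_ker: "eqm (ker F) a b \<longleftrightarrow> (\<forall>xs. ev F xs a = ev F xs b)"
  by (simp add: eqm_def ker_def ev_diff ev_closed[OF cringF] r_right_minus_eq)

lemma fconst_consts: "fconst F c \<in> consts_of F"
  unfolding consts_of_def mem_Collect_eq using cringF
  by (intro exI[of _ "if c \<in> carrier F then c else \<zero>\<^bsub>F\<^esub>"], transfer) auto

lemma finv_consts: "a \<in> consts_of F \<Longrightarrow> finv a \<in> consts_of F"
proof -
  assume "a \<in> consts_of F"
  then obtain c where c: "\<forall>xs. ev F xs a = c" by (auto simp: consts_of_def)
  show ?thesis
    unfolding consts_of_def mem_Collect_eq ev_finv[OF F] by (intro exI[of _ "if c = \<zero>\<^bsub>F\<^esub> then \<zero>\<^bsub>F\<^esub> else inv\<^bsub>F\<^esub> c"]) (simp add: c)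
qed

lemma finv_right: "\<forall>xs. ev F xs a \<noteq> \<zero>\<^bsub>F\<^esub> \<Longrightarrow> eqm (ker F) (a * finv a) 1"
  using ev_closed[OF cringF]
  by (simp add: eqm_ker ev_mult[OF cringF] ev_1[OF cringF] ev_finv[OF F] field_Units)

lemma ev_power: "ev F xs (a ^ n) = ev F xs a [^]\<^bsub>F\<^esub> n"
  by (induction n) (simp_all add: ev_1[OF cringF] ev_mult[OF cringF] m_comm ev_closed[OF cringF])

lemma ev_sum: "finite A \<Longrightarrow> ev F xs (sum f A) = (\<Oplus>\<^bsub>F\<^esub>i\<in>A. ev F xs (f i))"
  by (induction A rule: finite_induct)
    (simp_all add: ev_0[OF cringF] ev_add[OF cringF] ev_closed[OF cringF] Pi_def)

lemma ev_prod_nonzero: "finite A \<Longrightarrow> (\<And>i. i \<in> A \<Longrightarrow> ev F xs (f i) \<noteq> \<zero>\<^bsub>F\<^esub>) \<Longrightarrow> ev F xs (prod f A) \<noteq> \<zero>\<^bsub>F\<^esub>"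
  by (induction A rule: finite_induct)
    (simp_all add: ev_1[OF cringF] ev_mult[OF cringF] ev_closed[OF cringF] integral_iff)

lemma ev_diff_nonzero: "ev F xs a \<noteq> ev F xs b \<Longrightarrow> ev F xs (a - b) \<noteq> \<zero>\<^bsub>F\<^esub>"
  by (simp add: ev_diff ev_closed[OF cringF] r_right_minus_eq)

text \<open>A step becomes two multiplications and one addition, whence the factor 3. One program
  has to serve all inputs, so the memory is a function of the input while the operands are chosen
  before it. The inputs stay in the first n registers, where factors of the form
  \<open>freg i\<close> are read.\<close>

lemma derives_exec:
  assumes Cx: "Cx \<subseteq> consts_of F \<union> freg ` {..<n}"
  shows "derives (ker F) Cx K c W \<Longrightarrow> n \<le> N \<Longrightarrow>
    (\<And>xs. xs \<in> tuples F n \<Longrightarrow> length (mem xs) = N \<and> (\<forall>i<n. mem xs ! i = xs ! i)) \<Longrightarrow>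
    (\<And>k. k \<in> K \<Longrightarrow> \<exists>i<N. \<forall>xs\<in>tuples F n. mem xs ! i = ev F xs k) \<Longrightarrow>
    \<exists>p mem'. length p \<le> 3 * c \<and> (\<forall>xs\<in>tuples F n. exec F p (mem xs) = Some (mem' xs)) \<and>
      (\<forall>w\<in>W. \<exists>x. \<forall>xs\<in>tuples F n. operand_val F (mem' xs) x = Some (ev F xs w))"
proof (induction arbitrary: mem N rule: derives.induct)
  case (known W K c)
  have "\<exists>x. \<forall>xs\<in>tuples F n. operand_val F (mem xs) x = Some (ev F xs w)" if w: "w \<in> W" for w
  proof -
    obtain k where k: "k \<in> insert 0 K" "eqm (ker F) w k" using known(1) w by blast
    show ?thesis
    proof (cases "k = 0")
      case True
      then show ?thesis using k(2)
        by (intro exI[of _ "Const \<zero>\<^bsub>F\<^esub>"]) (simp add: eqm_ker ev_0[OF cringF])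
    next
      case False
      then obtain i where "i < N" "\<forall>xs\<in>tuples F n. mem xs ! i = ev F xs k"
        using k(1) known(4)[of k] by auto
      then show ?thesis using k(2) known(3)
        by (intro exI[of _ "Reg i"]) (simp add: eqm_ker)
    qed
  qed
  then show ?case by (intro exI[of _ "[]"] exI[of _ mem]) auto
next
  case (step u K v a b c W)
  \<comment> \<open>The appended list l matters since the second multiplication runs after the first
    result has been stored.\<close>
  have data: "\<exists>x. \<forall>xs\<in>tuples F n. \<forall>l. operand_val F (mem xs @ l) x = Some (ev F xs u)" if u: "u \<in> insert 0 K" for u
  proof (cases "u = 0")
    case True
    then show ?thesis by (intro exI[of _ "Const \<zero>\<^bsub>F\<^esub>"]) (simp add: ev_0[OF cringF])
  next
    case False
    then obtain i where "i < N" "\<forall>xs\<in>tuples F n. mem xs ! i = ev F xs u"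
      using u step.prems(3)[of u] by auto
    then show ?thesis using step.prems(2)
      by (intro exI[of _ "Reg i"]) (simp add: nth_append)
  qed
  have coef: "\<exists>x. \<forall>xs\<in>tuples F n. \<forall>l. operand_val F (mem xs @ l) x = Some (ev F xs a)" if a: "a \<in> Cx" for a
  proof (cases "a \<in> consts_of F")
    case True
    then obtain c where "\<forall>xs. ev F xs a = c" unfolding consts_of_def by blast
    then show ?thesis
      using ev_closed[OF cringF, of "[]" a] by (intro exI[of _ "Const c"]) simp
  next
    case False
    then obtain i where i: "i < n" "a = freg i" using a Cx by auto
    have "mem xs ! i = ev F xs a \<and> i < length (mem xs)" if xs: "xs \<in> tuples F n" for xs
    proof -
      have "length xs = n" "xs ! i \<in> carrier F" using xs i(1) by (auto simp: tuples_def)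
      then show ?thesis using step.prems(1) step.prems(2)[of xs] xs i ev_reg[OF cringF, of i xs] by auto
    qed
    then show ?thesis by (intro exI[of _ "Reg i"]) (simp add: nth_append trans_less_add1)
  qed
  obtain xu where xu: "\<forall>xs\<in>tuples F n. \<forall>l. operand_val F (mem xs @ l) xu = Some (ev F xs u)" using data[OF step.hyps(1)] ..
  obtain xv where xv: "\<forall>xs\<in>tuples F n. \<forall>l. operand_val F (mem xs @ l) xv = Some (ev F xs v)" using data[OF step.hyps(2)] ..
  obtain xa where xa: "\<forall>xs\<in>tuples F n. \<forall>l. operand_val F (mem xs @ l) xa = Some (ev F xs a)" using coef[OF step.hyps(3)] ..
  obtain xb where xb: "\<forall>xs\<in>tuples F n. \<forall>l. operand_val F (mem xs @ l) xb = Some (ev F xs b)" using coef[OF step.hyps(4)] ..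
  define mem2 where "mem2 xs = mem xs @ [ev F xs (a * u), ev F xs (b * v), ev F xs (a * u + b * v)]" for xs
  have "\<exists>p mem'. length p \<le> 3 * c \<and> (\<forall>xs\<in>tuples F n. exec F p (mem2 xs) = Some (mem' xs)) \<and>
      (\<forall>w\<in>W. \<exists>x. \<forall>xs\<in>tuples F n. operand_val F (mem' xs) x = Some (ev F xs w))"
  proof (rule step.IH[of "N + 3" mem2])
    show "n \<le> N + 3" using step.prems(1) by simp
    show "length (mem2 xs) = N + 3 \<and> (\<forall>i<n. mem2 xs ! i = xs ! i)" if "xs \<in> tuples F n" for xs
      using step.prems(1) step.prems(2)[OF that] by (simp add: mem2_def nth_append)
    fix k assume k: "k \<in> insert (a * u + b * v) K"
    show "\<exists>i<N + 3. \<forall>xs\<in>tuples F n. mem2 xs ! i = ev F xs k"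
    proof (cases "k = a * u + b * v")
      case True
      then show ?thesis using step.prems(2)
        by (intro exI[of _ "N + 2"]) (simp add: mem2_def nth_append)
    next
      case False
      then obtain i where "i < N" "\<forall>xs\<in>tuples F n. mem xs ! i = ev F xs k"
        using k step.prems(3)[of k] by auto
      then show ?thesis using step.prems(2)
        by (intro exI[of _ i]) (simp add: mem2_def nth_append)
    qed
  qed
  then obtain p mem' where p: "length p \<le> 3 * c" "\<forall>xs\<in>tuples F n. exec F p (mem2 xs) = Some (mem' xs)"
      "\<forall>w\<in>W. \<exists>x. \<forall>xs\<in>tuples F n. operand_val F (mem' xs) x = Some (ev F xs w)"
    by (elim exE conjE)
  let ?p = "Instr Times xa xu # Instr Times xb xv # Instr Plus (Reg N) (Reg (N + 1)) # p"
  have "exec F ?p (mem xs) = Some (mem' xs)" if xs: "xs \<in> tuples F n" for xs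
  proof -
    have 1: "operand_val F (mem xs) xa = Some (ev F xs a)" "operand_val F (mem xs) xu = Some (ev F xs u)"
      using xa[rule_format, OF xs, of "[]"] xu[rule_format, OF xs, of "[]"] by simp_all
    have "length (mem xs) = N" using step.prems(2)[OF xs] by simp
    then show ?thesis
      using 1 xb[rule_format, OF xs] xv[rule_format, OF xs] p(2) xs
      by (simp add: ev_mult[OF cringF, symmetric] ev_add[OF cringF, symmetric] nth_append mem2_def)
  qed
  then show ?case using p(1,3) by (intro exI[of _ ?p] exI[of _ mem']) simp
qed

lemma those_map_Some: "(\<And>x. x \<in> set l \<Longrightarrow> f x = Some (g x)) \<Longrightarrow> those (map f l) = Some (map g l)"
  by (induction l) auto

lemma arith_complexity_le:
  assumes Cx: "Cx \<subseteq> consts_of F \<union> freg ` {..<n}"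
    and der: "derives (ker F) Cx (freg ` {..<n}) c (set ws)"
    and io: "\<And>x. x \<in> X \<Longrightarrow> inp x \<in> tuples F n \<and> out x = map (ev F (inp x)) ws"
  shows "arith_complexity F X inp out \<le> ereal (real (3 * c))"
proof -
  have regs: "\<exists>i<n. \<forall>xs\<in>tuples F n. xs ! i = ev F xs k" if k: "k \<in> freg ` {..<n}" for k
  proof -
    obtain i where i: "i < n" "k = freg i" using k by auto
    show ?thesis
    proof (intro exI[of _ i] conjI ballI i(1))
      fix xs assume "xs \<in> tuples F n"
      then have "i < length xs" "xs ! i \<in> carrier F" using i(1) by (auto simp: tuples_def)
      then show "xs ! i = ev F xs k" unfolding i(2) by (rule ev_reg[OF cringF, symmetric])
    qed
  qed
  have "\<exists>p mem'. length p \<le> 3 * c \<and> (\<forall>xs\<in>tuples F n. exec F p xs = Some (mem' xs)) \<and>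
      (\<forall>w\<in>set ws. \<exists>x. \<forall>xs\<in>tuples F n. operand_val F (mem' xs) x = Some (ev F xs w))"
    by (rule derives_exec[OF Cx der order_refl, of "\<lambda>xs. xs"]) (use regs in \<open>auto simp: tuples_def\<close>)
  then obtain p mem' where p: "length p \<le> 3 * c" "\<forall>xs\<in>tuples F n. exec F p xs = Some (mem' xs)"
      "\<forall>w\<in>set ws. \<exists>x. \<forall>xs\<in>tuples F n. operand_val F (mem' xs) x = Some (ev F xs w)"
    by (elim exE conjE)
  obtain x where x: "\<forall>w\<in>set ws. \<forall>xs\<in>tuples F n. operand_val F (mem' xs) (x w) = Some (ev F xs w)"
    using bchoice[OF p(3)] ..
  have "run_slp F p (map x ws) (inp t) = Some (out t)" if t: "t \<in> X" for t
  proof -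
    have "inp t \<in> tuples F n" "out t = map (ev F (inp t)) ws" using io[OF t] by auto
    moreover from this x have "those (map (\<lambda>w. operand_val F (mem' (inp t)) (x w)) ws) = Some (map (ev F (inp t)) ws)"
      by (intro those_map_Some) blast
    ultimately show ?thesis using p(2) by (simp add: run_slp_def comp_def)
  qed
  then have "arith_complexity F X inp out \<le> ereal (real (length p))"
    unfolding arith_complexity_def by (intro INF_lower) blast
  also have "\<dots> \<le> ereal (real (3 * c))" using p(1) by simp
  finally show ?thesis .
qed

end

section \<open>Interpolation over a finite field\<close>

text \<open>In characteristic 2 the number 3 equals 1; in all others 2 is invertible.\<close>

lemma small_radix_invertible:
  assumes F: "field F"
  shows "\<exists>r v. (r = 2 \<or> r = 3) \<and> v \<in> consts_of F \<and> eqm (ker F) (of_nat r * v) 1"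
proof -
  interpret field F by fact
  have ev2: "ev F xs (of_nat 2) = \<one>\<^bsub>F\<^esub> \<oplus>\<^bsub>F\<^esub> \<one>\<^bsub>F\<^esub>" for xs
    using ev_add[OF is_cring, of xs 1 1] by (simp add: ev_1[OF is_cring])
  have ev3: "ev F xs (of_nat 3) = (\<one>\<^bsub>F\<^esub> \<oplus>\<^bsub>F\<^esub> \<one>\<^bsub>F\<^esub>) \<oplus>\<^bsub>F\<^esub> \<one>\<^bsub>F\<^esub>" for xs
    using ev_add[OF is_cring, of xs "of_nat 2" 1] ev2[of xs] by (simp add: ev_1[OF is_cring])
  have C: "finv (of_nat r) \<in> consts_of F" for r
    by (intro finv_consts[OF F] const_ring_of_nat const_ring_consts F)
  show ?thesis
  proof (cases "\<one>\<^bsub>F\<^esub> \<oplus>\<^bsub>F\<^esub> \<one>\<^bsub>F\<^esub> = \<zero>\<^bsub>F\<^esub>")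
    case False
    then have "eqm (ker F) (of_nat 2 * finv (of_nat 2)) 1"
      by (intro finv_right[OF F] allI) (simp only: ev2 not_False_eq_True)
    then show ?thesis using C by blast
  next
    case True
    then have "eqm (ker F) (of_nat 3 * finv (of_nat 3)) 1"
      by (intro finv_right[OF F] allI) (simp only: ev3 l_zero one_closed one_not_zero not_False_eq_True)
    then show ?thesis using C by blast
  qed
qed

text \<open>The root of order \<open>2 ^ k\<close>, raised to half its order, has square 1 without
  being 1, so it is -1. This also shows that 1 differs from -1, hence that 2 is invertible. From
  \<open>2 ^ k0 <= 4 * b\<close> and \<open>b <= 2 ^ Suc n\<close> comes the bound
  \<open>n + 3\<close> on k0.\<close>

lemma mult_rate_supports_fft:
  assumes F: "field F" and fft: "supports_fft F b" and b: "b \<ge> 2" and k0: "2 ^ k0 \<le> 4 * b"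
  shows "mult_rate (ker F) (consts_of F) k0 (568 * Suc k0)"
proof -
  interpret field F by fact
  interpret G: group "mult_of F" by (rule field_mult_group)
  obtain k \<omega> where k: "b \<le> 2 ^ k" and w: "\<omega> \<in> carrier (mult_of F)" "group.ord (mult_of F) \<omega> = 2 ^ k"
    using fft by (auto simp: supports_fft_def)
  have "k \<noteq> 0" using k b by (intro notI) simp
  then obtain n where n: "k = Suc n" by (cases k) auto
  have wF: "\<omega> \<in> carrier F" using w by simp
  define \<eta> where "\<eta> = \<omega> [^]\<^bsub>F\<^esub> ((2::nat) ^ n)"
  have eta: "\<eta> \<in> carrier F" using wF by (simp add: \<eta>_def)
  have "\<omega> [^]\<^bsub>F\<^esub> ((2::nat) ^ k) = \<one>\<^bsub>F\<^esub>"
    using G.pow_ord_eq_1[OF w(1)] unfolding w(2) nat_pow_mult_of one_mult_of .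
  then have "\<eta> \<otimes>\<^bsub>F\<^esub> \<eta> = \<one>\<^bsub>F\<^esub>"
    unfolding \<eta>_def nat_pow_mult[OF wF] n by (simp add: mult_2)
  moreover have "\<eta> \<noteq> \<one>\<^bsub>F\<^esub>"
  proof
    assume "\<eta> = \<one>\<^bsub>F\<^esub>"
    then have "\<omega> [^]\<^bsub>mult_of F\<^esub> ((2::nat) ^ n) = \<one>\<^bsub>mult_of F\<^esub>"
      by (simp add: \<eta>_def nat_pow_mult_of)
    then have "(2::nat) ^ k dvd 2 ^ n" using G.pow_eq_id[OF w(1)] w(2) by simp
    then show False by (simp add: n power_dvd_imp_le)
  qed
  ultimately have eta_minus: "\<eta> = \<ominus>\<^bsub>F\<^esub> \<one>\<^bsub>F\<^esub>" using square_eq_one[OF eta] by blast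
  have two: "\<one>\<^bsub>F\<^esub> \<oplus>\<^bsub>F\<^esub> \<one>\<^bsub>F\<^esub> \<noteq> \<zero>\<^bsub>F\<^esub>"
  proof
    assume "\<one>\<^bsub>F\<^esub> \<oplus>\<^bsub>F\<^esub> \<one>\<^bsub>F\<^esub> = \<zero>\<^bsub>F\<^esub>"
    then have "\<ominus>\<^bsub>F\<^esub> \<one>\<^bsub>F\<^esub> = \<one>\<^bsub>F\<^esub>" by (intro minus_equality) auto
    then show False using eta_minus \<open>\<eta> \<noteq> \<one>\<^bsub>F\<^esub>\<close> by simp
  qed
  have "eqm (ker F) (fconst F \<omega> ^ (2 ^ n)) (-1)"
    using eta_minus wF
    by (simp add: eqm_ker[OF F] ev_power[OF F] ev_const[OF is_cring] ev_uminus[OF is_cring] ev_1[OF is_cring] \<eta>_def)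
  moreover have "ev F xs 2 = \<one>\<^bsub>F\<^esub> \<oplus>\<^bsub>F\<^esub> \<one>\<^bsub>F\<^esub>" for xs
    using ev_add[OF is_cring, of xs 1 1] by (simp add: ev_1[OF is_cring])
  then have "eqm (ker F) (2 * finv 2) 1"
    using two by (intro finv_right[OF F] allI) simp
  moreover have "finv 2 \<in> consts_of F"
    using const_ring_of_nat[OF const_ring_consts[OF F], of 2] by (intro finv_consts[OF F]) simp
  moreover have "k0 \<le> n + 3"
  proof -
    have "2 ^ k0 \<le> 4 * (2::nat) ^ k" using k0 k by linarith
    then have "(2::nat) ^ k0 \<le> 2 ^ (n + 3)" by (simp add: n power_add)
    then show ?thesis by (rule power_le_imp_le_exp[rotated]) simp
  qed
  ultimately show ?thesis
    by (intro mult_rate_fft[OF ring_ideal_ker[OF F] const_ring_consts[OF F], of "fconst F \<omega>" n "finv 2"] fconst_consts[OF F])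
qed

section \<open>The cost of interpolation in terms of \<open>O_tilde\<close>\<close>

definition fft_factor :: "'a ring \<Rightarrow> nat \<Rightarrow> real" where
  "fft_factor F b = (if supports_fft F b then 1 else max 1 (log 2 (log 2 (real b))))"

lemma O_tilde_alt: "O_tilde F a b = a * (log 2 (real b))\<^sup>2 * fft_factor F b"
  by (simp add: O_tilde_def fft_factor_def)

lemma fft_factor_ge_1: "fft_factor F b \<ge> 1"
  by (simp add: fft_factor_def)

lemma mult_rate_field:
  assumes F: "field F" and b: "b \<ge> 2" and k0: "2 ^ k0 \<le> 4 * b"
  shows "\<exists>\<mu>. mult_rate (ker F) (consts_of F) k0 \<mu> \<and> real \<mu> \<le> 432016 * log 2 (real b) * fft_factor F b"
proof -
  define y where "y = log 2 (real b)"
  have y: "y \<ge> 1" using b unfolding y_def by (subst le_log_iff) auto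
  have "real k0 = log 2 (real (2 ^ k0))" by simp
  also have "\<dots> \<le> log 2 (real (4 * b))" using k0 b by (intro log_mono) (auto simp del: of_nat_mult of_nat_power)
  also have "\<dots> = 2 + y"
  proof -
    have "log 2 (4 :: real) = 2" using log_pow_cancel[of 2 2] by simp
    then show ?thesis using b by (simp add: log_mult y_def)
  qed
  finally have k0y: "real k0 \<le> 2 + y" .
  then have k04: "real k0 + 1 \<le> 4 * y" using y by linarith
  show ?thesis
  proof (cases "supports_fft F b")
    case True
    have "real (568 * Suc k0) \<le> 568 * (4 * y)" using k04 by simp
    also have "\<dots> \<le> 432016 * y * fft_factor F b" using y True by (simp add: fft_factor_def)
    finally show ?thesis using mult_rate_supports_fft[OF F True b k0] unfolding y_def by blast
  next
    case False
    have l6: "log 2 (real k0 + 3) \<le> 4 * fft_factor F b"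
    proof -
      have "log 2 (real k0 + 3) \<le> log 2 (8 * y)" using k0y y by (intro log_mono) auto
      also have "\<dots> = 3 + log 2 y"
      proof -
        have "log 2 (8 :: real) = 3" using log_pow_cancel[of 2 3] by simp
        then show ?thesis using y by (simp add: log_mult)
      qed
      also have "\<dots> \<le> 4 * max 1 (log 2 y)" by linarith
      finally show ?thesis using False by (simp add: fft_factor_def y_def)
    qed
    obtain r v where rv: "r = 2 \<or> r = 3" "v \<in> consts_of F" "eqm (ker F) (of_nat r * v) 1"
      using small_radix_invertible[OF F] by blast
    obtain \<mu> where mu: "mult_rate (ker F) (consts_of F) k0 \<mu>" "real \<mu> \<le> 27001 * (real k0 + 1) * log 2 (real k0 + 3)"
      using mult_rate_any[OF ring_ideal_ker[OF F] const_ring_consts[OF F] rv] by blast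
    \<comment> \<open>Both the size \<open>k0 + 1\<close> and its logarithm lose a factor 4 when
      expressed by b, and \<open>16 * 27001 = 432016\<close>.\<close>
    have "27001 * (real k0 + 1) * log 2 (real k0 + 3) \<le> 27001 * (4 * y) * (4 * fft_factor F b)"
      using k04 l6 y by (intro mult_mono) auto
    also have "\<dots> = 432016 * y * fft_factor F b" by simp
    finally show ?thesis using mu unfolding y_def by (intro exI[of _ \<mu>]) linarith
  qed
qed

text \<open>Lagrange interpolation of the values \<open>y i\<close> at the nodes
  \<open>g ^ i\<close>, evaluated at \<open>g ^ e\<close>.\<close>

definition interp :: "'a fam \<Rightarrow> nat set \<Rightarrow> (nat \<Rightarrow> 'a fam) \<Rightarrow> nat \<Rightarrow> 'a fam" where
  "interp g A y e =
     (\<Sum>i\<in>A. finv (\<Prod>j\<in>A - {i}. g ^ i - g ^ j) * y i * (\<Prod>j\<in>A - {i}. g ^ e - g ^ j))"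

text \<open>For \<open>b = 1\<close> the bound is 0, as \<open>log 1 = 0\<close>; then the map is the identity up to v.\<close>

lemma interp_cost:
  assumes F: "field F" and b: "b \<ge> 1"
  shows "\<exists>T. real T \<le> 10368408 * O_tilde F (real b) b \<and>
    (\<forall>g A y v E. g \<in> consts_of F \<longrightarrow> (\<forall>xs. ev F xs g \<noteq> \<zero>\<^bsub>F\<^esub>) \<longrightarrow> finite A \<longrightarrow> card A \<le> b \<longrightarrow>
      (\<forall>e. v e \<in> consts_of F) \<longrightarrow> E \<subseteq> {..b} \<longrightarrow> (b = 1 \<longrightarrow> (\<forall>e\<in>E. eqm (ker F) (v e) 1)) \<longrightarrow>
      derives (ker F) (consts_of F) (y ` A) T ((\<lambda>e. v e * interp g A y e) ` E))"
proof (cases "b = 1")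
  case True
  note I = ring_ideal_ker[OF F]
  interpret field F by fact
  have "derives (ker F) (consts_of F) (y ` A) 0 ((\<lambda>e. v e * interp g A y e) ` E)"
    if "finite A" "card A \<le> b" "\<forall>e\<in>E. eqm (ker F) (v e) 1" for g A y v E
  proof (rule derives.known, clarify)
    fix e assume e: "e \<in> E"
    show "\<exists>k\<in>insert 0 (y ` A). eqm (ker F) (v e * interp g A y e) k"
    proof (cases "A = {}")
      case True
      then show ?thesis by (simp add: interp_def eqm_refl[OF I])
    next
      case False
      then have "card A = 1" using that True by (simp add: card_gt_0_iff Suc_le_eq le_antisym)
      then obtain i where A: "A = {i}" by (auto simp: card_1_singleton_iff)
      have "eqm (ker F) (1 * finv 1) 1"
        by (intro finv_right[OF F] allI) (simp add: ev_1[OF is_cring])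
      then have "eqm (ker F) (v e * (finv 1 * y i * 1)) (1 * (1 * y i * 1))"
        using that(3) e by (intro eqm_mult[OF I] eqm_refl[OF I]) auto
      then show ?thesis by (simp add: A interp_def)
    qed
  qed
  then show ?thesis using True by (intro exI[of _ 0]) (simp add: O_tilde_def)
next
  case False
  then have b: "b \<ge> 2" using b by simp
  note I = ring_ideal_ker[OF F] and C = const_ring_consts[OF F]
  define y where "y = log 2 (real b)"
  have y: "y \<ge> 1" using b unfolding y_def by (subst le_log_iff) auto
  obtain n where n: "2 ^ n \<le> b" "b < 2 ^ (n + 1)" using ex_power_ivl1[of 2 b] b by auto
  \<comment> \<open>The strict bound \<open>b < 2 ^ k\<close> is wanted because E may contain b
    itself. The evaluation multiplies at size \<open>Suc k\<close>, and
    \<open>2 ^ Suc k <= 4 * b\<close> is what \<open>mult_rate_field\<close> allows.\<close>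
  define k where "k = n + 1"
  have k: "2 ^ k \<le> 2 * b" "b < 2 ^ k" using n by (simp_all add: k_def)
  obtain \<mu> where mu: "mult_rate (ker F) (consts_of F) (Suc k) \<mu>" "real \<mu> \<le> 432016 * y * fft_factor F b"
    using mult_rate_field[OF F b, of "Suc k"] k unfolding y_def by auto
  define T where "T = 2 ^ k * Suc k * (2 * \<mu> + 4)"
  have "real T \<le> 10368408 * O_tilde F (real b) b"
  proof -
    have "real n = log 2 (real (2 ^ n))" by simp
    also have "\<dots> \<le> y" unfolding y_def using n(1) by (intro log_mono) (auto simp del: of_nat_power)
    finally have sk: "real (Suc k) \<le> 3 * y" using y by (simp add: k_def)
    have "real (2 ^ k) \<le> real (2 * b)" by (rule of_nat_mono[OF k(1)])
    then have pk: "real (2 ^ k) \<le> 2 * real b" by simp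
    have "1 * 1 \<le> y * fft_factor F b" using y fft_factor_ge_1[of F b] by (intro mult_mono) auto
    then have m4: "real (2 * \<mu> + 4) \<le> 864036 * (y * fft_factor F b)" using mu(2) by simp
    have "real T = real (2 ^ k) * real (Suc k) * real (2 * \<mu> + 4)"
      unfolding T_def by (simp only: of_nat_mult)
    also have "\<dots> \<le> (2 * real b) * (3 * y) * (864036 * (y * fft_factor F b))"
      using y by (intro mult_mono pk sk m4) auto
    \<comment> \<open>\<open>864036 = 2 * 432016 + 4\<close>, and the factors 2 and 3 come from
      rounding b up to a power of two and from the number of levels.\<close>
    also have "\<dots> = 5184216 * O_tilde F (real b) b"
      by (simp add: O_tilde_alt y_def power2_eq_square)
    also have "\<dots> \<le> 10368408 * O_tilde F (real b) b"
      using fft_factor_ge_1[of F b] by (intro mult_right_mono) (auto simp: O_tilde_alt)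
    finally show ?thesis .
  qed
  moreover have "derives (ker F) (consts_of F) (z ` A) T ((\<lambda>e. v e * interp g A z e) ` E)"
    if "g \<in> consts_of F" "\<forall>xs. ev F xs g \<noteq> \<zero>\<^bsub>F\<^esub>" "finite A" "card A \<le> b"
      "\<forall>e. v e \<in> consts_of F" "E \<subseteq> {..b}" for g A z v E
  proof -
    have gC: "g ^ i \<in> consts_of F" for i by (rule const_ring_power[OF C that(1)])
    have "derives (ker F) (consts_of F) (z ` A) T ((\<lambda>e. v e * interp g A z e) ` {..<2 ^ k})"
      unfolding interp_def T_def
    proof (rule derives_interpolate_eval[OF I C mu(1) that(1) finv_consts[OF F that(1)] finv_right[OF F that(2)] that(3)])
      show "card A \<le> 2 ^ k" using that(4) k(2) by linarith
      show "finv (\<Prod>j\<in>A - {i}. g ^ i - g ^ j) \<in> consts_of F" for i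
        by (intro finv_consts[OF F] const_ring_prod[OF C] const_ring_diff[OF C] gC)
    qed (use gC that(5) in auto)
    moreover have "E \<subseteq> {..<2 ^ k}" using that(6) k(2) by auto
    ultimately show ?thesis by (blast intro: derives_sub)
  qed
  ultimately show ?thesis by (intro exI[of _ T]) blast
qed

text \<open>A polynomial with as many roots as its length vanishes modulo I. Roots are split off by
  synthetic division; differences of nodes are units modulo I, which takes the place of the absence
  of zero divisors.\<close>

lemma poly_in_ideal_of_roots:
  fixes I :: "'r::comm_ring_1 set" and x :: "'i \<Rightarrow> 'r"
  assumes I: "ring_ideal I"
  shows "finite A \<Longrightarrow> short (card A) p \<Longrightarrow> (\<And>i. i \<in> A \<Longrightarrow> poly p (x i) \<in> I) \<Longrightarrow>
    (\<And>i j. i \<in> A \<Longrightarrow> j \<in> A \<Longrightarrow> i \<noteq> j \<Longrightarrow> \<exists>v. eqm I ((x i - x j) * v) 1) \<Longrightarrow> poly p t \<in> I"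
proof (induction A arbitrary: p t rule: finite_induct)
  case empty
  then have "p = 0" by (auto simp: short_def poly_eq_iff)
  then show ?case by (simp add: ring_ideal_0[OF I])
next
  case (insert s A)
  define q where "q = synthetic_div p (x s)"
  have p: "poly p t = (t - x s) * poly q t + poly p (x s)" for t
  proof -
    have "poly p t = poly ([:- x s, 1:] * q + [:poly p (x s):]) t"
      by (simp only: q_def synthetic_div_correct')
    then show ?thesis by (simp add: left_diff_distrib)
  qed
  have "short (card A) q"
  proof (cases "degree p = 0")
    case True
    then show ?thesis by (simp add: q_def synthetic_div_eq_0_iff[THEN iffD2])
  next
    case False
    have "degree p < Suc (card A)"
    proof (rule ccontr)
      assume "\<not> degree p < Suc (card A)"
      then have "coeff p (degree p) = 0" using insert.prems(1) insert.hyps by (simp add: short_def)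
      then show False using False by auto
    qed
    then show ?thesis using False by (intro degree_less_imp_short) (simp add: q_def degree_synthetic_div)
  qed
  moreover have "poly q (x j) \<in> I" if j: "j \<in> A" for j
  proof -
    obtain v where v: "eqm I ((x j - x s) * v) 1" using insert.prems(3)[of j s] insert.hyps j by auto
    have "(x j - x s) * poly q (x j) = poly p (x j) - poly p (x s)" using p[of "x j"] by simp
    then have "(x j - x s) * poly q (x j) \<in> I"
      using insert.prems(2) j by (simp add: ring_ideal_diff[OF I])
    then have "v * ((x j - x s) * poly q (x j)) \<in> I" by (rule ring_ideal_mult[OF I])
    moreover have "eqm I ((x j - x s) * v * poly q (x j)) (1 * poly q (x j))"
      by (intro eqm_mult[OF I] v eqm_refl[OF I])
    ultimately have "v * ((x j - x s) * poly q (x j)) - ((x j - x s) * v * poly q (x j) - 1 * poly q (x j)) \<in> I"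
      unfolding eqm_def by (rule ring_ideal_diff[OF I])
    moreover have "v * ((x j - x s) * poly q (x j)) = (x j - x s) * v * poly q (x j)"
      by (simp only: mult_ac)
    ultimately show ?thesis by simp
  qed
  ultimately have "poly q t \<in> I"
  proof (rule insert.IH)
    show "\<exists>v. eqm I ((x i - x j) * v) 1" if "i \<in> A" "j \<in> A" "i \<noteq> j" for i j
      by (rule insert.prems(3)) (use that in auto)
  qed
  then show ?case unfolding p[of t]
    using insert.prems(2)[of s] by (intro ring_ideal_add[OF I] ring_ideal_mult[OF I]) auto
qed

context
  fixes F :: "'a ring" and g :: "'a fam" and A :: "nat set"
  assumes F: "field F" and A: "finite A"
    and distinct: "\<And>i j xs. i \<in> A \<Longrightarrow> j \<in> A \<Longrightarrow> i \<noteq> j \<Longrightarrow> ev F xs (g ^ i) \<noteq> ev F xs (g ^ j)"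
begin

lemma node_weight: "i \<in> A \<Longrightarrow> eqm (ker F) ((\<Prod>j\<in>A - {i}. g ^ i - g ^ j) * finv (\<Prod>j\<in>A - {i}. g ^ i - g ^ j)) 1"
  using A distinct by (intro finv_right[OF F] allI ev_prod_nonzero[OF F] ev_diff_nonzero[OF F]) auto

lemma interp_node:
  assumes i: "i \<in> A"
  shows "eqm (ker F) (interp g A y i) (y i)"
proof -
  note I = ring_ideal_ker[OF F]
  let ?P = "\<Prod>j\<in>A - {i}. g ^ i - g ^ j"
  have "interp g A y i = (\<Sum>s\<in>A. if s = i then ?P * finv ?P * y i else 0)"
    unfolding interp_def
  proof (rule sum.cong[OF refl])
    fix s assume s: "s \<in> A"
    show "finv (\<Prod>j\<in>A - {s}. g ^ s - g ^ j) * y s * (\<Prod>j\<in>A - {s}. g ^ i - g ^ j)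
        = (if s = i then ?P * finv ?P * y i else 0)"
    proof (cases "s = i")
      case False
      then have "(\<Prod>j\<in>A - {s}. g ^ i - g ^ j) = 0" using A i by (intro prod_zero) auto
      then show ?thesis using False by simp
    qed (simp add: mult_ac)
  qed
  also have "\<dots> = ?P * finv ?P * y i" using A i by simp
  finally have e: "interp g A y i = ?P * finv ?P * y i" .
  have "eqm (ker F) (?P * finv ?P * y i) (1 * y i)"
    by (intro eqm_mult[OF I] node_weight i eqm_refl[OF I])
  then show ?thesis unfolding e by simp
qed

lemma interp_eq_poly_lagr:
  "interp g A y e = poly (lagr (\<lambda>i. finv (\<Prod>j\<in>A - {i}. g ^ i - g ^ j) * y i) (\<lambda>j. [:- (g ^ j), 1:]) A) (g ^ e)"
  by (simp add: interp_def lagr_def poly_sum poly_prod)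

lemma short_lagr_linear: "short (card A) (lagr z (\<lambda>j. [:- (g ^ j), 1:]) A)"
  using A by (intro short_lagr) (auto simp: short_def coeff_pCons split: nat.splits)

text \<open>Uniqueness of interpolation: p minus its Lagrange polynomial has \<open>card A\<close>
  roots but no greater length.\<close>

lemma interp_poly:
  assumes p: "short (card A) p"
  shows "eqm (ker F) (poly p (g ^ e)) (interp g A (\<lambda>i. poly p (g ^ i)) e)"
proof -
  note I = ring_ideal_ker[OF F]
  let ?q = "lagr (\<lambda>i. finv (\<Prod>j\<in>A - {i}. g ^ i - g ^ j) * poly p (g ^ i)) (\<lambda>j. [:- (g ^ j), 1:]) A"
  have "poly (p - ?q) (g ^ e) \<in> ker F"
  proof (rule poly_in_ideal_of_roots[OF I A, where x = "\<lambda>i. g ^ i"])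
    show "short (card A) (p - ?q)" by (intro short_diff p short_lagr_linear)
    show "poly (p - ?q) (g ^ i) \<in> ker F" if "i \<in> A" for i
      using eqm_sym[OF I interp_node[OF that, of "\<lambda>i. poly p (g ^ i)"]]
      by (simp add: interp_eq_poly_lagr eqm_def)
    show "\<exists>v. eqm (ker F) ((g ^ i - g ^ j) * v) 1" if "i \<in> A" "j \<in> A" "i \<noteq> j" for i j
      by (rule exI[of _ "finv (g ^ i - g ^ j)"], intro finv_right[OF F] allI ev_diff_nonzero[OF F] distinct that)
  qed
  then show ?thesis by (simp add: interp_eq_poly_lagr eqm_def)
qed

end

text \<open>Two windows of one period each: data indices start at 0, server numbers at 1.\<close>

lemma primitive_powers_distinct:
  assumes F: "field F" and fin: "finite (carrier F)"
  shows "\<exists>g\<in>carrier F. g \<noteq> \<zero>\<^bsub>F\<^esub> \<and> (\<forall>i<card (carrier F) - 1. \<forall>j<card (carrier F) - 1. g [^]\<^bsub>F\<^esub> i = g [^]\<^bsub>F\<^esub> j \<longrightarrow> i = j) \<and>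
    (\<forall>i\<in>{1..card (carrier F) - 1}. \<forall>j\<in>{1..card (carrier F) - 1}. g [^]\<^bsub>F\<^esub> i = g [^]\<^bsub>F\<^esub> j \<longrightarrow> i = j)"
proof -
  interpret field F by fact
  interpret G: group "mult_of F" by (rule field_mult_group)
  have finG: "finite (carrier (mult_of F))" using fin by simp
  obtain g where g: "g \<in> carrier (mult_of F)" "carrier (mult_of F) = {g [^]\<^bsub>F\<^esub> i | i::nat. i \<in> UNIV}"
    using finite_field_mult_group_has_gen[OF fin] by blast
  let ?o = "group.ord (mult_of F) g"
  have o1: "?o \<ge> 1" by (rule G.ord_ge_1[OF finG g(1)])
  have "carrier (mult_of F) = (\<lambda>x. g [^]\<^bsub>mult_of F\<^esub> x) ` {0..?o - 1}"
    using G.ord_elems[OF finG g(1)] g(2) unfolding nat_pow_mult_of by (auto simp: image_def)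
  then have "card (carrier (mult_of F)) \<le> card {0..?o - 1}" by (metis card_image_le finite_atLeastAtMost)
  then have q: "card (carrier F) - 1 \<le> ?o" using o1 fin by (simp add: card_Diff_singleton)
  have inj1: "inj_on (\<lambda>x. g [^]\<^bsub>F\<^esub> x) {0..?o - 1}" using G.ord_inj[OF g(1)] unfolding nat_pow_mult_of .
  have inj2: "inj_on (\<lambda>x. g [^]\<^bsub>F\<^esub> x) {1..?o}" using G.ord_inj'[OF g(1)] unfolding nat_pow_mult_of .
  show ?thesis
  proof (intro bexI[of _ g] conjI allI ballI impI)
    show "g \<noteq> \<zero>\<^bsub>F\<^esub>" "g \<in> carrier F" using g(1) by auto
    show "i = j" if "i < card (carrier F) - 1" "j < card (carrier F) - 1" "g [^]\<^bsub>F\<^esub> i = g [^]\<^bsub>F\<^esub> j" for i j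
      by (rule inj_onD[OF inj1 that(3)]) (use that q in auto)
    show "i = j" if "i \<in> {1..card (carrier F) - 1}" "j \<in> {1..card (carrier F) - 1}" "g [^]\<^bsub>F\<^esub> i = g [^]\<^bsub>F\<^esub> j" for i j
      by (rule inj_onD[OF inj2 that(3)]) (use that q in auto)
  qed
qed

section \<open>The code\<close>

lemma length_concat_uniform:
  "(\<And>x. x \<in> set l \<Longrightarrow> length (f x) = n) \<Longrightarrow> length (concat (map f l)) = length l * n"
  by (induction l) auto

lemma nth_concat_uniform:
  "(\<And>x. x \<in> set l \<Longrightarrow> length (f x) = n) \<Longrightarrow> i < length l \<Longrightarrow> j < n \<Longrightarrow> concat (map f l) ! (i * n + j) = f (l ! i) ! j"
proof (induction l arbitrary: i)
  case (Cons x l)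
  show ?case
  proof (cases i)
    case 0
    then show ?thesis using Cons.prems by (simp add: nth_append)
  next
    case (Suc i')
    then show ?thesis using Cons.prems Cons.IH[of i'] by (simp add: nth_append)
  qed
qed simp

definition flat :: "nat \<Rightarrow> nat \<Rightarrow> nat \<Rightarrow> (nat \<Rightarrow> nat \<Rightarrow> nat \<Rightarrow> 'b) \<Rightarrow> 'b list" where
  "flat L m n f = concat (map (\<lambda>i. concat (map (\<lambda>p. map (f i p) [0..<n]) [0..<m])) [0..<L])"

lemma length_flat_row: "length (concat (map (\<lambda>p. map (f i p) [0..<n]) [0..<m])) = m * n"
  by (subst length_concat_uniform[where n = n]) auto

lemma length_flat: "length (flat L m n f) = L * (m * n)"
  unfolding flat_def by (subst length_concat_uniform[where n = "m * n"]) (auto simp: length_flat_row)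

lemma flat_index: "p < m \<Longrightarrow> q < n \<Longrightarrow> p * n + q < m * (n::nat)"
proof -
  assume "p < m" "q < n"
  then have "p * n + q < Suc p * n" by simp
  also have "\<dots> \<le> m * n" using \<open>p < m\<close> by (intro mult_le_mono1) simp
  finally show ?thesis .
qed

lemma nth_flat:
  assumes "i < L" "p < m" "q < n"
  shows "flat L m n f ! (i * (m * n) + (p * n + q)) = f i p q"
proof -
  have "flat L m n f ! (i * (m * n) + (p * n + q)) = concat (map (\<lambda>p. map (f ([0..<L] ! i) p) [0..<n]) [0..<m]) ! (p * n + q)"
    unfolding flat_def by (rule nth_concat_uniform) (use assms flat_index in \<open>auto simp: length_flat_row\<close>)
  also have "\<dots> = map (f ([0..<L] ! i) ([0..<m] ! p)) [0..<n] ! q"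
    by (rule nth_concat_uniform) (use assms in auto)
  finally show ?thesis using assms by simp
qed

lemma set_flat: "set (flat L m n f) = (\<Union>i<L. \<Union>p<m. f i p ` {..<n})"
  by (simp add: flat_def lessThan_atLeast0)

lemma map_flat: "map h (flat L m n f) = flat L m n (\<lambda>i p q. h (f i p q))"
  by (simp add: flat_def map_concat comp_def)

lemma flat_cong: "(\<And>i p q. i < L \<Longrightarrow> p < m \<Longrightarrow> q < n \<Longrightarrow> f i p q = h i p q) \<Longrightarrow> flat L m n f = flat L m n h"
  unfolding flat_def by (intro arg_cong[of _ _ concat] map_cong refl) auto

lemma batch_entries_flat:
  assumes "length As = L" "\<And>A. A \<in> set As \<Longrightarrow> A \<in> carrier_mat m n"
  shows "batch_entries As = flat L m n (\<lambda>i p q. As ! i $$ (p, q))"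
proof -
  have "batch_entries As = concat (map (\<lambda>i. concat (mat_to_list (As ! i))) [0..<L])"
    unfolding batch_entries_def by (subst map_nth[of As, symmetric]) (simp add: assms(1) comp_def)
  also have "\<dots> = flat L m n (\<lambda>i p q. As ! i $$ (p, q))"
    unfolding flat_def
  proof (intro arg_cong[of _ _ concat] map_cong refl)
    fix i assume "i \<in> set [0..<L]"
    then have "As ! i \<in> carrier_mat m n" using assms by simp
    then show "mat_to_list (As ! i) = map (\<lambda>p. map (\<lambda>q. As ! i $$ (p, q)) [0..<n]) [0..<m]"
      by (simp add: mat_to_list_def)
  qed
  finally show ?thesis .
qed

lemma batch_nth_carrier:
  assumes "As \<in> batches F L m n" "i < L" "p < m" "q < n"
  shows "As ! i $$ (p, q) \<in> carrier F"
proof -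
  have "As ! i \<in> set As" using assms by (simp add: batches_def)
  then have "As ! i \<in> carrier_mat m n" "elements_mat (As ! i) \<subseteq> carrier F" using assms by (auto simp: batches_def)
  moreover from this(1) have "As ! i $$ (p, q) \<in> elements_mat (As ! i)"
    using assms(3,4) by (intro elements_matI[of _ m n p q]) auto
  ultimately show ?thesis by blast
qed

lemma batch_entries_batch:
  "As \<in> batches F L m n \<Longrightarrow> batch_entries As = flat L m n (\<lambda>i p q. As ! i $$ (p, q))"
  by (rule batch_entries_flat) (auto simp: batches_def)

lemma batch_entries_tuples:
  assumes "As \<in> batches F L m n"
  shows "batch_entries As \<in> tuples F (L * (m * n))"
  unfolding batch_entries_batch[OF assms] tuples_def
  using batch_nth_carrier[OF assms] by (auto simp: length_flat set_flat)

section \<open>Blocks of data points and recovery from the answers\<close>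

definition block :: "nat \<Rightarrow> nat \<Rightarrow> nat set" where
  "block Kc l = {l * Kc..<l * Kc + Kc}"

text \<open>The value at \<open>g ^ e\<close> of the polynomial \<open>Q_l\<close> of the
  overview.\<close>

definition coblock_prod :: "'a fam \<Rightarrow> nat \<Rightarrow> nat \<Rightarrow> nat \<Rightarrow> nat \<Rightarrow> 'a fam" where
  "coblock_prod g L Kc l e = (\<Prod>i\<in>{..<L} - block Kc l. g ^ e - g ^ i)"

lemma block_subset: "l < ell \<Longrightarrow> block Kc l \<subseteq> {..<ell * Kc}"
proof
  fix i assume "l < ell" "i \<in> block Kc l"
  then have "i < Suc l * Kc" by (simp add: block_def)
  also have "\<dots> \<le> ell * Kc" using \<open>l < ell\<close> by (intro mult_le_mono1) simp
  finally show "i \<in> {..<ell * Kc}" by simp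
qed

lemma mem_block_iff: "Kc > 0 \<Longrightarrow> i \<in> block Kc l \<longleftrightarrow> l = i div Kc"
proof -
  assume K: "Kc > 0"
  show ?thesis
  proof
    assume "i \<in> block Kc l"
    then have "l * Kc \<le> i" "i < Suc l * Kc" by (auto simp: block_def)
    then show "l = i div Kc" by (intro div_nat_eqI[symmetric]) (simp_all add: mult.commute)
  next
    assume l: "l = i div Kc"
    have "i = i div Kc * Kc + i mod Kc" "i mod Kc < Kc" using K by simp_all
    then show "i \<in> block Kc l" unfolding block_def l atLeastLessThan_iff by linarith
  qed
qed

context
  fixes F :: "'a ring"
  assumes F: "field F"
begin

interpretation field F by (rule F)

lemma ev_consts: "c \<in> consts_of F \<Longrightarrow> ev F xs c = ev F zs c"
  by (auto simp: consts_of_def)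

lemma ev_mult_cong: "ev F xs a = ev F zs a' \<Longrightarrow> ev F xs b = ev F zs b' \<Longrightarrow> ev F xs (a * b) = ev F zs (a' * b')"
  by (simp add: ev_mult[OF is_cring])

lemma ev_sum_cong:
  "(\<And>i. i \<in> A \<Longrightarrow> ev F xs (f i) = ev F zs (h i)) \<Longrightarrow> ev F xs (sum f A) = ev F zs (sum h A)"
  by (induction A rule: infinite_finite_induct) (simp_all add: ev_0[OF is_cring] ev_add[OF is_cring])

text \<open>The nodes and weights are constants, so the inputs enter only through y. This permits
  comparing expressions at different input tuples, in particular registers at the data with
  constants at the empty tuple.\<close>

lemma ev_interp_cong:
  assumes g: "g \<in> consts_of F" and y: "\<And>i. i \<in> A \<Longrightarrow> ev F xs (y i) = ev F zs (y' i)"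
  shows "ev F xs (interp g A y e) = ev F zs (interp g A y' e)"
proof -
  note C = const_ring_consts[OF F]
  have gC: "g ^ i \<in> consts_of F" for i by (rule const_ring_power[OF C g])
  show ?thesis
    unfolding interp_def
    by (intro ev_sum_cong ev_mult_cong y ev_consts finv_consts[OF F] const_ring_prod[OF C] const_ring_diff[OF C] gC)
qed

lemma coblock_prod_consts: "g \<in> consts_of F \<Longrightarrow> coblock_prod g L Kc l e \<in> consts_of F"
  unfolding coblock_prod_def
  by (intro const_ring_prod const_ring_diff const_ring_power const_ring_consts F)

text \<open>The answers are the values of one polynomial P, of length \<open>L + Kc - 1\<close>, at the server points.
  At a data point i all summands but that of the block of i vanish, so that \<open>P (g ^ i)\<close> is the wanted
  product up to a factor which is nonzero because i lies in the block.\<close>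

lemma interp_answers:
  fixes a b :: "nat \<Rightarrow> nat \<Rightarrow> 'a fam" and kap :: nat
  assumes L: "L = ell * Kc" and Kc: "Kc > 0" and R: "finite R" "card R = L + Kc - 1" and i: "i < L"
    and dL: "\<And>i j xs. i < L \<Longrightarrow> j < L \<Longrightarrow> i \<noteq> j \<Longrightarrow> ev F xs (g ^ i) \<noteq> ev F xs (g ^ j)"
    and dR: "\<And>i j xs. i \<in> R \<Longrightarrow> j \<in> R \<Longrightarrow> i \<noteq> j \<Longrightarrow> ev F xs (g ^ i) \<noteq> ev F xs (g ^ j)"
  defines "Y \<equiv> \<lambda>s. \<Sum>l<ell. \<Sum>k<kap. interp g (block Kc l) (\<lambda>i. a i k) s *
      (coblock_prod g L Kc l s * interp g (block Kc l) (\<lambda>i. b i k) s)"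
  shows "eqm (ker F) (finv (coblock_prod g L Kc (i div Kc) i) * interp g R Y i) (\<Sum>k<kap. a i k * b i k)"
proof -
  note I = ring_ideal_ker[OF F]
  have fin: "finite (block Kc l)" and card: "card (block Kc l) = Kc" for l by (auto simp: block_def)
  have dB: "ev F xs (g ^ i) \<noteq> ev F xs (g ^ j)"
    if "l < ell" "i \<in> block Kc l" "j \<in> block Kc l" "i \<noteq> j" for l i j xs
    using dL[of i j xs] block_subset[OF that(1), of Kc] that L by auto
  let ?w = "\<lambda>l i. finv (\<Prod>j\<in>block Kc l - {i}. g ^ i - g ^ j)"
  let ?m = "\<lambda>j. [:- (g ^ j), 1:]"
  define PA where "PA l k = lagr (\<lambda>i. ?w l i * a i k) ?m (block Kc l)" for l k
  define PB where "PB l k = lagr (\<lambda>i. ?w l i * b i k) ?m (block Kc l)" for l k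
  define PQ where "PQ l = (\<Prod>i\<in>{..<L} - block Kc l. ?m i)" for l
  define P where "P = (\<Sum>l<ell. \<Sum>k<kap. PA l k * (PQ l * PB l k))"
  have polyY: "poly P (g ^ s) = Y s" for s
    unfolding P_def Y_def poly_sum poly_mult PA_def PB_def PQ_def coblock_prod_def
    by (simp add: interp_def lagr_def poly_sum poly_prod)
  have m2: "short 2 (?m j)" for j by (auto simp: short_def coeff_pCons split: nat.splits)
  have "short (card R) P"
    unfolding P_def
  proof (intro short_sum)
    fix l k assume l: "l \<in> {..<ell}"
    have "card ({..<L} - block Kc l) = L - Kc"
      using l block_subset[of l ell Kc] by (subst card_Diff_subset) (auto simp: card L fin)
    then have "short (L - Kc + 1) (PQ l)" unfolding PQ_def using short_prod[OF m2, of "{..<L} - block Kc l"] by simp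
    moreover have "short Kc (PA l k)" "short Kc (PB l k)"
      unfolding PA_def PB_def using short_lagr[OF m2 fin, of l] by (simp_all only: card)
    \<comment> \<open>The lengths Kc, \<open>L - Kc + 1\<close> and Kc combine to
      \<open>L + Kc - 1\<close>, which is the recovery threshold.\<close>
    ultimately have "short (Kc + ((L - Kc + 1) + Kc - 1) - 1) (PA l k * (PQ l * PB l k))"
      by (intro short_mult)
    moreover have "Kc \<le> L" using l by (auto simp: L)
    ultimately show "short (card R) (PA l k * (PQ l * PB l k))"
      using Kc by (auto simp: R intro: short_mono)
  qed
  from interp_poly[OF F R(1) dR this, of i]
  have 1: "eqm (ker F) (Y i) (interp g R Y i)" unfolding polyY .
  define l0 where "l0 = i div Kc"
  have l0: "l0 < ell" "i \<in> block Kc l0" "\<And>l. l \<noteq> l0 \<Longrightarrow> i \<notin> block Kc l"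
    using i Kc by (auto simp: l0_def L mem_block_iff less_mult_imp_div_less)
  let ?Q = "coblock_prod g L Kc l0 i"
  have "Y i = (\<Sum>l<ell. if l = l0 then \<Sum>k<kap. interp g (block Kc l0) (\<lambda>i. a i k) i *
      (?Q * interp g (block Kc l0) (\<lambda>i. b i k) i) else 0)"
    unfolding Y_def
  proof (rule sum.cong[OF refl])
    fix l assume "l \<in> {..<ell}"
    have "coblock_prod g L Kc l i = 0" if "l \<noteq> l0"
      unfolding coblock_prod_def by (rule prod_zero) (use l0(3)[OF that] i in auto)
    then show "(\<Sum>k<kap. interp g (block Kc l) (\<lambda>i. a i k) i * (coblock_prod g L Kc l i * interp g (block Kc l) (\<lambda>i. b i k) i))
      = (if l = l0 then \<Sum>k<kap. interp g (block Kc l0) (\<lambda>i. a i k) i * (?Q * interp g (block Kc l0) (\<lambda>i. b i k) i) else 0)"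
      by auto
  qed
  also have "\<dots> = (\<Sum>k<kap. interp g (block Kc l0) (\<lambda>i. a i k) i * (?Q * interp g (block Kc l0) (\<lambda>i. b i k) i))"
    using l0(1) by simp
  finally have 2: "Y i = (\<Sum>k<kap. interp g (block Kc l0) (\<lambda>i. a i k) i * (?Q * interp g (block Kc l0) (\<lambda>i. b i k) i))" .
  have "eqm (ker F) (Y i) (\<Sum>k<kap. a i k * (?Q * b i k))"
    unfolding 2
    by (intro eqm_sum[OF I] eqm_mult[OF I] eqm_refl[OF I] interp_node[OF F fin dB[OF l0(1)]] l0)
  moreover have "(\<Sum>k<kap. a i k * (?Q * b i k)) = ?Q * (\<Sum>k<kap. a i k * b i k)"
    by (simp add: sum_distrib_left mult_ac)
  ultimately have 3: "eqm (ker F) (Y i) (?Q * (\<Sum>k<kap. a i k * b i k))" by simp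
  have "eqm (ker F) (?Q * finv ?Q) 1"
  proof (intro finv_right[OF F] allI)
    show "ev F xs ?Q \<noteq> \<zero>\<^bsub>F\<^esub>" for xs
      unfolding coblock_prod_def
    proof (intro ev_prod_nonzero[OF F] ev_diff_nonzero[OF F])
      fix j assume "j \<in> {..<L} - block Kc l0"
      then show "ev F xs (g ^ i) \<noteq> ev F xs (g ^ j)" using dL[OF i, of j xs] l0(2) by auto
    qed simp
  qed
  from eqm_mult[OF I this eqm_refl[OF I, of "\<Sum>k<kap. a i k * b i k"]]
  have 4: "eqm (ker F) (finv ?Q * (?Q * (\<Sum>k<kap. a i k * b i k))) (\<Sum>k<kap. a i k * b i k)"
    by (simp add: mult_ac)
  have "eqm (ker F) (interp g R Y i) (?Q * (\<Sum>k<kap. a i k * b i k))"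
    by (rule eqm_trans[OF I eqm_sym[OF I 1] 3])
  from eqm_trans[OF I eqm_mult[OF I eqm_refl[OF I] this] 4]
  show ?thesis by (simp only: l0_def)
qed

end

section \<open>The code as formal expressions\<close>

definition enc_exprs :: "'a fam \<Rightarrow> nat \<Rightarrow> nat \<Rightarrow> nat \<Rightarrow> nat \<Rightarrow> (nat \<Rightarrow> nat \<Rightarrow> 'a fam) \<Rightarrow> nat \<Rightarrow> 'a fam list" where
  "enc_exprs g ell Kc m n v s =
     flat ell m n (\<lambda>l p q. v l s * interp g (block Kc l) (\<lambda>i. freg (i * (m * n) + (p * n + q))) s)"

definition ans_exprs :: "nat \<Rightarrow> nat \<Rightarrow> nat \<Rightarrow> nat \<Rightarrow> 'a fam list" where
  "ans_exprs ell lam kap mu = flat 1 lam mu (\<lambda>_ p q. \<Sum>l<ell. \<Sum>k<kap.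
     freg (l * (lam * kap) + (p * kap + k)) * freg (ell * (lam * kap) + (l * (kap * mu) + (k * mu + q))))"

text \<open>The rank of server s in R, which locates its answer in the concatenated input of the
  decoder.\<close>

definition pos :: "nat set \<Rightarrow> nat \<Rightarrow> nat" where
  "pos R s = (SOME i. i < card R \<and> sorted_list_of_set R ! i = s)"

definition dec_expr :: "'a fam \<Rightarrow> nat \<Rightarrow> nat \<Rightarrow> nat \<Rightarrow> nat \<Rightarrow> nat set \<Rightarrow> nat \<Rightarrow> nat \<Rightarrow> nat \<Rightarrow> 'a fam" where
  "dec_expr g L Kc lam mu R i p q = finv (coblock_prod g L Kc (i div Kc) i) *
     interp g R (\<lambda>s. freg (pos R s * (lam * mu) + (p * mu + q))) i"

text \<open>The encoded matrices, answers and results are formal expressions in the inputs, evaluated at the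
  data; hence the complexities are costs of deriving these expressions. Sets of servers of any other
  size than the threshold are decoded to zero, which makes the threshold minimal.\<close>

definition csa_code :: "'a ring \<Rightarrow> 'a fam \<Rightarrow> nat \<Rightarrow> nat \<Rightarrow> nat \<Rightarrow> nat \<Rightarrow> nat \<Rightarrow> 'a cdbmm_code" where
  "csa_code F g lam kap mu ell Kc = \<lparr>
     sizeA = \<lambda>_. ell * (lam * kap), sizeB = \<lambda>_. ell * (kap * mu), sizeY = \<lambda>_. lam * mu,
     encA = \<lambda>s As. map (ev F (batch_entries As)) (enc_exprs g ell Kc lam kap (\<lambda>_ _. 1) s),
     encB = \<lambda>s Bs. map (ev F (batch_entries Bs)) (enc_exprs g ell Kc kap mu (coblock_prod g (ell * Kc) Kc) s),
     ans = \<lambda>_ a b. map (ev F (a @ b)) (ans_exprs ell lam kap mu),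
     dec = \<lambda>R Y. map (\<lambda>i. mat lam mu (\<lambda>(p, q).
       if card R = (ell + 1) * Kc - 1
       then ev F (concat (map Y (sorted_list_of_set R))) (dec_expr g (ell * Kc) Kc lam mu R i p q)
       else \<zero>\<^bsub>F\<^esub>)) [0..<ell * Kc] \<rparr>"

lemma pos_sorted:
  assumes "finite R" "s \<in> R"
  shows "pos R s < card R" "sorted_list_of_set R ! pos R s = s"
proof -
  have "s \<in> set (sorted_list_of_set R)" using assms by simp
  then have "\<exists>i. i < card R \<and> sorted_list_of_set R ! i = s"
    unfolding in_set_conv_nth by (simp add: length_sorted_list_of_set)
  from someI_ex[OF this] show "pos R s < card R" "sorted_list_of_set R ! pos R s = s"
    by (simp_all add: pos_def)
qed

section \<open>Correctness of the code\<close>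

locale csa =
  fixes F :: "'a ring" and lam kap mu S ell Kc :: nat and \<gamma> :: 'a
  assumes F: "field F" and fin: "finite (carrier F)"
    and pos: "lam > 0" "kap > 0" "mu > 0" "S > 0" "ell > 0" "Kc > 0"
    and field_size: "int (ell * Kc) \<le> int (card (carrier F)) - int S"
    and servers: "S \<ge> (ell + 1) * Kc - 1"
    and gamma: "\<gamma> \<in> carrier F" "\<gamma> \<noteq> \<zero>\<^bsub>F\<^esub>"
    and distinct0: "\<And>i j. i < card (carrier F) - 1 \<Longrightarrow> j < card (carrier F) - 1 \<Longrightarrow> \<gamma> [^]\<^bsub>F\<^esub> i = \<gamma> [^]\<^bsub>F\<^esub> j \<Longrightarrow> i = j"
    and distinct1: "\<And>i j. i \<in> {1..card (carrier F) - 1} \<Longrightarrow> j \<in> {1..card (carrier F) - 1} \<Longrightarrow> \<gamma> [^]\<^bsub>F\<^esub> i = \<gamma> [^]\<^bsub>F\<^esub> j \<Longrightarrow> i = j"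
begin

interpretation field F by (rule F)

abbreviation "g \<equiv> fconst F \<gamma>"
abbreviation "L \<equiv> ell * Kc"
abbreviation "R0 \<equiv> (ell + 1) * Kc - 1"
abbreviation "code \<equiv> csa_code F g lam kap mu ell Kc"
abbreviation "entryA As p \<equiv> \<lambda>i k. fconst F (As ! i $$ (p, k))"
abbreviation "entryB Bs q \<equiv> \<lambda>i k. fconst F (Bs ! i $$ (k, q))"

lemma R0_eq: "R0 = L + Kc - 1" and R0_pos: "R0 > 0" and L_pos: "L > 0" and L_le_R0: "L \<le> R0" and Kc_le_S: "Kc \<le> S"
proof -
  show e: "R0 = L + Kc - 1" by simp
  show "L > 0" using pos by simp
  have "Kc \<le> L" using pos by simp
  then show "R0 > 0" "L \<le> R0" "Kc \<le> S" using e pos servers by linarith+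
qed

lemma g_consts: "g \<in> consts_of F"
  by (rule fconst_consts[OF F])

lemma ev_g_power: "ev F xs (g ^ i) = \<gamma> [^]\<^bsub>F\<^esub> i"
  by (simp add: ev_power[OF F] ev_const[OF is_cring] gamma)

lemma g_nonzero: "\<forall>xs. ev F xs g \<noteq> \<zero>\<^bsub>F\<^esub>"
  by (simp add: ev_const[OF is_cring] gamma)

lemma field_size_nat: "L + S \<le> card (carrier F)"
  using field_size by linarith

lemma distinct_data: "i < L \<Longrightarrow> j < L \<Longrightarrow> i \<noteq> j \<Longrightarrow> ev F xs (g ^ i) \<noteq> ev F xs (g ^ j)"
proof
  assume ij: "i < L" "j < L" "i \<noteq> j" and "ev F xs (g ^ i) = ev F xs (g ^ j)"
  then have "\<gamma> [^]\<^bsub>F\<^esub> i = \<gamma> [^]\<^bsub>F\<^esub> j" by (simp only: ev_g_power)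
  then have "i = j" by (rule distinct0[rotated 2]) (use ij field_size_nat pos(4) in linarith)+
  with ij show False by simp
qed

lemma distinct_servers: "i \<in> {1..S} \<Longrightarrow> j \<in> {1..S} \<Longrightarrow> i \<noteq> j \<Longrightarrow> ev F xs (g ^ i) \<noteq> ev F xs (g ^ j)"
proof
  assume ij: "i \<in> {1..S}" "j \<in> {1..S}" "i \<noteq> j" and "ev F xs (g ^ i) = ev F xs (g ^ j)"
  then have "\<gamma> [^]\<^bsub>F\<^esub> i = \<gamma> [^]\<^bsub>F\<^esub> j" by (simp only: ev_g_power)
  moreover have "S \<le> card (carrier F) - 1" using field_size_nat L_pos by linarith
  then have "i \<in> {1..card (carrier F) - 1}" "j \<in> {1..card (carrier F) - 1}" using ij by auto
  ultimately have "i = j" by (intro distinct1)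
  with ij show False by simp
qed

lemma code_is_cdbmm_code: "is_cdbmm_code F S L lam kap mu code"
proof -
  have dec: "dec code R Y \<in> batches F L lam mu" for R Y
    by (auto simp: csa_code_def batches_def elements_mat_def ev_closed[OF is_cring])
  show ?thesis
    unfolding is_cdbmm_code_def
    using dec by (auto simp: csa_code_def tuples_def enc_exprs_def ans_exprs_def length_flat ev_closed[OF is_cring])
qed

lemma ev_batch_entry:
  assumes "As \<in> batches F L m n" "i < L" "p < m" "q < n"
  shows "ev F (batch_entries As) (freg (i * (m * n) + (p * n + q))) = As ! i $$ (p, q)"
proof -
  let ?j = "i * (m * n) + (p * n + q)"
  have j: "?j < length (batch_entries As)"
    using flat_index[OF assms(2) flat_index[OF assms(3,4)]] by (simp add: batch_entries_batch[OF assms(1)] length_flat)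
  have nth: "batch_entries As ! ?j = As ! i $$ (p, q)"
    using nth_flat[OF assms(2-4)] by (simp add: batch_entries_batch[OF assms(1)])
  show ?thesis
    using ev_reg[OF is_cring j] batch_nth_carrier[OF assms] unfolding nth .
qed

text \<open>Replaces the registers holding the data by constants. A, B and the answers are read from
  different input tuples, and this brings them to the common empty tuple, where
  \<open>interp_answers\<close> applies.\<close>

lemma ev_enc:
  assumes As: "As \<in> batches F L m n" and l: "l < ell" "p < m" "q < n" and v: "v l s \<in> consts_of F"
  shows "map (ev F (batch_entries As)) (enc_exprs g ell Kc m n v s) ! (l * (m * n) + (p * n + q)) =
    ev F [] (v l s * interp g (block Kc l) (\<lambda>i. fconst F (As ! i $$ (p, q))) s)"
proof -
  have "map (ev F (batch_entries As)) (enc_exprs g ell Kc m n v s) ! (l * (m * n) + (p * n + q)) =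
      ev F (batch_entries As) (v l s * interp g (block Kc l) (\<lambda>i. freg (i * (m * n) + (p * n + q))) s)"
    unfolding enc_exprs_def map_flat by (rule nth_flat[OF l])
  also have "\<dots> = ev F [] (v l s * interp g (block Kc l) (\<lambda>i. fconst F (As ! i $$ (p, q))) s)"
  proof (intro ev_mult_cong[OF F] ev_consts[OF F v] ev_interp_cong[OF F g_consts])
    fix i assume "i \<in> block Kc l"
    then have i: "i < L" using block_subset[OF l(1), of Kc] by auto
    show "ev F (batch_entries As) (freg (i * (m * n) + (p * n + q))) = ev F [] (fconst F (As ! i $$ (p, q)))"
      by (simp add: ev_batch_entry[OF As i l(2,3)] ev_const[OF is_cring] batch_nth_carrier[OF As i l(2,3)])
  qed
  finally show ?thesis .
qed

lemma enc_tuples: "map (ev F xs) (enc_exprs g ell Kc m n v s) \<in> tuples F (ell * (m * n))"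
  by (auto simp: tuples_def enc_exprs_def length_flat ev_closed[OF is_cring])

lemma answer_nth:
  assumes As: "As \<in> batches F L lam kap" and Bs: "Bs \<in> batches F L kap mu" and p: "p < lam" and q: "q < mu"
  shows "answer code As Bs s ! (p * mu + q) = ev F [] (\<Sum>l<ell. \<Sum>k<kap.
    interp g (block Kc l) (\<lambda>i. entryA As p i k) s *
    (coblock_prod g L Kc l s * interp g (block Kc l) (\<lambda>i. entryB Bs q i k) s))"
proof -
  define a b where "a = encA code s As" and "b = encB code s Bs"
  have a: "a = map (ev F (batch_entries As)) (enc_exprs g ell Kc lam kap (\<lambda>_ _. 1) s)"
    and b: "b = map (ev F (batch_entries Bs)) (enc_exprs g ell Kc kap mu (coblock_prod g L Kc) s)"
    by (simp_all add: a_def b_def csa_code_def)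
  have at: "length a = ell * (lam * kap)" "set a \<subseteq> carrier F" and bt: "length b = ell * (kap * mu)" "set b \<subseteq> carrier F"
    using enc_tuples unfolding a b tuples_def by auto
  have "answer code As Bs s ! (0 * (lam * mu) + (p * mu + q)) = ev F (a @ b) (\<Sum>l<ell. \<Sum>k<kap.
     freg (l * (lam * kap) + (p * kap + k)) * freg (ell * (lam * kap) + (l * (kap * mu) + (k * mu + q))))"
    unfolding answer_def a_def[symmetric] b_def[symmetric]
    by (simp add: csa_code_def ans_exprs_def map_flat) (use nth_flat[of 0 1 p lam q mu] p q in simp)
  also have "\<dots> = ev F [] (\<Sum>l<ell. \<Sum>k<kap.
    interp g (block Kc l) (\<lambda>i. entryA As p i k) s *
    (coblock_prod g L Kc l s * interp g (block Kc l) (\<lambda>i. entryB Bs q i k) s))"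
  proof (intro ev_sum_cong[OF F] ev_mult_cong[OF F])
    fix l k assume lk: "l \<in> {..<ell}" "k \<in> {..<kap}"
    let ?i = "l * (lam * kap) + (p * kap + k)" and ?j = "l * (kap * mu) + (k * mu + q)"
    have i: "?i < length a" using lk p by (simp add: at flat_index)
    have j: "?j < length b" using lk q by (simp add: bt flat_index)
    have "ev F (a @ b) (freg ?i) = a ! ?i"
      using i at(2) by (subst ev_reg[OF is_cring]) (auto simp: nth_append)
    also have "\<dots> = ev F [] (interp g (block Kc l) (\<lambda>i. entryA As p i k) s)"
      using ev_enc[OF As, of l p k "\<lambda>_ _. 1" s] lk p const_ring_1[OF const_ring_consts[OF F]] unfolding a by simp
    finally show "ev F (a @ b) (freg ?i) = ev F [] (interp g (block Kc l) (\<lambda>i. entryA As p i k) s)" .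
    have "ev F (a @ b) (freg (ell * (lam * kap) + ?j)) = b ! ?j"
      using j bt(2) at(1) by (subst ev_reg[OF is_cring]) (auto simp: nth_append)
    also have "\<dots> = ev F [] (coblock_prod g L Kc l s * interp g (block Kc l) (\<lambda>i. entryB Bs q i k) s)"
      using ev_enc[OF Bs, of l k q "coblock_prod g L Kc" s] lk q coblock_prod_consts[OF F g_consts] unfolding b by simp
    finally show "ev F (a @ b) (freg (ell * (lam * kap) + ?j)) =
        ev F [] (coblock_prod g L Kc l s * interp g (block Kc l) (\<lambda>i. entryB Bs q i k) s)" .
  qed
  finally show ?thesis by simp
qed

lemma answer_tuples: "answer code As Bs s \<in> tuples F (lam * mu)"
  by (auto simp: answer_def csa_code_def ans_exprs_def tuples_def length_flat ev_closed[OF is_cring])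

lemma ev_answer_entry:
  assumes Y: "\<And>s. s \<in> R \<Longrightarrow> Y s \<in> tuples F (lam * mu)" and R: "finite R" "s \<in> R" and p: "p < lam" and q: "q < mu"
  shows "ev F (concat (map Y (sorted_list_of_set R))) (freg (pos R s * (lam * mu) + (p * mu + q))) = Y s ! (p * mu + q)"
proof -
  let ?l = "sorted_list_of_set R"
  have len: "length (Y x) = lam * mu" if "x \<in> set ?l" for x using Y that R by (simp add: tuples_def)
  have "concat (map Y ?l) ! (pos R s * (lam * mu) + (p * mu + q)) = Y (?l ! pos R s) ! (p * mu + q)"
    by (rule nth_concat_uniform[OF len]) (use pos_sorted[OF R] flat_index[OF p q] in \<open>auto simp: length_sorted_list_of_set\<close>)
  then have nth: "concat (map Y ?l) ! (pos R s * (lam * mu) + (p * mu + q)) = Y s ! (p * mu + q)"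
    by (simp add: pos_sorted[OF R])
  have "pos R s * (lam * mu) + (p * mu + q) < length (concat (map Y ?l))"
    using flat_index[OF pos_sorted(1)[OF R] flat_index[OF p q]]
    by (simp add: length_concat_uniform[OF len] length_sorted_list_of_set)
  moreover have "Y s ! (p * mu + q) \<in> carrier F"
    using Y[OF R(2)] flat_index[OF p q] by (auto simp: tuples_def)
  ultimately show ?thesis using ev_reg[OF is_cring] nth by metis
qed

lemma dec_code_nth:
  "i < L \<Longrightarrow> card R = R0 \<Longrightarrow> dec code R Y ! i =
    mat lam mu (\<lambda>(p, q). ev F (concat (map Y (sorted_list_of_set R))) (dec_expr g L Kc lam mu R i p q))"
  by (simp add: csa_code_def)

lemma dec_correct:
  assumes R: "R \<subseteq> {1..S}" "card R = R0" and As: "As \<in> batches F L lam kap" and Bs: "Bs \<in> batches F L kap mu"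
  shows "dec code R (\<lambda>s\<in>R. answer code As Bs s) = batch_mult F As Bs"
proof (rule nth_equalityI)
  have lenA: "length As = L" and lenB: "length Bs = L" using As Bs by (auto simp: batches_def)
  have finR: "finite R" using R(1) finite_subset by blast
  show "length (dec code R (\<lambda>s\<in>R. answer code As Bs s)) = length (batch_mult F As Bs)"
    by (simp add: csa_code_def batch_mult_def lenA lenB)
  fix i assume "i < length (dec code R (\<lambda>s\<in>R. answer code As Bs s))"
  then have i: "i < L" by (simp add: csa_code_def)
  have dimA: "As ! i \<in> carrier_mat lam kap" and dimB: "Bs ! i \<in> carrier_mat kap mu"
    using As Bs i lenA lenB by (auto simp: batches_def)
  let ?Y = "\<lambda>s\<in>R. answer code As Bs s"
  let ?xs = "concat (map ?Y (sorted_list_of_set R))"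
  have entry: "ev F ?xs (dec_expr g L Kc lam mu R i p q) =
      (\<Oplus>\<^bsub>F\<^esub>k\<in>{..<kap}. As ! i $$ (p, k) \<otimes>\<^bsub>F\<^esub> Bs ! i $$ (k, q))" if p: "p < lam" and q: "q < mu" for p q
  proof -
    \<comment> \<open>The formal answers, of the shape required by
      \<open>interp_answers\<close>.\<close>
    let ?V = "\<lambda>s. \<Sum>l<ell. \<Sum>k<kap. interp g (block Kc l) (\<lambda>i. entryA As p i k) s *
        (coblock_prod g L Kc l s * interp g (block Kc l) (\<lambda>i. entryB Bs q i k) s)"
    have "ev F ?xs (dec_expr g L Kc lam mu R i p q) =
        ev F [] (finv (coblock_prod g L Kc (i div Kc) i) * interp g R ?V i)"
      unfolding dec_expr_def
    proof (intro ev_mult_cong[OF F] ev_consts[OF F] finv_consts[OF F] coblock_prod_consts[OF F]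
        g_consts ev_interp_cong[OF F g_consts])
      fix s assume s: "s \<in> R"
      have "ev F ?xs (freg (pos R s * (lam * mu) + (p * mu + q))) = ?Y s ! (p * mu + q)"
        by (rule ev_answer_entry[OF _ finR s p q]) (simp add: answer_tuples)
      also have "\<dots> = ev F [] (?V s)" using answer_nth[OF As Bs p q] s by simp
      finally show "ev F ?xs (freg (pos R s * (lam * mu) + (p * mu + q))) = ev F [] (?V s)" .
    qed
    also have "\<dots> = ev F [] (\<Sum>k<kap. entryA As p i k * entryB Bs q i k)"
    proof -
      have "eqm (ker F) (finv (coblock_prod g L Kc (i div Kc) i) * interp g R ?V i) (\<Sum>k<kap. entryA As p i k * entryB Bs q i k)"
        by (rule interp_answers[OF F refl pos(6) finR R(2)[unfolded R0_eq] i distinct_data distinct_servers])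
          (use R(1) in auto)
      then show ?thesis by (simp add: eqm_ker[OF F])
    qed
    also have "\<dots> = (\<Oplus>\<^bsub>F\<^esub>k\<in>{..<kap}. As ! i $$ (p, k) \<otimes>\<^bsub>F\<^esub> Bs ! i $$ (k, q))"
      unfolding ev_sum[OF F finite_lessThan]
      by (intro finsum_cong' refl)
        (auto simp: ev_mult[OF is_cring] ev_const[OF is_cring] batch_nth_carrier[OF As i p] batch_nth_carrier[OF Bs i _ q])
    finally show ?thesis .
  qed
  have "dec code R ?Y ! i = mat lam mu (\<lambda>(p, q). \<Oplus>\<^bsub>F\<^esub>k\<in>{..<kap}. As ! i $$ (p, k) \<otimes>\<^bsub>F\<^esub> Bs ! i $$ (k, q))"
    unfolding dec_code_nth[OF i R(2)] by (intro eq_matI) (simp_all add: entry)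
  also have "\<dots> = batch_mult F As Bs ! i"
    using dimA dimB i lenA lenB by (simp add: batch_mult_def mat_mult_def)
  finally show "dec code R ?Y ! i = batch_mult F As Bs ! i" .
qed

text \<open>There is a set of r servers, and it is decoded to zero. The matrices with a single 1 in
  the top left corner have a nonzero product.\<close>

lemma not_recoverable_below: 
  assumes "r < R0"
  shows "\<not> recoverable F S L lam kap mu code r"
proof
  assume rec: "recoverable F S L lam kap mu code r"
  obtain R where R: "R \<subseteq> {1..S}" "card R = r"
    using obtain_subset_with_card_n[of r "{1..S}"] assms servers by auto
  define U where "U m n = replicate L (mat m n (\<lambda>(p, q). if p = 0 \<and> q = 0 then \<one>\<^bsub>F\<^esub> else \<zero>\<^bsub>F\<^esub>))" for m n :: nat
  have U: "U m n \<in> batches F L m n" for m n by (auto simp: U_def batches_def elements_mat_def)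
  have "dec code R (\<lambda>s\<in>R. answer code (U lam kap) (U kap mu) s) = batch_mult F (U lam kap) (U kap mu)"
    using rec R U unfolding recoverable_def by blast
  then have "dec code R (\<lambda>s\<in>R. answer code (U lam kap) (U kap mu) s) ! 0 $$ (0, 0) = batch_mult F (U lam kap) (U kap mu) ! 0 $$ (0, 0)"
    by simp
  moreover have "dec code R (\<lambda>s\<in>R. answer code (U lam kap) (U kap mu) s) ! 0 $$ (0, 0) = \<zero>\<^bsub>F\<^esub>"
    using R(2) assms L_pos pos by (simp add: csa_code_def)
  moreover have "batch_mult F (U lam kap) (U kap mu) ! 0 $$ (0, 0) =
      (\<Oplus>\<^bsub>F\<^esub>k\<in>{..<kap}. if 0 = k then \<one>\<^bsub>F\<^esub> else \<zero>\<^bsub>F\<^esub>)"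
    using L_pos pos by (auto simp: batch_mult_def mat_mult_def U_def intro!: finsum_cong')
  moreover have "\<dots> = \<one>\<^bsub>F\<^esub>"
    using pos by (intro add.finprod_singleton) auto
  ultimately show False by simp
qed

lemma recovery_threshold_code: "recovery_threshold F S L lam kap mu code = R0"
  unfolding recovery_threshold_def
proof (rule Least_equality)
  show "recoverable F S L lam kap mu code R0"
    unfolding recoverable_def using dec_correct by blast
  show "R0 \<le> r" if "recoverable F S L lam kap mu code r" for r
    using not_recoverable_below[of r] that by (cases "r < R0") auto
qed

lemma threshold_sets_code: "threshold_sets F S L lam kap mu code = {R. R \<subseteq> {1..S} \<and> card R = R0}"
  by (simp add: threshold_sets_def recovery_threshold_code)

section \<open>Costs and complexities\<close>

lemma upload_costs:
  "upload_cost_A S L lam kap code = real S / real Kc" "upload_cost_B S L kap mu code = real S / real Kc"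
  using pos by (simp_all add: upload_cost_A_def upload_cost_B_def csa_code_def field_simps)

lemma download_cost_code:
  "download_cost F S L lam kap mu code = (real (ell + 1) * real Kc - 1) / (real ell * real Kc)"
proof -
  let ?d = "(real (ell + 1) * real Kc - 1) / (real ell * real Kc)"
  have "real (\<Sum>s\<in>R. sizeY code s) / real (L * lam * mu) = ?d" if "R \<in> threshold_sets F S L lam kap mu code" for R
  proof -
    have "card R = R0" using that by (simp add: threshold_sets_code)
    then have "real (\<Sum>s\<in>R. sizeY code s) = real R0 * real (lam * mu)"
      by (simp add: csa_code_def)
    moreover have "real R0 = real (ell + 1) * real Kc - 1"
      using R0_pos by (subst of_nat_diff) (auto simp: algebra_simps)
    ultimately show ?thesis using pos by simp
  qed
  moreover obtain R where "R \<subseteq> {1..S}" "card R = R0"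
    using obtain_subset_with_card_n[of R0 "{1..S}"] servers by auto
  then have "threshold_sets F S L lam kap mu code \<noteq> {}" by (auto simp: threshold_sets_code)
  ultimately have "(\<lambda>R. real (\<Sum>s\<in>R. sizeY code s) / real (L * lam * mu)) ` threshold_sets F S L lam kap mu code = {?d}"
    by auto
  then show ?thesis unfolding download_cost_def by simp
qed

lemma server_complexity_code:
  "server_complexity F L code s \<le> ereal (3 * (real (lam * kap * mu) / real Kc))"
proof -
  let ?n = "ell * (lam * kap) + ell * (kap * mu)"
  let ?C = "consts_of F \<union> freg ` {..<?n}"
  have "arith_complexity F (tuples F (ell * (lam * kap)) \<times> tuples F (ell * (kap * mu)))
      (\<lambda>(a, b). a @ b) (\<lambda>(a, b). map (ev F (a @ b)) (ans_exprs ell lam kap mu))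
      \<le> ereal (real (3 * ((lam * mu) * (ell * kap))))"
  proof (rule arith_complexity_le[OF F order_refl])
    show "derives (ker F) ?C (freg ` {..<?n}) ((lam * mu) * (ell * kap)) (set (ans_exprs ell lam kap mu))"
    proof (rule derives_sums[OF ring_ideal_ker[OF F]])
      show "1 \<in> ?C" using const_ring_1[OF const_ring_consts[OF F]] by simp
      show "card (set (ans_exprs ell lam kap mu :: 'a fam list)) \<le> lam * mu"
        using card_length[of "ans_exprs ell lam kap mu :: 'a fam list"] by (simp add: ans_exprs_def length_flat)
      fix w :: "'a fam" assume "w \<in> set (ans_exprs ell lam kap mu)"
      then obtain p q where pq: "p < lam" "q < mu" and w: "w = (\<Sum>l<ell. \<Sum>k<kap.
          freg (l * (lam * kap) + (p * kap + k)) * freg (ell * (lam * kap) + (l * (kap * mu) + (k * mu + q))))"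
        by (auto simp: ans_exprs_def set_flat lessThan_Suc)
      let ?c = "\<lambda>(l, k). freg (l * (lam * kap) + (p * kap + k))"
      let ?u = "\<lambda>(l, k). freg (ell * (lam * kap) + (l * (kap * mu) + (k * mu + q)))"
      have "w = (\<Sum>x\<in>{..<ell} \<times> {..<kap}. ?c x * ?u x)"
        unfolding w sum.cartesian_product' by simp
      then have e: "eqm (ker F) w (\<Sum>x\<in>{..<ell} \<times> {..<kap}. ?c x * ?u x)"
        by (simp only: eqm_refl[OF ring_ideal_ker[OF F]])
      have "?c ` ({..<ell} \<times> {..<kap}) \<subseteq> freg ` {..<?n}"
        using pq by (auto intro!: imageI trans_less_add1 flat_index)
      then have c: "?c ` ({..<ell} \<times> {..<kap}) \<subseteq> ?C" by (rule le_supI2)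
      have "?u ` ({..<ell} \<times> {..<kap}) \<subseteq> freg ` {..<?n}"
        using pq by (auto intro!: imageI flat_index)
      then have u: "?u ` ({..<ell} \<times> {..<kap}) \<subseteq> insert 0 (freg ` {..<?n})" by (rule subset_insertI2)
      show "\<exists>A c u. finite A \<and> card A \<le> ell * kap \<and> c ` A \<subseteq> ?C \<and> u ` A \<subseteq> insert 0 (freg ` {..<?n}) \<and>
          eqm (ker F) w (\<Sum>i\<in>(A::(nat \<times> nat) set). c i * u i)"
      proof (intro exI conjI)
        show "eqm (ker F) w (\<Sum>x\<in>{..<ell} \<times> {..<kap}. ?c x * ?u x)" by (rule e)
        show "?c ` ({..<ell} \<times> {..<kap}) \<subseteq> ?C" by (rule c)
        show "?u ` ({..<ell} \<times> {..<kap}) \<subseteq> insert 0 (freg ` {..<?n})" by (rule u)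
      qed simp_all
    qed simp
  qed (auto simp: tuples_def)
  then have "server_complexity F L code s \<le> ereal (real (3 * ((lam * mu) * (ell * kap)))) / ereal (real L)"
    unfolding server_complexity_def using pos
    by (intro ereal_divide_right_mono) (simp_all add: csa_code_def)
  also have "\<dots> = ereal (3 * (real (lam * kap * mu) / real Kc))"
    using pos by (simp add: field_simps)
  finally show ?thesis .
qed

lemma interp_cost_code:
  assumes b: "b \<ge> 1"
  shows "\<exists>T. real T \<le> 10368408 * O_tilde F (real b) b \<and> (\<forall>A y w E. finite A \<longrightarrow> card A \<le> b \<longrightarrow>
      (\<forall>e. w e \<in> consts_of F) \<longrightarrow> E \<subseteq> {..b} \<longrightarrow> (b = 1 \<longrightarrow> (\<forall>e\<in>E. eqm (ker F) (w e) 1)) \<longrightarrow>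
      derives (ker F) (consts_of F) (y ` A) T ((\<lambda>e. w e * interp g A y e) ` E))"
proof -
  from interp_cost[OF F b] obtain T where T: "real T \<le> 10368408 * O_tilde F (real b) b"
    and der: "\<forall>g A y v E. g \<in> consts_of F \<longrightarrow> (\<forall>xs. ev F xs g \<noteq> \<zero>\<^bsub>F\<^esub>) \<longrightarrow> finite A \<longrightarrow> card A \<le> b \<longrightarrow>
      (\<forall>e. v e \<in> consts_of F) \<longrightarrow> E \<subseteq> {..b} \<longrightarrow> (b = 1 \<longrightarrow> (\<forall>e\<in>E. eqm (ker F) (v e) 1)) \<longrightarrow>
      derives (ker F) (consts_of F) (y ` A) T ((\<lambda>e. v e * interp g A y e) ` E)"
    by (elim exE conjE)
  show ?thesis
    by (rule exI[of _ T], rule conjI[OF T], intro allI,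
        rule der[THEN spec[of _ g], THEN spec, THEN spec, THEN spec, THEN spec, THEN mp[OF _ g_consts], THEN mp[OF _ g_nonzero]])
qed

text \<open>For each block and each matrix entry, one interpolation takes the Kc values of the block
  to all S servers; it is charged at size S, as Kc is at most S. Of these \<open>ell * m * n\<close>
  maps, division by L leaves \<open>m * n / Kc\<close>. The constant is three times that of
  \<open>interp_cost\<close>.\<close>

lemma enc_complexity:
  assumes mn: "m > 0" "n > 0" and v: "\<And>l e. v l e \<in> consts_of F" and v1: "\<And>l e. S = 1 \<Longrightarrow> l < ell \<Longrightarrow> eqm (ker F) (v l e) 1"
  shows "arith_complexity F (batches F L m n) batch_entries
      (\<lambda>As. concat (map (\<lambda>s. map (ev F (batch_entries As)) (enc_exprs g ell Kc m n v s)) [1..<Suc S])) / ereal (real L)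
    \<le> ereal (31105224 * O_tilde F (real (m * n * S) / real Kc) S)"
proof -
  note I = ring_ideal_ker[OF F]
  have "S \<ge> 1" using pos(4) by simp
  from interp_cost_code[OF this] obtain T where T: "real T \<le> 10368408 * O_tilde F (real S) S"
    and der': "\<forall>A y w E. finite A \<longrightarrow> card A \<le> S \<longrightarrow>
      (\<forall>e. w e \<in> consts_of F) \<longrightarrow> E \<subseteq> {..S} \<longrightarrow> (S = 1 \<longrightarrow> (\<forall>e\<in>E. eqm (ker F) (w e) 1)) \<longrightarrow>
      derives (ker F) (consts_of F) (y ` A) T ((\<lambda>e. w e * interp g A y e) ` E)"
    by (elim exE conjE)
  note der = der'[THEN spec, THEN spec, THEN spec, THEN spec, THEN mp, THEN mp, THEN mp, THEN mp, THEN mp]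
  let ?ws = "concat (map (enc_exprs g ell Kc m n v) [1..<Suc S])"
  let ?y = "\<lambda>p q i. freg (i * (m * n) + (p * n + q)) :: 'a fam"
  let ?X = "{..<ell} \<times> {..<m} \<times> {..<n}"
  have "derives (ker F) (consts_of F) (freg ` {..<L * (m * n)}) (ell * (m * n) * T)
      (\<Union>x\<in>?X. (\<lambda>(l, p, q). (\<lambda>e. v l e * interp g (block Kc l) (?y p q) e) ` {1..S}) x)"
  proof (rule derives_UN_card[OF I])
    fix x assume "x \<in> ?X"
    then obtain l p q where x: "x = (l, p, q)" "l < ell" "p < m" "q < n" by auto
    have "derives (ker F) (consts_of F) (?y p q ` block Kc l) T ((\<lambda>e. v l e * interp g (block Kc l) (?y p q) e) ` {1..S})"
      by (rule der) (use v v1 x(2) Kc_le_S in \<open>auto simp: block_def\<close>)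
    moreover have "?y p q ` block Kc l \<subseteq> freg ` {..<L * (m * n)}"
      using block_subset[OF x(2), of Kc] x by (auto intro!: imageI flat_index)
    ultimately show "derives (ker F) (consts_of F) (freg ` {..<L * (m * n)}) T
        ((\<lambda>(l, p, q). (\<lambda>e. v l e * interp g (block Kc l) (?y p q) e) ` {1..S}) x)"
      unfolding x(1) prod.case by (rule derives_subset_known[OF I])
  qed (simp_all add: card_cartesian_product)
  then have "derives (ker F) (consts_of F) (freg ` {..<L * (m * n)}) (ell * (m * n) * T) (set ?ws)"
  proof (rule derives_sub, intro subsetI)
    fix w assume "w \<in> set ?ws"
    then have "w \<in> (\<Union>s\<in>{1..S}. set (enc_exprs g ell Kc m n v s))"
      by (simp only: set_concat set_map image_image set_upt atLeastLessThanSuc_atLeastAtMost)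
    then obtain s where s: "s \<in> {1..S}" "w \<in> set (enc_exprs g ell Kc m n v s)" by (rule UN_E)
    then obtain l p q where "l < ell" "p < m" "q < n" "w = v l s * interp g (block Kc l) (?y p q) s"
      by (auto simp: enc_exprs_def set_flat)
    with s(1) show "w \<in> (\<Union>x\<in>?X. (\<lambda>(l, p, q). (\<lambda>e. v l e * interp g (block Kc l) (?y p q) e) ` {1..S}) x)"
      by (intro UN_I[of "(l, p, q)"]) auto
  qed
  then have "arith_complexity F (batches F L m n) batch_entries
      (\<lambda>As. concat (map (\<lambda>s. map (ev F (batch_entries As)) (enc_exprs g ell Kc m n v s)) [1..<Suc S]))
    \<le> ereal (real (3 * (ell * (m * n) * T)))"
    by (rule arith_complexity_le[OF F Un_upper1, where ws = ?ws and n = "L * (m * n)"])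
      (simp_all add: batch_entries_tuples map_concat comp_def)
  then have "arith_complexity F (batches F L m n) batch_entries
      (\<lambda>As. concat (map (\<lambda>s. map (ev F (batch_entries As)) (enc_exprs g ell Kc m n v s)) [1..<Suc S])) / ereal (real L)
    \<le> ereal (real (3 * (ell * (m * n) * T))) / ereal (real L)"
    using L_pos by (intro ereal_divide_right_mono) auto
  also have "\<dots> = ereal (3 * (real (m * n) / real Kc) * real T)"
    using pos by (simp add: field_simps)
  also have "\<dots> \<le> ereal (3 * (real (m * n) / real Kc) * (10368408 * O_tilde F (real S) S))"
    unfolding ereal_less_eq(3) by (intro mult_left_mono T) simp
  also have "\<dots> = ereal (31105224 * O_tilde F (real (m * n * S) / real Kc) S)"
    by (simp add: O_tilde_alt)
  finally show ?thesis .
qed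

lemma encoding_complexities:
  "encoding_complexity_A F S L lam kap code \<le> ereal (31105224 * O_tilde F (real (lam * kap * S) / real Kc) S)"
  "encoding_complexity_B F S L kap mu code \<le> ereal (31105224 * O_tilde F (real (kap * mu * S) / real Kc) S)"
proof -
  note I = ring_ideal_ker[OF F]
  show "encoding_complexity_A F S L lam kap code \<le> ereal (31105224 * O_tilde F (real (lam * kap * S) / real Kc) S)"
    using enc_complexity[OF pos(1,2), of "\<lambda>_ _. 1"] const_ring_1[OF const_ring_consts[OF F]] eqm_refl[OF I]
    by (simp add: encoding_complexity_A_def csa_code_def)
  \<comment> \<open>A single server forces \<open>L = 1\<close>, so the product is empty and the
    weight costs nothing, as the bound 0 demands.\<close>
  have "eqm (ker F) (coblock_prod g L Kc l e) 1" if "S = 1" "l < ell" for l e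
  proof -
    have "L = 1" using L_le_R0 servers that(1) L_pos by linarith
    then have "ell = 1" "Kc = 1" by simp_all
    then show ?thesis using that by (simp add: coblock_prod_def block_def eqm_refl[OF I] lessThan_Suc)
  qed
  then show "encoding_complexity_B F S L kap mu code \<le> ereal (31105224 * O_tilde F (real (kap * mu * S) / real Kc) S)"
    using enc_complexity[OF pos(2,3), of "coblock_prod g L Kc"] coblock_prod_consts[OF F g_consts]
    by (simp add: encoding_complexity_B_def csa_code_def)
qed

text \<open>For each of the \<open>lam * mu\<close> entries, one interpolation takes the R0 answers
  to all L data points. Normalizing by L leaves the ratio \<open>R0 / L\<close>, which is below 2
  and doubles the constant.\<close>

lemma decoding_complexity_code:
  "decoding_complexity F S L lam kap mu code \<le> ereal (62210448 * O_tilde F (real (lam * mu)) R0)"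
  unfolding decoding_complexity_def
proof (rule SUP_least)
  note I = ring_ideal_ker[OF F]
  fix R assume "R \<in> threshold_sets F S L lam kap mu code"
  then have R: "R \<subseteq> {1..S}" "card R = R0" and finR: "finite R"
    using finite_subset by (auto simp: threshold_sets_code)
  have "R0 \<ge> 1" using R0_pos by simp
  from interp_cost_code[OF this] obtain T where T: "real T \<le> 10368408 * O_tilde F (real R0) R0"
    and der': "\<forall>A y w E. finite A \<longrightarrow> card A \<le> R0 \<longrightarrow>
      (\<forall>e. w e \<in> consts_of F) \<longrightarrow> E \<subseteq> {..R0} \<longrightarrow> (R0 = 1 \<longrightarrow> (\<forall>e\<in>E. eqm (ker F) (w e) 1)) \<longrightarrow>
      derives (ker F) (consts_of F) (y ` A) T ((\<lambda>e. w e * interp g A y e) ` E)"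
    by (elim exE conjE)
  note der = der'[THEN spec, THEN spec, THEN spec, THEN spec, THEN mp, THEN mp, THEN mp, THEN mp, THEN mp]
  let ?ws = "flat L lam mu (dec_expr g L Kc lam mu R)"
  let ?in = "\<lambda>Y. concat (map Y (sorted_list_of_set R))"
  let ?y = "\<lambda>p q s. freg (pos R s * (lam * mu) + (p * mu + q)) :: 'a fam"
  let ?v = "\<lambda>i. finv (coblock_prod g L Kc (i div Kc) i)"
  \<comment> \<open>Threshold 1 means one data point and an empty product, so the only weight is 1
    and decoding is a copy.\<close>
  have v1: "eqm (ker F) (?v e) 1" if "R0 = 1" "e < L" for e
  proof -
    have "L = 1" using L_le_R0 that(1) L_pos by linarith
    then have "ell = 1" "Kc = 1" "e = 0" using that(2) by simp_all
    moreover have "eqm (ker F) (1 * finv 1) 1"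
      by (intro finv_right[OF F] allI) (simp add: ev_1[OF is_cring])
    ultimately show ?thesis by (simp add: coblock_prod_def block_def lessThan_Suc)
  qed
  have "derives (ker F) (consts_of F) (freg ` {..<R0 * (lam * mu)}) (lam * mu * T)
      (\<Union>x\<in>{..<lam} \<times> {..<mu}. (\<lambda>(p, q). (\<lambda>e. ?v e * interp g R (?y p q) e) ` {..<L}) x)"
  proof (rule derives_UN_card[OF I])
    fix x assume "x \<in> {..<lam} \<times> {..<mu}"
    then obtain p q where x: "x = (p, q)" "p < lam" "q < mu" by auto
    have "derives (ker F) (consts_of F) (?y p q ` R) T ((\<lambda>e. ?v e * interp g R (?y p q) e) ` {..<L})"
    proof (rule der[OF finR])
      show "\<forall>e. ?v e \<in> consts_of F" by (intro allI finv_consts[OF F] coblock_prod_consts[OF F] g_consts)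
      show "{..<L} \<subseteq> {..R0}" using L_le_R0 by auto
      show "R0 = 1 \<longrightarrow> (\<forall>e\<in>{..<L}. eqm (ker F) (?v e) 1)" using v1 by simp
    qed (simp add: R(2))
    moreover have "?y p q ` R \<subseteq> freg ` {..<R0 * (lam * mu)}"
      using pos_sorted(1)[OF finR] R(2) x by (auto intro!: imageI flat_index)
    ultimately show "derives (ker F) (consts_of F) (freg ` {..<R0 * (lam * mu)}) T
        ((\<lambda>(p, q). (\<lambda>e. ?v e * interp g R (?y p q) e) ` {..<L}) x)"
      unfolding x(1) prod.case by (rule derives_subset_known[OF I])
  qed (simp_all add: card_cartesian_product)
  then have "derives (ker F) (consts_of F) (freg ` {..<R0 * (lam * mu)}) (lam * mu * T) (set ?ws)"
  proof (rule derives_sub, intro subsetI)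
    fix w assume "w \<in> set ?ws"
    then obtain i p q where "i < L" "p < lam" "q < mu" "w = ?v i * interp g R (?y p q) i"
      by (auto simp: dec_expr_def set_flat)
    then show "w \<in> (\<Union>x\<in>{..<lam} \<times> {..<mu}. (\<lambda>(p, q). (\<lambda>e. ?v e * interp g R (?y p q) e) ` {..<L}) x)"
      by (intro UN_I[of "(p, q)"]) auto
  qed
  then have "arith_complexity F (\<Pi>\<^sub>E s\<in>R. tuples F (sizeY code s)) ?in (\<lambda>Y. batch_entries (dec code R Y))
      \<le> ereal (real (3 * (lam * mu * T)))"
  proof (rule arith_complexity_le[OF F, rotated])
    fix Y assume "Y \<in> (\<Pi>\<^sub>E s\<in>R. tuples F (sizeY code s))"
    then have Y: "Y s \<in> tuples F (lam * mu)" if "s \<in> R" for s using that by (auto simp: csa_code_def)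
    have len: "length (Y x) = lam * mu" if "x \<in> set (sorted_list_of_set R)" for x
      using Y that finR by (simp add: tuples_def)
    have "length (?in Y) = length (sorted_list_of_set R) * (lam * mu)"
      by (rule length_concat_uniform[OF len])
    moreover have "set (?in Y) \<subseteq> carrier F" using Y finR by (auto simp: tuples_def)
    ultimately have "?in Y \<in> tuples F (R0 * (lam * mu))"
      by (simp only: tuples_def mem_Collect_eq length_sorted_list_of_set R(2))
    moreover have "batch_entries (dec code R Y) = map (ev F (?in Y)) ?ws"
    proof -
      have "batch_entries (dec code R Y) = flat L lam mu (\<lambda>i p q. dec code R Y ! i $$ (p, q))"
        by (rule batch_entries_flat) (auto simp: csa_code_def)
      also have "\<dots> = flat L lam mu (\<lambda>i p q. ev F (?in Y) (dec_expr g L Kc lam mu R i p q))"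
        by (rule flat_cong) (use R(2) in \<open>simp add: csa_code_def\<close>)
      finally show ?thesis by (simp add: map_flat)
    qed
    ultimately show "?in Y \<in> tuples F (R0 * (lam * mu)) \<and> batch_entries (dec code R Y) = map (ev F (?in Y)) ?ws" by simp
  qed auto
  then have "arith_complexity F (\<Pi>\<^sub>E s\<in>R. tuples F (sizeY code s)) ?in (\<lambda>Y. batch_entries (dec code R Y)) / ereal (real L)
      \<le> ereal (real (3 * (lam * mu * T))) / ereal (real L)"
    using L_pos by (intro ereal_divide_right_mono) auto
  also have "\<dots> = ereal (3 * real (lam * mu) / real L * real T)"
    using pos by simp
  also have "\<dots> \<le> ereal (3 * real (lam * mu) / real L * (10368408 * O_tilde F (real R0) R0))"
    unfolding ereal_less_eq(3) by (intro mult_left_mono T) simp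
  also have "\<dots> = ereal (31105224 * (real R0 / real L) * O_tilde F (real (lam * mu)) R0)"
    by (simp add: O_tilde_alt)
  also have "\<dots> \<le> ereal (31105224 * 2 * O_tilde F (real (lam * mu)) R0)"
  proof -
    have "Kc \<le> L" using pos by simp
    then have "R0 \<le> 2 * L" unfolding R0_eq by linarith
    then have "real R0 \<le> 2 * real L" by (metis of_nat_le_iff of_nat_mult of_nat_numeral)
    then have "real R0 / real L \<le> 2" using L_pos by (subst pos_divide_le_eq) auto
    moreover have "0 \<le> O_tilde F (real (lam * mu)) R0"
      using fft_factor_ge_1[of F R0] by (simp add: O_tilde_alt)
    ultimately show ?thesis unfolding ereal_less_eq(3) by (intro mult_right_mono mult_left_mono) auto
  qed
  finally show "arith_complexity F (\<Pi>\<^sub>E s\<in>R. tuples F (sizeY code s)) ?in (\<lambda>Y. batch_entries (dec code R Y)) / ereal (real L)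
      \<le> ereal (62210448 * O_tilde F (real (lam * mu)) R0)" by simp
qed

end

theorem theorem1:
  shows "\<exists>C::real. C > 0 \<and>
    (\<forall>(F :: 'a ring) (lam::nat) (kap::nat) (mu::nat) (S::nat) (ell::nat) (Kc::nat) (L::nat) (R::nat).
       field F \<and> finite (carrier F) \<and>
       lam > 0 \<and> kap > 0 \<and> mu > 0 \<and> S > 0 \<and> ell > 0 \<and> Kc > 0 \<and>
       L = ell * Kc \<and> R = (ell + 1) * Kc - 1 \<and>
       int L \<le> int (card (carrier F)) - int S \<and> S \<ge> (ell + 1) * Kc - 1 \<longrightarrow>
       (\<exists>c :: 'a cdbmm_code.
          is_cdbmm_code F S L lam kap mu c \<and>
          recovery_threshold F S L lam kap mu c = R \<and>
          upload_cost_A S L lam kap c = real S / real Kc \<and>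
          upload_cost_B S L kap mu c = real S / real Kc \<and>
          download_cost F S L lam kap mu c = (real (ell + 1) * real Kc - 1) / (real ell * real Kc) \<and>
          (\<forall>s\<in>{1..S}. server_complexity F L c s
             \<le> ereal (C * (real (lam * kap * mu) / real Kc))) \<and>
          encoding_complexity_A F S L lam kap c
             \<le> ereal (C * O_tilde F (real (lam * kap * S) / real Kc) S) \<and>
          encoding_complexity_B F S L kap mu c
             \<le> ereal (C * O_tilde F (real (kap * mu * S) / real Kc) S) \<and>
          decoding_complexity F S L lam kap mu c
             \<le> ereal (C * O_tilde F (real (lam * mu)) R)))"
proof (intro exI[of _ 62210448] conjI allI impI)
  \<comment> \<open>The largest of the constants, that of decoding:
    \<open>2 * 3 * 10368408\<close>.\<close>
  show "(62210448::real) > 0" by simp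
  fix F :: "'a ring" and lam kap mu S ell Kc L R :: nat
  assume H: "field F \<and> finite (carrier F) \<and>
       lam > 0 \<and> kap > 0 \<and> mu > 0 \<and> S > 0 \<and> ell > 0 \<and> Kc > 0 \<and>
       L = ell * Kc \<and> R = (ell + 1) * Kc - 1 \<and>
       int L \<le> int (card (carrier F)) - int S \<and> S \<ge> (ell + 1) * Kc - 1"
  then have L: "L = ell * Kc" and R: "R = (ell + 1) * Kc - 1" by auto
  have F: "field F" "finite (carrier F)" using H by auto
  obtain \<gamma> where gamma: "\<gamma> \<in> carrier F" "\<gamma> \<noteq> \<zero>\<^bsub>F\<^esub>"
    "\<forall>i<card (carrier F) - 1. \<forall>j<card (carrier F) - 1. \<gamma> [^]\<^bsub>F\<^esub> i = \<gamma> [^]\<^bsub>F\<^esub> j \<longrightarrow> i = j"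
    "\<forall>i\<in>{1..card (carrier F) - 1}. \<forall>j\<in>{1..card (carrier F) - 1}. \<gamma> [^]\<^bsub>F\<^esub> i = \<gamma> [^]\<^bsub>F\<^esub> j \<longrightarrow> i = j"
    using primitive_powers_distinct[OF F] by blast
  have csa: "csa F lam kap mu S ell Kc \<gamma>"
    by (rule csa.intro) (use H F gamma in auto)
  let ?c = "csa_code F (fconst F \<gamma>) lam kap mu ell Kc"
  have O_mono: "ereal (k * O_tilde F x b) \<le> ereal (62210448 * O_tilde F x b)"
    if "k \<le> 62210448" "0 \<le> x" for k x b
    unfolding ereal_less_eq(3) O_tilde_alt using that fft_factor_ge_1[of F b]
    by (intro mult_right_mono) auto
  show "\<exists>c. is_cdbmm_code F S L lam kap mu c \<and>
          recovery_threshold F S L lam kap mu c = R \<and>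
          upload_cost_A S L lam kap c = real S / real Kc \<and>
          upload_cost_B S L kap mu c = real S / real Kc \<and>
          download_cost F S L lam kap mu c = (real (ell + 1) * real Kc - 1) / (real ell * real Kc) \<and>
          (\<forall>s\<in>{1..S}. server_complexity F L c s
             \<le> ereal (62210448 * (real (lam * kap * mu) / real Kc))) \<and>
          encoding_complexity_A F S L lam kap c
             \<le> ereal (62210448 * O_tilde F (real (lam * kap * S) / real Kc) S) \<and>
          encoding_complexity_B F S L kap mu c
             \<le> ereal (62210448 * O_tilde F (real (kap * mu * S) / real Kc) S) \<and>
          decoding_complexity F S L lam kap mu c
             \<le> ereal (62210448 * O_tilde F (real (lam * mu)) R)"
  proof (intro exI[of _ ?c] conjI ballI, unfold L R)
    show "server_complexity F (ell * Kc) ?c s \<le> ereal (62210448 * (real (lam * kap * mu) / real Kc))" for s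
      by (rule order.trans[OF csa.server_complexity_code[OF csa]]) (simp add: divide_right_mono)
    show "encoding_complexity_A F S (ell * Kc) lam kap ?c
        \<le> ereal (62210448 * O_tilde F (real (lam * kap * S) / real Kc) S)"
      by (rule order.trans[OF csa.encoding_complexities(1)[OF csa] O_mono]) simp_all
    show "encoding_complexity_B F S (ell * Kc) kap mu ?c
        \<le> ereal (62210448 * O_tilde F (real (kap * mu * S) / real Kc) S)"
      by (rule order.trans[OF csa.encoding_complexities(2)[OF csa] O_mono]) simp_all
  qed (rule csa.code_is_cdbmm_code[OF csa] csa.recovery_threshold_code[OF csa] csa.upload_costs[OF csa]
      csa.download_cost_code[OF csa] csa.decoding_complexity_code[OF csa])+
qed

end
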